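(* Let $0\le p\le n$. The spectrum of $\tilde\Box_p$ consists of all numbers $m+p$ for $m=0,1,2,\dots$, where $m+p$ has multiplicity $\binom{n+m-1}{n-1}\binom np$.
   Context: $n\ge1$. $A^2(\mathbb C^n,e^{-|z|^2})$ is the Fock space of entire functions $f$ with $\|f\|^2=\int_{\mathbb C^n}|f|^2e^{-|z|^2}\,d\lambda<\infty$, a Hilbert space. $A^2_{(p,0)}(\mathbb C^n,e^{-|z|^2})$ is the Hilbert space of $(p,0)$-forms $f=\sum'_{|J|=p}f_J\,dz_J$ (sum over strictly increasing multi-indices $J$ of length $p$) with coefficients $f_J\in A^2(\mathbb C^n,e^{-|z|^2})$ and $\|f\|^2=\sum'_{|J|=p}\|f_J\|^2$. The densely defined operator $\partial f=\sum'_{|J|=p}\sum_{j=1}^n\frac{\partial f_J}{\partial z_j}\,dz_j\wedge dz_J$ has domain $\mathrm{dom}(\partial)=\{f\in A^2_{(p,0)}(\mathbb C^n,e^{-|z|^2}):\partial f\in A^2_{(p+1,0)}(\mathbb C^n,e^{-|z|^2})\}$, and $\partial^*$ is its Hilbert space adjoint. On $(p,0)$-forms, $\tilde\Box_p=\partial^*\partial+\partial\partial^*$ with $\mathrm{dom}(\tilde\Box_p)=\{f\in\mathrm{dom}(\partial)\cap\mathrm{dom}(\partial^* ):\partial f\in\mathrm{dom}(\partial^* )\text{ and }\partial^*f\in\mathrm{dom}(\partial)\}$, a self-adjoint operator on $A^2_{(p,0)}(\mathbb C^n,e^{-|z|^2})$; for $p=0$ it is $\tilde\Box_0=\partial^*\partial$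 and for $p=n$ it is $\tilde\Box_n=\partial\partial^*$. Multiplicity of an eigenvalue means the dimension of its eigenspace. *)

theory Defs
  imports "HOL-Analysis.Analysis" "HOL-Library.Function_Algebras"
begin

section \<open>The Fock space\<close>

definition entire :: "(complex^'n \<Rightarrow> complex) \<Rightarrow> bool" where
  "entire f \<longleftrightarrow>
    (\<forall>z. \<exists>D. (f has_derivative D) (at z) \<and> (\<forall>c v. D (c *s v) = c * D v))"

definition partial_z :: "'n \<Rightarrow> (complex^'n \<Rightarrow> complex) \<Rightarrow> complex^'n \<Rightarrow> complex" where
  "partial_z j f z = deriv (\<lambda>w. f (z + axis j w)) 0"

definition fock_space :: "(complex^'n \<Rightarrow> complex) set" where
  "fock_space =
    {f. entire f \<and> integrable lborel (\<lambda>z. (cmod (f z))\<^sup>2 * exp (- (norm z)\<^sup>2))}"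

definition fock_inner :: "(complex^'n \<Rightarrow> complex) \<Rightarrow> (complex^'n \<Rightarrow> complex) \<Rightarrow> complex" where
  "fock_inner f g = (LINT z|lborel. f z * cnj (g z) * of_real (exp (- (norm z)\<^sup>2)))"

definition fock_norm :: "(complex^'n \<Rightarrow> complex) \<Rightarrow> real" where
  "fock_norm f = sqrt (LINT z|lborel. (cmod (f z))\<^sup>2 * exp (- (norm z)\<^sup>2))"


section \<open>Forms of type (p,0)\<close>

text \<open>
  The coordinates of \<open>complex^'n\<close> are indexed by the linearly ordered finite type \<open>'n\<close>, so
  a strictly increasing multi-index of length \<open>p\<close> is the same thing as a set \<open>J :: 'n set\<close>
  with \<open>card J = p\<close>. A form is given by its coefficients, \<open>f J\<close> being the coefficient of
  \<open>dz_J\<close>. Forms of all degrees share this type; a form of degree \<open>p\<close> has \<open>f J = 0\<close> unless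
  \<open>card J = p\<close>. In particular, the only form of degree greater than \<open>CARD('n)\<close> is \<open>0\<close>.
\<close>

type_synonym 'n form = "'n set \<Rightarrow> complex^'n \<Rightarrow> complex"

definition fock_forms :: "nat \<Rightarrow> 'n::finite form set" where
  "fock_forms p =
    {f. (\<forall>J. card J = p \<longrightarrow> f J \<in> fock_space) \<and> (\<forall>J. card J \<noteq> p \<longrightarrow> f J = 0)}"

definition form_inner :: "'n::finite form \<Rightarrow> 'n form \<Rightarrow> complex" where
  "form_inner f g = (\<Sum>J\<in>UNIV. fock_inner (f J) (g J))"

definition form_norm :: "'n::finite form \<Rightarrow> real" where
  "form_norm f = sqrt (\<Sum>J\<in>UNIV. (fock_norm (f J))\<^sup>2)"

definition form_scale :: "complex \<Rightarrow> 'n form \<Rightarrow> 'n form" where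
  "form_scale c f = (\<lambda>J z. c * f J z)"

interpretation form: vector_space form_scale
  by unfold_locales (simp_all add: form_scale_def fun_eq_iff algebra_simps)

text \<open>The coefficient of \<open>dz_K\<close> in \<open>dz_j \<and> dz_J\<close>: moving \<open>dz_j\<close> to its place in the
  increasing order passes the factors \<open>dz_i\<close> with \<open>i \<in> J\<close> and \<open>i < j\<close>.\<close>

definition wedge_coeff :: "'n::{finite,linorder} \<Rightarrow> 'n set \<Rightarrow> 'n set \<Rightarrow> complex" where
  "wedge_coeff j J K =
    (if j \<notin> J \<and> K = insert j J then (- 1) ^ card {i \<in> J. i < j} else 0)"

definition del :: "'n::{finite,linorder} form \<Rightarrow> 'n form" where
  "del f = (\<lambda>K z. \<Sum>J\<in>UNIV. \<Sum>j\<in>UNIV. partial_z j (f J) z * wedge_coeff j J K)"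

definition del_dom :: "nat \<Rightarrow> 'n::{finite,linorder} form set" where
  "del_dom p = {f \<in> fock_forms p. del f \<in> fock_forms (Suc p)}"


section \<open>Unbounded operators\<close>

text \<open>An operator is given by its domain \<open>D\<close> and its action \<open>T\<close> on \<open>D\<close>; the Hilbert spaces
  between which it acts are the sets \<open>H\<^sub>1\<close> and \<open>H\<^sub>2\<close>. The vector \<open>h\<close> in the definition of the
  adjoint is unique when \<open>D\<close> is dense in \<open>H\<^sub>1\<close>.\<close>

definition adjoint_dom ::
    "'n::finite form set \<Rightarrow> 'n form set \<Rightarrow> 'n form set \<Rightarrow> ('n form \<Rightarrow> 'n form) \<Rightarrow> 'n form set" where
  "adjoint_dom H\<^sub>1 H\<^sub>2 D T =
    {g \<in> H\<^sub>2. \<exists>h\<in>H\<^sub>1. \<forall>f\<in>D. form_inner (T f) g = form_inner f h}"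

definition adjoint_op ::
    "'n::finite form set \<Rightarrow> 'n form set \<Rightarrow> ('n form \<Rightarrow> 'n form) \<Rightarrow> 'n form \<Rightarrow> 'n form" where
  "adjoint_op H\<^sub>1 D T g =
    (THE h. h \<in> H\<^sub>1 \<and> (\<forall>f\<in>D. form_inner (T f) g = form_inner f h))"

definition resolvent_set ::
    "'n::finite form set \<Rightarrow> 'n form set \<Rightarrow> ('n form \<Rightarrow> 'n form) \<Rightarrow> complex set" where
  "resolvent_set H D T =
    {c. bij_betw (\<lambda>f. T f - form_scale c f) D H \<and>
        (\<exists>B. \<forall>f\<in>D. form_norm f \<le> B * form_norm (T f - form_scale c f))}"

definition op_spectrum ::
    "'n::finite form set \<Rightarrow> 'n form set \<Rightarrow> ('n form \<Rightarrow> 'n form) \<Rightarrow> complex set" where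
  "op_spectrum H D T = - resolvent_set H D T"

definition eigenspace ::
    "'n form set \<Rightarrow> ('n form \<Rightarrow> 'n form) \<Rightarrow> complex \<Rightarrow> 'n form set" where
  "eigenspace D T c = {f \<in> D. T f = form_scale c f}"

text \<open>\<open>form.dim\<close> assigns \<open>0\<close> to infinite-dimensional spaces, so \<open>multiplicity_of D T c = k\<close>
  with \<open>k > 0\<close> means that the eigenspace is finite-dimensional of dimension exactly \<open>k\<close>.\<close>

definition multiplicity_of ::
    "'n form set \<Rightarrow> ('n form \<Rightarrow> 'n form) \<Rightarrow> complex \<Rightarrow> nat" where
  "multiplicity_of D T c = form.dim (eigenspace D T c)"


section \<open>The Laplacian of the operator \<open>del\<close>\<close>

text \<open>\<open>del_adj p\<close> is the adjoint of \<open>del\<close> acting from forms of degree \<open>p\<close> to forms of degree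
  \<open>p + 1\<close>; its own arguments have degree \<open>p + 1\<close>. In degree
  \<open>0\<close> the Laplacian has no \<open>del del*\<close> part; in degree \<open>CARD('n)\<close> its \<open>del* del\<close> part is \<open>0\<close>,
  since there are no nonzero forms of degree \<open>CARD('n) + 1\<close>.\<close>

definition del_adj_dom :: "nat \<Rightarrow> 'n::{finite,linorder} form set" where
  "del_adj_dom p = adjoint_dom (fock_forms p) (fock_forms (Suc p)) (del_dom p) del"

definition del_adj :: "nat \<Rightarrow> 'n::{finite,linorder} form \<Rightarrow> 'n form" where
  "del_adj p = adjoint_op (fock_forms p) (del_dom p) del"

fun laplacian_domain :: "nat \<Rightarrow> 'n::{finite,linorder} form set" where
  "laplacian_domain 0 = {f \<in> del_dom 0. del f \<in> del_adj_dom 0}"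
| "laplacian_domain (Suc q) =
    {f \<in> del_dom (Suc q) \<inter> del_adj_dom q.
       del f \<in> del_adj_dom (Suc q) \<and> del_adj q f \<in> del_dom q}"

fun laplacian :: "nat \<Rightarrow> 'n::{finite,linorder} form \<Rightarrow> 'n form" where
  "laplacian 0 f = del_adj 0 (del f)"
| "laplacian (Suc q) f = del_adj (Suc q) (del f) + del (del_adj q f)"

end

(*
  On the Fock space multiplication by z_j is adjoint to d/dz_j, so the adjoint of del is contraction
  with the Euler field, and by Cartan's formula the Laplacian acts on forms of degree p as the Euler
  operator plus p. Hence everything decomposes along the homogeneous expansion of the coefficients:
  an entire function is the locally uniform sum of homogeneous polynomials f_m, which are pairwise
  orthogonal because the Gaussian measure is rotation invariant, and the Laplacian multiplies the
  component of degree m by m + p. Its domain consists of the forms for which the sum of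
  (m + p)^2 |f_m|^2 converges, so outside the numbers m + p the resolvent is obtained by dividing
  the components, and the eigenspace of m + p consists of the forms whose coefficients are
  homogeneous polynomials of degree m.
*)

theory Submission
  imports Defs "HOL-Complex_Analysis.Complex_Analysis"
begin

text \<open>Entire functions are given only by complex differentiability at each point, and
  multiplication by a coordinate is unbounded, so the argument keeps returning to polynomials. The
  components are Taylor coefficients along complex lines through 0; that they are polynomials is a
  step of its own, by Liouville's theorem on coordinate lines and interpolation. Cauchy's estimate
  on a circle of radius 2 gives the bounds \<open>M / 2 ^ m\<close> on balls that justify all
  termwise operations. The expansion converges uniformly only on bounded sets, so Parseval's
  identity is proved on balls and extended by monotone convergence; from then on, membership in the
  Fock space means summability of the component norms. The adjoint is found by testing against
  homogeneous forms, which lie in the domain of \<open>del\<close>, and this also determines its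
  exact domain. Besides \<open>f\<close> itself, four forms built from \<open>f\<close> must be
  square integrable for \<open>f\<close> to lie in the domain of the Laplacian; one weight controls
  all four, because \<open>del\<close> and \<open>contr\<close> leave \<open>m + p\<close>
  unchanged.\<close>

section \<open>Integration on Euclidean spaces\<close>

lemma integrable_translate_iff:
  fixes f :: "'a::euclidean_space \<Rightarrow> 'b::{banach, second_countable_topology}"
  assumes "f \<in> borel_measurable borel"
  shows "integrable lborel (\<lambda>x. f (x + c)) \<longleftrightarrow> integrable lborel f"
  using integrable_distr_eq[of "(+) c" lborel borel f] assms
  by (simp add: lborel_distr_plus add.commute)

lemma integral_translate:
  fixes f :: "'a::euclidean_space \<Rightarrow> 'b::{banach, second_countable_topology}"
  assumes "f \<in> borel_measurable borel"
  shows "(LINT x|lborel. f (x + c)) = (LINT x|lborel. f x)"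
  using integral_distr[of "(+) c" lborel borel f] assms
  by (simp add: lborel_distr_plus add.commute)

lemma nn_integral_translate:
  fixes f :: "'a::euclidean_space \<Rightarrow> ennreal"
  assumes "f \<in> borel_measurable borel"
  shows "(\<integral>\<^sup>+x. f (x + c) \<partial>lborel) = (\<integral>\<^sup>+x. f x \<partial>lborel)"
  using nn_integral_distr[of "(+) c" lborel borel f] assms
  by (simp add: lborel_distr_plus add.commute)

text \<open>Averaging \<open>f'\<close> over the translates by \<open>t *\<^sub>R v\<close> with
  \<open>t\<close> in the unit interval does not change its integral. By Fubini and the fundamental
  theorem of calculus the average is \<open>f (z + v) - f z\<close>, whose integral vanishes by
  translation invariance. Integrability of \<open>f\<close> thus takes the place of vanishing
  boundary terms.\<close>

lemma integral_directional_derivative: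
  fixes f f' :: "'a::euclidean_space \<Rightarrow> complex"
  assumes der: "\<And>z t. ((\<lambda>t. f (z + t *\<^sub>R v)) has_vector_derivative f' (z + t *\<^sub>R v)) (at t)"
    and cont: "continuous_on UNIV f'"
    and int: "integrable lborel f" and int': "integrable lborel f'"
  shows "(LINT z|lborel. f' z) = 0"
proof -
  have m[measurable]: "f' \<in> borel_measurable borel"
    using cont by (rule borel_measurable_continuous_onI)
  have mf[measurable]: "f \<in> borel_measurable borel" using int by auto
  define g where "g = (\<lambda>t z. indicat_real {0..1} t *\<^sub>R f' (z + t *\<^sub>R v))"
  have gm: "case_prod g \<in> borel_measurable (lborel \<Otimes>\<^sub>M lborel)"
    unfolding g_def by measurable
  have I: "integrable (lborel \<Otimes>\<^sub>M lborel) (case_prod g)"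
  proof (rule lborel_pair.Fubini_integrable[OF gm])
    show "AE x in lborel. integrable lborel (\<lambda>y. case (x, y) of (t, z) \<Rightarrow> g t z)"
      unfolding g_def by (auto simp: integrable_translate_iff int')
    have "(LINT y|lborel. norm (case (x, y) of (t, z) \<Rightarrow> g t z))
        = indicat_real {0..1} x *\<^sub>R (LINT y|lborel. norm (f' y))" for x
      unfolding g_def using integral_translate[of "\<lambda>y. norm (f' y)"] by simp
    moreover have "integrable lborel (\<lambda>x::real. indicat_real {0..1} x *\<^sub>R (LINT y|lborel. norm (f' y)))"
      by (intro integrable_scaleR_left integrable_real_indicator) auto
    ultimately show "integrable lborel (\<lambda>x. LINT y|lborel. norm (case (x, y) of (t, z) \<Rightarrow> g t z))"
      by simp
  qed
  have A: "(LINT t|lborel. g t z) = f (z + v) - f z" for z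
  proof -
    have "continuous_on {0..1} (\<lambda>t. f' (z + t *\<^sub>R v))"
      by (rule continuous_on_compose2[OF cont]) (auto intro!: continuous_intros)
    from integral_FTC_atLeastAtMost[of 0 1 "\<lambda>t. f (z + t *\<^sub>R v)" "\<lambda>t. f' (z + t *\<^sub>R v)", OF _ _ this]
    show ?thesis unfolding g_def using has_vector_derivative_at_within[OF der] by simp
  qed
  have "(LINT z|lborel. (LINT t|lborel. g t z)) = (LINT t|lborel. (LINT z|lborel. g t z))"
    using lborel_pair.Fubini_integral[OF I] by simp
  also have "\<dots> = (LINT t|lborel. indicat_real {0..1::real} t *\<^sub>R (LINT z|lborel. f' z))"
    unfolding g_def by (simp add: integral_translate)
  also have "\<dots> = (LINT z|lborel. f' z)"
    by (subst integral_scaleR_left) (auto intro: integrable_real_indicator)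
  finally have "(LINT z|lborel. f' z) = (LINT z|lborel. f (z + v) - f z)" by (simp add: A)
  also have "\<dots> = 0"
    by (subst Bochner_Integration.integral_diff) (auto simp: integrable_translate_iff integral_translate int)
  finally show ?thesis .
qed

text \<open>Uniqueness of Haar measure: the image measure is translation invariant, and comparing both
  measures on the product of a set with the unit ball, which \<open>T\<close> fixes, shows that they agree.\<close>

lemma lborel_distr_linear_isometry:
  fixes T :: "'a::euclidean_space \<Rightarrow> 'a"
  assumes lin: "linear T" and nrm: "\<And>x. norm (T x) = norm x"
  shows "distr lborel borel T = lborel"
proof -
  have inj: "inj T"
    unfolding linear_injective_0[OF lin] using nrm by (metis norm_eq_zero)
  have surj: "surj T" using linear_inj_imp_surj[OF lin inj] .
  have T[measurable]: "T \<in> borel_measurable borel"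
    using lin by (intro borel_measurable_continuous_onI linear_continuous_on linear_conv_bounded_linear[THEN iffD1])
  define N where "N = distr lborel borel T"
  have sN[measurable_cong]: "sets N = sets borel" by (simp add: N_def)
  have trN: "(\<integral>\<^sup>+x. f (x + c) \<partial>N) = (\<integral>\<^sup>+x. f x \<partial>N)" if [measurable]: "f \<in> borel_measurable borel" for f c
  proof -
    obtain d where d: "c = T d" using surj by blast
    have "(\<integral>\<^sup>+x. f (x + c) \<partial>N) = (\<integral>\<^sup>+x. f (T x + T d) \<partial>lborel)"
      unfolding N_def d by (subst nn_integral_distr) auto
    also have "\<dots> = (\<integral>\<^sup>+x. f (T (x + d)) \<partial>lborel)"
      by (simp add: linear_add[OF lin])
    also have "\<dots> = (\<integral>\<^sup>+x. f (T x) \<partial>lborel)"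
      by (rule nn_integral_translate) measurable
    also have "\<dots> = (\<integral>\<^sup>+x. f x \<partial>N)"
      unfolding N_def by (subst nn_integral_distr) auto
    finally show ?thesis .
  qed
  define A where "A = ball (0::'a) 1"
  have A[measurable]: "A \<in> sets borel" by (simp add: A_def)
  have NA: "emeasure N A = emeasure lborel A"
  proof -
    have "T -` A = A" by (auto simp: A_def nrm)
    then show ?thesis unfolding N_def by (subst emeasure_distr) auto
  qed
  have fin: "emeasure lborel A < \<infinity>" unfolding A_def by (rule emeasure_lborel_ball_finite)
  have pos: "emeasure lborel A > 0"
  proof -
    have "\<not> negligible A" unfolding A_def by (simp add: open_not_negligible)
    moreover have "A \<in> null_sets lebesgue \<longleftrightarrow> A \<in> null_sets lborel"
      by (simp add: null_sets_completion_iff)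
    ultimately have "A \<notin> null_sets lborel" by (simp add: negligible_iff_null_sets)
    then show ?thesis by (auto simp: null_sets_def zero_less_iff_neq_zero)
  qed
  have sfN: "sigma_finite_measure N"
  proof
    show "\<exists>B. countable B \<and> B \<subseteq> sets N \<and> \<Union> B = space N \<and> (\<forall>a\<in>B. emeasure N a \<noteq> \<infinity>)"
    proof (intro exI[of _ "range (\<lambda>n. ball (0::'a) (real n))"] conjI ballI)
      show "\<Union> (range (\<lambda>n. ball (0::'a) (real n))) = space N"
        by (auto simp: N_def reals_Archimedean2)
      fix a assume "a \<in> range (\<lambda>n. ball (0::'a) (real n))"
      then obtain n where a: "a = ball 0 (real n)" by auto
      have "T -` a = a" by (auto simp: a nrm)
      then have "emeasure N a = emeasure lborel a" unfolding N_def by (subst emeasure_distr) (auto simp: a)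
      then show "emeasure N a \<noteq> \<infinity>" using emeasure_lborel_ball_finite[of "0::'a" "real n"] by (auto simp: a less_top)
    qed (auto simp: sN)
  qed
  interpret pair_sigma_finite lborel N
    by (simp add: pair_sigma_finite_def sfN sigma_finite_lborel)
  have main: "emeasure N B = emeasure lborel B" if B[measurable]: "B \<in> sets borel" for B
  proof -
    have [measurable]: "(\<lambda>(x,y). indicator A x * indicator B (x + y) :: ennreal) \<in> borel_measurable (lborel \<Otimes>\<^sub>M N)"
      "(\<lambda>(x,y). indicator A (x - y) * indicator B x :: ennreal) \<in> borel_measurable (lborel \<Otimes>\<^sub>M N)"
      by measurable
    \<comment> \<open>The double integral of \<open>indicator A x * indicator B (x + y)\<close> is
      evaluated in two ways: invariance of \<open>N\<close> in \<open>y\<close> gives this product,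
      and translating \<open>x\<close> by \<open>y\<close> gives the product with the two measures
      exchanged.\<close>
    have "emeasure lborel A * emeasure N B = (\<integral>\<^sup>+x. indicator A x * emeasure N B \<partial>lborel)"
      by (simp add: nn_integral_multc)
    also have "\<dots> = (\<integral>\<^sup>+x. (\<integral>\<^sup>+y. indicator A x * indicator B (y + x) \<partial>N) \<partial>lborel)"
      using trN[of "indicator B"] by (simp add: nn_integral_cmult sN)
    also have "\<dots> = (\<integral>\<^sup>+y. (\<integral>\<^sup>+x. indicator A x * indicator B (x + y) \<partial>lborel) \<partial>N)"
        using Fubini'[of "\<lambda>x y. indicator A x * indicator B (x + y)"] by (simp add: add.commute)
    also have "\<dots> = (\<integral>\<^sup>+y. (\<integral>\<^sup>+x. indicator A (x - y) * indicator B x \<partial>lborel) \<partial>N)"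
    proof (rule nn_integral_cong)
      fix y
      show "(\<integral>\<^sup>+x. indicator A x * indicator B (x + y) \<partial>lborel) = (\<integral>\<^sup>+x. indicator A (x - y) * indicator B x \<partial>lborel)"
        using nn_integral_translate[of "\<lambda>x. indicator A (x - y) * indicator B x" y] by simp
    qed
    also have "\<dots> = (\<integral>\<^sup>+x. (\<integral>\<^sup>+y. indicator A (x - y) * indicator B x \<partial>N) \<partial>lborel)"
      using Fubini'[of "\<lambda>x y. indicator A (x - y) * indicator B x"] by simp
    also have "\<dots> = (\<integral>\<^sup>+x. emeasure N A * indicator B x \<partial>lborel)"
    \<comment> \<open>The unit ball is symmetric, so \<open>x - y\<close> may be replaced by
      \<open>y - x\<close>, to which the translation invariance of \<open>N\<close> applies.\<close>
    proof (rule nn_integral_cong)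
      fix x
      have "(\<integral>\<^sup>+y. indicator A (x - y) \<partial>N) = (\<integral>\<^sup>+y. indicator A (y + (- x)) \<partial>N)"
        by (intro nn_integral_cong) (auto simp: A_def indicator_def norm_minus_commute dist_norm)
      also have "\<dots> = emeasure N A" by (subst trN[of "indicator A"]) (auto simp: sN)
      finally show "(\<integral>\<^sup>+y. indicator A (x - y) * indicator B x \<partial>N) = emeasure N A * indicator B x"
        by (subst nn_integral_multc) auto
    qed
    also have "\<dots> = emeasure lborel A * emeasure lborel B"
      by (simp add: nn_integral_cmult NA)
    finally show ?thesis using pos fin by (auto simp: ennreal_mult_cancel_left)
  qed
  show ?thesis unfolding N_def[symmetric]
    by (rule measure_eqI) (auto simp: sN main)
qed

lemma nn_integral_linear_isometry:
  fixes T :: "'a::euclidean_space \<Rightarrow> 'a"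
  assumes lin: "linear T" and nrm: "\<And>x. norm (T x) = norm x" and f: "f \<in> borel_measurable borel"
  shows "(\<integral>\<^sup>+x. f (T x) \<partial>lborel) = (\<integral>\<^sup>+x. f x \<partial>lborel)"
proof -
  have T: "T \<in> borel_measurable borel"
    using lin by (intro borel_measurable_continuous_onI linear_continuous_on linear_conv_bounded_linear[THEN iffD1])
  show ?thesis
    using nn_integral_distr[of T lborel borel f] T f lborel_distr_linear_isometry[OF lin nrm] by simp
qed

lemma integral_linear_isometry:
  fixes T :: "'a::euclidean_space \<Rightarrow> 'a" and f :: "'a \<Rightarrow> 'b::{banach, second_countable_topology}"
  assumes lin: "linear T" and nrm: "\<And>x. norm (T x) = norm x" and f: "f \<in> borel_measurable borel"
  shows "(LINT x|lborel. f (T x)) = (LINT x|lborel. f x)"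
proof -
  have T: "T \<in> borel_measurable borel"
    using lin by (intro borel_measurable_continuous_onI linear_continuous_on linear_conv_bounded_linear[THEN iffD1])
  show ?thesis
    using integral_distr[of T lborel borel f] T f lborel_distr_linear_isometry[OF lin nrm] by simp
qed

section \<open>Integrability against Gaussian weights\<close>

lemma nn_integral_exp_neg_square_finite:
  fixes a :: real assumes a: "a > 0"
  shows "(\<integral>\<^sup>+x. ennreal (exp (- (a * (x::real)\<^sup>2))) \<partial>lborel) < \<infinity>"
proof -
  \<comment> \<open>Completing the square bounds \<open>- (a * x\<^sup>2)\<close> by
    \<open>1 / (4 * a) - \<bar>x\<bar>\<close>, which replaces the Gaussian by a two-sided
    exponential with an elementary primitive.\<close>
  define C where "C = exp (1 / (4 * a))"
  have half: "(\<integral>\<^sup>+x. ennreal (exp (- x)) * indicator {0..} x \<partial>lborel) = ennreal (0 - (- exp (- 0)))"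
  proof (rule nn_integral_FTC_atLeast)
    show "((\<lambda>x::real. - exp (- x)) \<longlongrightarrow> 0) at_top"
      using tendsto_minus[OF filterlim_compose[OF exp_at_bot filterlim_uminus_at_bot_at_top]] by simp
  qed (auto intro!: derivative_eq_intros)
  have half': "(\<integral>\<^sup>+x. ennreal (exp x) * indicator {0..} (- x) \<partial>lborel) = ennreal (0 - (- exp (- 0)))"
    using nn_integral_linear_isometry[of "\<lambda>x::real. - x" "\<lambda>x. ennreal (exp (- x)) * indicator {0..} x"] half
    by (simp add: module_hom_uminus linear_uminus)
  have le: "- (a * x\<^sup>2) \<le> 1 / (4 * a) - \<bar>x\<bar>" for x :: real
  proof -
    have "0 \<le> a * (\<bar>x\<bar> - 1 / (2*a))\<^sup>2" using a by simp
    also have "\<dots> = a * x\<^sup>2 - \<bar>x\<bar> + 1 / (4 * a)"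
      using a by (simp add: power2_eq_square field_simps)
    finally show ?thesis by simp
  qed
  have "(\<integral>\<^sup>+x. ennreal (exp (- (a * (x::real)\<^sup>2))) \<partial>lborel) \<le>
      (\<integral>\<^sup>+x. ennreal C * (ennreal (exp (- x)) * indicator {0..} x + ennreal (exp x) * indicator {0..} (- x)) \<partial>lborel)"
  proof (intro nn_integral_mono)
    fix x :: real
    have "exp (- (a * x\<^sup>2)) \<le> C * exp (- \<bar>x\<bar>)" unfolding C_def using le[of x] by (simp flip: exp_add)
    then have "ennreal (exp (- (a * x\<^sup>2))) \<le> ennreal C * ennreal (exp (- \<bar>x\<bar>))"
      by (simp add: C_def flip: ennreal_mult)
    also have "\<dots> \<le> ennreal C * (ennreal (exp (- x)) * indicator {0..} x + ennreal (exp x) * indicator {0..} (- x))"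
      by (intro mult_left_mono) (auto simp: indicator_def)
    finally show "ennreal (exp (- (a * x\<^sup>2))) \<le> ennreal C * (ennreal (exp (- x)) * indicator {0..} x + ennreal (exp x) * indicator {0..} (- x))" .
  qed
  also have "\<dots> = ennreal C * ((\<integral>\<^sup>+x. ennreal (exp (- x)) * indicator {0..} x \<partial>lborel) +
      (\<integral>\<^sup>+x. ennreal (exp x) * indicator {0..} (- x) \<partial>lborel))"
    by (subst nn_integral_cmult, measurable, subst nn_integral_add) auto
  also have "\<dots> < \<infinity>"
    unfolding half half' by (simp add: ennreal_mult_less_top)
  finally show ?thesis .
qed

lemma integrable_gaussian:
  fixes a :: real assumes a: "a > 0"
  shows "integrable lborel (\<lambda>z::'a::euclidean_space. exp (- (a * (norm z)\<^sup>2)))"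
proof (rule integrableI_nonneg)
  have "ennreal (exp (- (a * (norm z)\<^sup>2))) = (\<Prod>b\<in>Basis. ennreal (exp (- (a * (z \<bullet> b)\<^sup>2))))" for z :: 'a
    by (simp add: prod_ennreal power2_norm_eq_inner euclidean_inner[of z z] power2_eq_square[symmetric]
        sum_distrib_left flip: exp_sum sum_negf)
  then have "(\<integral>\<^sup>+z. ennreal (exp (- (a * (norm (z::'a))\<^sup>2))) \<partial>lborel) = (\<Prod>b\<in>(Basis::'a set). (\<integral>\<^sup>+x. ennreal (exp (- (a * x\<^sup>2))) \<partial>lborel))"
    using nn_integral_lborel_prod[of "\<lambda>b x. ennreal (exp (- (a * x\<^sup>2)))"] by simp
  also have "\<dots> < \<infinity>"
    using nn_integral_exp_neg_square_finite[OF a] by (simp add: power_less_top_ennreal)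
  finally show "(\<integral>\<^sup>+z. ennreal (exp (- (a * (norm (z::'a))\<^sup>2))) \<partial>lborel) < \<infinity>" .
qed auto

text \<open>Half of the Gaussian exponent absorbs the polynomial factor, and the other half remains
  integrable.\<close>

lemma integrable_polynomial_growth_gaussian:
  fixes f :: "'a::euclidean_space \<Rightarrow> 'b::{banach, second_countable_topology}"
  assumes m: "f \<in> borel_measurable borel" and b: "\<And>z. norm (f z) \<le> C * (1 + norm z) ^ k"
  shows "integrable lborel (\<lambda>z. exp (- (norm z)\<^sup>2) *\<^sub>R f z)"
proof -
  \<comment> \<open>One term of the exponential series gives
    \<open>(1 + x) ^ k \<le> fact k * exp (1 + x)\<close>, and \<open>1 + x - x\<^sup>2 / 2\<close>
    has the maximum 3/2, attained at \<open>x = 1\<close>.\<close>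
  define B where "B = fact k * exp (3/2 :: real)"
  have B: "(1 + x) ^ k * exp (- (x\<^sup>2) / 2) \<le> B" if x: "x \<ge> 0" for x :: real
  proof -
    have "(\<Sum>n\<in>{k}. (1 + x) ^ n /\<^sub>R fact n) \<le> exp (1 + x)"
      unfolding exp_def by (rule sum_le_suminf) (use x in \<open>auto intro: summable_exp\<close>)
    then have "(1 + x) ^ k \<le> fact k * exp (1 + x)" by (simp add: field_simps)
    then have "(1 + x) ^ k * exp (- (x\<^sup>2) / 2) \<le> fact k * exp (1 + x) * exp (- (x\<^sup>2) / 2)"
      by (rule mult_right_mono) simp
    also have "\<dots> = fact k * exp (1 + x - x\<^sup>2 / 2)" by (simp flip: exp_add)
    also have "\<dots> \<le> B"
    proof -
      have "0 \<le> (x - 1)\<^sup>2" by simp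
      then have "1 + x - x\<^sup>2 / 2 \<le> 3/2" by (simp add: power2_eq_square algebra_simps)
      then show ?thesis unfolding B_def by simp
    qed
    finally show ?thesis .
  qed
  show ?thesis
  proof (rule Bochner_Integration.integrable_bound)
    show "integrable lborel (\<lambda>z::'a. (\<bar>C\<bar> * B) * exp (- ((1/2) * (norm z)\<^sup>2)))"
      by (intro integrable_mult_right integrable_gaussian) simp
    show "AE x in lborel. norm (exp (- (norm x)\<^sup>2) *\<^sub>R f x) \<le> norm (\<bar>C\<bar> * B * exp (- (1/2 * (norm x)\<^sup>2)))"
    proof (intro always_eventually allI)
      fix z :: 'a
      have "norm (exp (- (norm z)\<^sup>2) *\<^sub>R f z) \<le> exp (- (norm z)\<^sup>2) * (\<bar>C\<bar> * (1 + norm z) ^ k)"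
        using b[of z] by (auto intro!: mult_left_mono order_trans[OF b] mult_right_mono)
      also have "\<dots> = \<bar>C\<bar> * ((1 + norm z) ^ k * exp (- ((norm z)\<^sup>2) / 2)) * exp (- (1/2 * (norm z)\<^sup>2))"
        by (simp flip: exp_add)
      also have "\<dots> \<le> \<bar>C\<bar> * B * exp (- (1/2 * (norm z)\<^sup>2))"
        by (intro mult_right_mono mult_left_mono B) auto
      finally show "norm (exp (- (norm z)\<^sup>2) *\<^sub>R f z) \<le> norm (\<bar>C\<bar> * B * exp (- (1/2 * (norm z)\<^sup>2)))"
        by (smt (verit) real_norm_def)
    qed
  qed (use m in measurable)
qed

section \<open>Complex scaling of vectors\<close>

lemma norm_scalar_mult: "norm (c *s z) = cmod c * norm (z :: complex^'n::finite)"
proof -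
  have "(norm (c *s z))\<^sup>2 = (cmod c * norm z)\<^sup>2"
    by (simp add: norm_vec_def L2_set_def sum_nonneg norm_mult power_mult_distrib sum_distrib_left)
  then show ?thesis
    by (simp add: power2_eq_iff_nonneg)
qed

lemma linear_scalar_mult_left: "linear (\<lambda>t. t *s (v :: complex^'n::finite))"
  by (rule linearI) (simp_all add: vec_eq_iff algebra_simps)

lemma linear_scalar_mult_right: "linear (\<lambda>z. c *s (z :: complex^'n::finite))"
  by (rule linearI) (simp_all add: vec_eq_iff algebra_simps)

lemma has_derivative_scalar_mult_left:
  "((\<lambda>t. a + t *s (v :: complex^'n::finite)) has_derivative (\<lambda>h. h *s v)) F"
  using linear_scalar_mult_left[of v, unfolded linear_conv_bounded_linear]
  by (auto intro!: derivative_eq_intros bounded_linear_imp_has_derivative)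

lemma axis_eq_scalar_mult: "axis j w = w *s (axis j 1 :: complex^'n::finite)"
  by (simp add: vec_eq_iff axis_def)

lemma norm_axis_one [simp]: "norm (axis j 1 :: complex^'n::finite) = 1"
  by (simp add: norm_vec_def L2_set_def axis_def if_distrib[of "\<lambda>x. (norm x)\<^sup>2"] cong: if_cong)

lemma of_real_scalar_mult: "complex_of_real r *s v = r *\<^sub>R (v :: complex^'n::finite)"
  by (simp add: vec_eq_iff scaleR_conv_of_real[symmetric])

lemma shift_axis: "(\<lambda>w. f (z + axis j w)) = (\<lambda>w. f (z + w *s axis j (1::complex)))"
  by (rule ext) (metis axis_eq_scalar_mult)

section \<open>Entire functions\<close>

lemma entireE:
  assumes "entire f"
  obtains D where "\<And>z. (f has_derivative D z) (at z)" "\<And>z c v. D z (c *s v) = c * D z v"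
  using assms unfolding entire_def by metis

lemma entire_continuous_on: "entire f \<Longrightarrow> continuous_on A f"
  unfolding entire_def by (meson continuous_at_imp_continuous_on has_derivative_continuous)

lemma entire_measurable: "entire f \<Longrightarrow> f \<in> borel_measurable borel"
  by (intro borel_measurable_continuous_onI entire_continuous_on)

lemma entire_bounded:
  fixes f :: "complex^'n::finite \<Rightarrow> complex"
  assumes "entire f"
  obtains M where "M \<ge> 0" "\<And>z. norm z \<le> r \<Longrightarrow> cmod (f z) \<le> M"
proof -
  have "compact (f ` cball 0 r)"
    by (intro compact_continuous_image entire_continuous_on assms compact_cball)
  then obtain M where "\<And>w. w \<in> f ` cball 0 r \<Longrightarrow> norm w \<le> M"
    using compact_imp_bounded bounded_iff by metis
  then show ?thesis by (intro that[of "max 0 M"]) (auto simp: le_max_iff_disj)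
qed

text \<open>Complex homogeneity of \<open>D\<close> turns the real derivative into a complex one
  along each complex line; through this the one-variable theory enters.\<close>

lemma has_field_derivative_line:
  fixes f :: "complex^'n::finite \<Rightarrow> complex"
  assumes "(f has_derivative D) (at (a + t *s v))" "\<And>c v. D (c *s v) = c * D v"
  shows "((\<lambda>t. f (a + t *s v)) has_field_derivative D v) (at t)"
proof -
  have "((\<lambda>t. f (a + t *s v)) has_derivative (\<lambda>h. D (h *s v))) (at t)"
    by (rule has_derivative_compose[OF has_derivative_scalar_mult_left assms(1)])
  then show ?thesis
    unfolding has_field_derivative_def by (simp add: assms(2) mult.commute[of _ "D v"] fun_eq_iff)
qed

lemma entire_line_holomorphic:
  fixes f :: "complex^'n::finite \<Rightarrow> complex"
  assumes "entire f"
  shows "(\<lambda>t. f (a + t *s v)) holomorphic_on S"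
proof -
  obtain D where D: "\<And>z. (f has_derivative D z) (at z)" "\<And>z c v. D z (c *s v) = c * D z v"
    using entireE[OF assms] by blast
  show ?thesis
    unfolding holomorphic_on_def field_differentiable_def
    by (blast intro: has_field_derivative_line[OF D] has_field_derivative_at_within)
qed

lemma entire_ray_holomorphic:
  fixes f :: "complex^'n::finite \<Rightarrow> complex"
  assumes "entire f"
  shows "(\<lambda>t. f (t *s v)) holomorphic_on S"
  using entire_line_holomorphic[OF assms, of 0 v] by simp

lemma entire_const [simp]: "entire (\<lambda>z. c)"
  unfolding entire_def by (intro allI exI[of _ "\<lambda>_. 0"]) auto

lemma entire_coord: "entire (\<lambda>z :: complex^'n::finite. z $ j)"
  unfolding entire_def
  by (intro allI exI[of _ "\<lambda>v. v $ j"]) (auto intro: bounded_linear_imp_has_derivative bounded_linear_vec_nth)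

lemma entire_add:
  assumes "entire f" "entire g" shows "entire (\<lambda>z. f z + g z)"
proof -
  obtain D E where D: "\<And>z. (f has_derivative D z) (at z)" "\<And>z c v. D z (c *s v) = c * D z v"
    using entireE[OF assms(1)] by blast
  obtain E where E: "\<And>z. (g has_derivative E z) (at z)" "\<And>z c v. E z (c *s v) = c * E z v"
    using entireE[OF assms(2)] by blast
  show ?thesis unfolding entire_def
    by (intro allI exI[of _ "\<lambda>v. D _ v + E _ v"])
      (auto intro!: derivative_eq_intros D(1) E(1) simp: D(2) E(2) algebra_simps)
qed

lemma entire_mult:
  assumes "entire f" "entire g" shows "entire (\<lambda>z. f z * g z)"
proof -
  obtain D E where D: "\<And>z. (f has_derivative D z) (at z)" "\<And>z c v. D z (c *s v) = c * D z v"
    using entireE[OF assms(1)] by blast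
  obtain E where E: "\<And>z. (g has_derivative E z) (at z)" "\<And>z c v. E z (c *s v) = c * E z v"
    using entireE[OF assms(2)] by blast
  show ?thesis unfolding entire_def
  proof (intro allI)
    fix z
    show "\<exists>F. ((\<lambda>z. f z * g z) has_derivative F) (at z) \<and> (\<forall>c v. F (c *s v) = c * F v)"
      by (intro exI[of _ "\<lambda>v. f z * E z v + D z v * g z"] conjI has_derivative_mult D(1) E(1))
        (simp add: D(2) E(2) algebra_simps)
  qed
qed

lemma entire_cmult: "entire f \<Longrightarrow> entire (\<lambda>z. c * f z)"
  by (rule entire_mult) auto

lemma entire_diff: "entire f \<Longrightarrow> entire g \<Longrightarrow> entire (\<lambda>z. f z - g z)"
  using entire_add[of f "\<lambda>z. (-1) * g z"] entire_cmult[of g "-1"] by simp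

lemma entire_sum: "(\<And>i. i \<in> I \<Longrightarrow> entire (f i)) \<Longrightarrow> entire (\<lambda>z. \<Sum>i\<in>I. f i z)"
  by (induction I rule: infinite_finite_induct) (auto intro: entire_add)

lemma entire_power: "entire f \<Longrightarrow> entire (\<lambda>z. f z ^ k)"
  by (induction k) (auto intro: entire_mult)

lemma entire_prod: "(\<And>i. i \<in> I \<Longrightarrow> entire (f i)) \<Longrightarrow> entire (\<lambda>z. \<Prod>i\<in>I. f i z)"
  by (induction I rule: infinite_finite_induct) (auto intro: entire_mult)

lemma entire_partial_z:
  fixes f :: "complex^'n::finite \<Rightarrow> complex"
  assumes "entire f"
  shows "((\<lambda>w. f (z + w *s axis j 1)) has_field_derivative partial_z j f (z + w *s axis j 1)) (at w)"
proof -
  obtain D where D: "\<And>z. (f has_derivative D z) (at z)" "\<And>z c v. D z (c *s v) = c * D z v"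
    using entireE[OF assms] by blast
  have A: "((\<lambda>w. f (z + w *s axis j 1)) has_field_derivative D (z + w *s axis j 1) (axis j 1)) (at w)" for z w
    by (rule has_field_derivative_line[OF D])
  have "partial_z j f z = D z (axis j 1)" for z
    using DERIV_imp_deriv[OF A[of z 0]] by (simp add: partial_z_def shift_axis)
  then show ?thesis using A by simp
qed

lemma entire_partial_z_at:
  fixes f :: "complex^'n::finite \<Rightarrow> complex"
  assumes "entire f"
  shows "((\<lambda>w. f (z + axis j w)) has_field_derivative partial_z j f z) (at 0)"
  unfolding shift_axis using entire_partial_z[OF assms, of z j 0] by simp

lemma partial_zI: "((\<lambda>w. f (z + axis j w)) has_field_derivative d) (at 0) \<Longrightarrow> partial_z j f z = d"
  unfolding partial_z_def by (rule DERIV_imp_deriv)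

lemma partial_z_const [simp]: "partial_z j (\<lambda>z. c) = (\<lambda>z. 0)"
  by (rule ext, rule partial_zI) simp

lemma partial_z_zero [simp]: "partial_z j 0 = 0"
  using partial_z_const[of j 0] by (simp add: zero_fun_def)

lemma partial_z_add:
  fixes f g :: "complex^'n::finite \<Rightarrow> complex"
  assumes "entire f" "entire g"
  shows "partial_z j (\<lambda>z. f z + g z) z = partial_z j f z + partial_z j g z"
  by (rule partial_zI, rule DERIV_add[OF entire_partial_z_at[OF assms(1)] entire_partial_z_at[OF assms(2)]])

lemma partial_z_mult:
  fixes f g :: "complex^'n::finite \<Rightarrow> complex"
  assumes "entire f" "entire g"
  shows "partial_z j (\<lambda>z. f z * g z) z = partial_z j f z * g z + f z * partial_z j g z"
  by (rule partial_zI, rule derivative_eq_intros, rule entire_partial_z_at[OF assms(1)],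
      rule entire_partial_z_at[OF assms(2)]) (simp add: axis_def zero_vec_def[symmetric])

lemma partial_z_cmult:
  fixes f :: "complex^'n::finite \<Rightarrow> complex"
  assumes "entire f"
  shows "partial_z j (\<lambda>z. c * f z) z = c * partial_z j f z"
  using partial_z_mult[OF entire_const assms] by simp

lemma partial_z_sum:
  fixes f :: "'i \<Rightarrow> complex^'n::finite \<Rightarrow> complex"
  assumes "\<And>i. i \<in> I \<Longrightarrow> entire (f i)"
  shows "partial_z j (\<lambda>z. \<Sum>i\<in>I. f i z) z = (\<Sum>i\<in>I. partial_z j (f i) z)"
  using assms
  by (induction I rule: infinite_finite_induct) (auto simp: partial_z_add entire_sum)

lemma partial_z_coord: "partial_z j (\<lambda>z :: complex^'n::finite. z $ k) z = (if j = k then 1 else 0)"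
  by (rule partial_zI) (auto simp: axis_def intro!: derivative_eq_intros)

lemma partial_z_cauchy:
  fixes f :: "complex^'n::finite \<Rightarrow> complex"
  assumes f: "entire f" and M: "\<And>w. norm w \<le> norm z + 1 \<Longrightarrow> cmod (f w) \<le> M"
  shows "cmod (partial_z j f z) \<le> M"
proof -
  have "cmod ((deriv ^^ 1) (\<lambda>w. f (z + w *s axis j 1)) 0) \<le> fact 1 * M / 1 ^ 1"
  proof (rule Cauchy_inequality)
    fix x :: complex assume "norm (0 - x) = 1"
    then have "norm (z + x *s axis j 1) \<le> norm z + 1"
      by (intro order_trans[OF norm_triangle_ineq]) (simp add: norm_scalar_mult)
    then show "norm (f (z + x *s axis j 1)) \<le> M" by (rule M)
  qed (auto intro!: holomorphic_on_imp_continuous_on entire_line_holomorphic f)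
  then show ?thesis
    by (simp add: partial_z_def shift_axis)
qed

text \<open>Cauchy's estimate on unit discs bounds the derivatives of the terms by the same
  geometric series, so the series may be differentiated termwise; complex homogeneity passes to the
  sum of the derivatives.\<close>

lemma entire_series:
  fixes q :: "nat \<Rightarrow> complex^'n::finite \<Rightarrow> complex"
  assumes q: "\<And>m. entire (q m)"
    and b: "\<And>r. \<exists>M. \<forall>m z. norm z \<le> r \<longrightarrow> cmod (q m z) \<le> M / 2 ^ m"
    and s: "\<And>z. (\<lambda>m. q m z) sums f z"
  shows "entire f"
  unfolding entire_def
proof
  fix z0 :: "complex^'n"
  obtain D where D: "\<And>m z. (q m has_derivative D m z) (at z)" "\<And>m z c v. D m z (c *s v) = c * D m z v"
  proof -
    have "\<forall>m. \<exists>D. \<forall>z. (q m has_derivative D z) (at z) \<and> (\<forall>c v. D z (c *s v) = c * D z v)"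
      using entireE[OF q] by (metis (no_types))
    from choice[OF this] show ?thesis using that by blast
  qed
  \<comment> \<open>The radius leaves room for a unit disc around each point of
    \<open>ball z0 1\<close>.\<close>
  obtain M where M: "\<And>m z. norm z \<le> norm z0 + 2 \<Longrightarrow> cmod (q m z) \<le> M / 2 ^ m"
    using b[of "norm z0 + 2"] by blast
  have lin: "D m z (r *\<^sub>R v) = r *\<^sub>R D m z v" for m r v and z :: "complex^'n"
    using D(2)[of m z "of_real r" v] by (simp add: scaleR_conv_of_real of_real_scalar_mult)
  have DB: "cmod (D m z h) \<le> M / 2 ^ m * norm h" if z: "z \<in> ball z0 1" for m h and z :: "complex^'n"
  proof (cases "h = 0")
    case True
    then show ?thesis using lin[of m z 0 h] by simp
  next
    case False
    define u where "u = (1 / norm h) *\<^sub>R h"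
    have nu: "norm u = 1" using False by (simp add: u_def)
    have nz: "norm z \<le> norm z0 + 1"
      using z norm_triangle_ineq4[of z0 "z0 - z"] by (simp add: dist_norm)
    have "cmod ((deriv ^^ 1) (\<lambda>w. q m (z + w *s u)) 0) \<le> fact 1 * (M / 2 ^ m) / 1 ^ 1"
    proof (rule Cauchy_inequality)
      fix x :: complex assume "norm (0 - x) = 1"
      then have "norm (z + x *s u) \<le> norm z + 1"
        by (intro order_trans[OF norm_triangle_ineq]) (simp add: norm_scalar_mult nu)
      then show "norm (q m (z + x *s u)) \<le> M / 2 ^ m" using nz by (intro M) auto
    qed (auto intro!: holomorphic_on_imp_continuous_on entire_line_holomorphic q)
    moreover have "((\<lambda>w. q m (z + w *s u)) has_field_derivative D m z u) (at 0)"
      using has_field_derivative_line[of "q m" "D m z" z 0 u] D by simp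
    ultimately have "cmod (D m z u) \<le> M / 2 ^ m" by (simp add: DERIV_imp_deriv)
    moreover have "D m z h = norm h *\<^sub>R D m z u" using False by (simp add: u_def lin)
    ultimately show ?thesis
      using mult_left_mono[of "cmod (D m z u)" "M / 2 ^ m" "norm h"] by (simp add: mult.commute)
  qed
  have geo: "summable (\<lambda>m. M / 2 ^ m * c)" for c :: real
    using summable_mult[OF summable_mult[OF summable_geometric[of "1/2::real"]], of "c" M]
    by (simp add: field_simps power_divide)
  have Dsum: "summable (\<lambda>m. D m z h)" if "z \<in> ball z0 1" for h and z :: "complex^'n"
    by (rule summable_comparison_test[OF _ geo[of "norm h"]]) (use DB[OF that] in auto)
  define D' where "D' = (\<lambda>z h. \<Sum>m. D m z h)"
  have "\<exists>g. \<forall>x\<in>ball z0 1. (\<lambda>n. q n x) sums g x \<and> (g has_derivative D' x) (at x within ball z0 1)"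
  proof (rule has_derivative_series)
    fix e :: real assume e: "e > 0"
    have "(\<lambda>n. (\<Sum>i. M / 2 ^ (i + n))) \<longlonglongrightarrow> 0"
      using suminf_exist_split2[OF geo[of 1]] by (simp add: LIMSEQ_def)
    then have "\<forall>\<^sub>F n in sequentially. (\<Sum>i. M / 2 ^ (i + n)) < e"
      using e by (rule order_tendstoD)
    then show "\<forall>\<^sub>F n in sequentially. \<forall>x\<in>ball z0 1. \<forall>h. norm ((\<Sum>i<n. D i x h) - D' x h) \<le> e * norm h"
    proof eventually_elim
      fix n assume n: "(\<Sum>i. M / 2 ^ (i + n)) < e"
      show "\<forall>x\<in>ball z0 1. \<forall>h. norm ((\<Sum>i<n. D i x h) - D' x h) \<le> e * norm h"
      proof (intro ballI allI)
        fix x h assume x: "x \<in> ball z0 1"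
        have "norm ((\<Sum>i<n. D i x h) - D' x h) = norm (\<Sum>i. D (i + n) x h)"
          unfolding D'_def suminf_split_initial_segment[OF Dsum[OF x], of h n] by simp
        also have "\<dots> \<le> (\<Sum>i. M / 2 ^ (i + n) * norm h)"
          by (rule norm_suminf_le) (use DB[OF x] summable_ignore_initial_segment[OF geo] in auto)
        also have "\<dots> = (\<Sum>i. M / 2 ^ (i + n)) * norm h"
          using summable_ignore_initial_segment[OF geo[of 1], of n] by (simp add: suminf_mult2)
        also have "\<dots> \<le> e * norm h" using n by (intro mult_right_mono) auto
        finally show "norm ((\<Sum>i<n. D i x h) - D' x h) \<le> e * norm h" .
      qed
    qed
  qed (auto intro!: has_derivative_at_withinI D(1) s[of z0])
  then obtain g where g: "\<And>x. x\<in>ball z0 1 \<Longrightarrow> (\<lambda>n. q n x) sums g x"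
    "\<And>x. x\<in>ball z0 1 \<Longrightarrow> (g has_derivative D' x) (at x within ball z0 1)" by blast
  have "(g has_derivative D' z0) (at z0)"
    using g(2)[of z0] by (simp add: at_within_open[of _ "ball z0 1"])
  then have "(f has_derivative D' z0) (at z0)"
    by (rule has_derivative_transform_within_open[of _ _ _ _ "ball z0 1"])
      (auto intro: sums_unique2[OF g(1) s])
  moreover have "D' z0 (c *s v) = c * D' z0 v" for c v
    unfolding D'_def using Dsum[of z0 v] by (simp add: D(2) suminf_mult)
  ultimately show "\<exists>D. (f has_derivative D) (at z0) \<and> (\<forall>c v. D (c *s v) = c * D v)" by blast
qed

section \<open>Polynomials\<close>

definition cmonom :: "('n::finite \<Rightarrow> nat) \<Rightarrow> complex^'n \<Rightarrow> complex" where
  "cmonom a z = (\<Prod>j\<in>UNIV. (z $ j) ^ a j)"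

definition multidegs :: "nat \<Rightarrow> ('n::finite \<Rightarrow> nat) set" where
  "multidegs m = {a. sum a UNIV = m}"

interpretation cfun: vector_space "\<lambda>c f (z::'a). c * (f z :: complex)"
  by unfold_locales (simp_all add: fun_eq_iff algebra_simps)

definition hom_polys :: "nat \<Rightarrow> (complex^'n::finite \<Rightarrow> complex) set" where
  "hom_polys m = cfun.span (cmonom ` multidegs m)"

lemma finite_multidegs: "finite (multidegs m :: ('n::finite \<Rightarrow> nat) set)"
proof (rule finite_subset)
  show "multidegs m \<subseteq> {a :: 'n \<Rightarrow> nat. \<forall>x. (x \<in> UNIV \<longrightarrow> a x \<in> {..m}) \<and> (x \<notin> UNIV \<longrightarrow> a x = 0)}"
    unfolding multidegs_def by (auto intro: member_le_sum)
  show "finite {a :: 'n \<Rightarrow> nat. \<forall>x. (x \<in> UNIV \<longrightarrow> a x \<in> {..m}) \<and> (x \<notin> UNIV \<longrightarrow> a x = 0)}"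
    by (rule finite_set_of_finite_funs) auto
qed

lemma entire_cmonom: "entire (cmonom a)"
  unfolding cmonom_def[abs_def] by (intro entire_prod entire_power entire_coord)

lemma cmonom_scale: "cmonom a (t *s z) = t ^ (sum a UNIV) * cmonom a z"
  by (simp add: cmonom_def power_mult_distrib prod.distrib power_sum)

lemma coord_mult_cmonom: "z $ j * cmonom a z = cmonom (a(j := Suc (a j))) z"
  by (simp add: cmonom_def prod.remove[of UNIV j] mult.assoc)

lemma sum_fun_upd_add:
  fixes a :: "'n::finite \<Rightarrow> nat"
  shows "sum (a(j := k)) UNIV + a j = sum a UNIV + k"
  by (simp add: sum.remove[of UNIV j])

lemma partial_z_cmonom:
  "partial_z j (cmonom a) z = of_nat (a j) * cmonom (a(j := a j - 1)) z"
proof (rule partial_zI)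
  let ?P = "\<Prod>i\<in>UNIV-{j}. (z $ i) ^ a i"
  have "cmonom a (z + axis j w) = (z $ j + w) ^ a j * ?P" for w
    by (simp add: cmonom_def prod.remove[of UNIV j] axis_def)
  then have "(\<lambda>w. cmonom a (z + axis j w)) = (\<lambda>w. (z $ j + w) ^ a j * ?P)" by blast
  moreover have "of_nat (a j) * cmonom (a(j := a j - 1)) z = of_nat (a j) * (z $ j) ^ (a j - 1) * ?P"
    by (simp add: cmonom_def prod.remove[of UNIV j])
  ultimately show "((\<lambda>w. cmonom a (z + axis j w)) has_field_derivative of_nat (a j) * cmonom (a(j := a j - 1)) z) (at 0)"
    by (auto intro!: derivative_eq_intros)
qed

lemma euler_cmonom:
  "(\<Sum>j\<in>UNIV. z $ j * partial_z j (cmonom a) z) = of_nat (sum a UNIV) * cmonom a z"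
proof -
  have "z $ j * partial_z j (cmonom a) z = of_nat (a j) * cmonom a z" for j
  proof (cases "a j")
    case (Suc k)
    have "z $ j * partial_z j (cmonom a) z = of_nat (a j) * (z $ j * cmonom (a(j := a j - 1)) z)"
      by (simp add: partial_z_cmonom)
    also have "\<dots> = of_nat (a j) * cmonom a z"
      unfolding coord_mult_cmonom using Suc by (metis diff_Suc_1 fun_upd_same fun_upd_triv fun_upd_upd)
    finally show ?thesis .
  qed (simp add: partial_z_cmonom)
  then show ?thesis by (simp add: sum_distrib_right)
qed

lemma hom_polys_cmonom: "sum a UNIV = m \<Longrightarrow> cmonom a \<in> hom_polys m"
  unfolding hom_polys_def multidegs_def by (intro cfun.span_base) auto

lemma hom_polys_add: "q \<in> hom_polys m \<Longrightarrow> r \<in> hom_polys m \<Longrightarrow> (\<lambda>z. q z + r z) \<in> hom_polys m"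
  unfolding hom_polys_def using cfun.span_add by (fastforce simp: plus_fun_def)

lemma hom_polys_cmult: "q \<in> hom_polys m \<Longrightarrow> (\<lambda>z. c * q z) \<in> hom_polys m"
  unfolding hom_polys_def using cfun.span_scale by blast

lemma hom_polys_zero: "(\<lambda>z. 0) \<in> hom_polys m"
  unfolding hom_polys_def using cfun.span_zero[of "cmonom ` multidegs m"] by (simp add: zero_fun_def)

text \<open>Everything below that is linear in the polynomial is reduced by this rule to a single
  monomial.\<close>

lemma hom_polys_induct [consumes 1, case_names zero step]:
  assumes "q \<in> hom_polys m" and "P (\<lambda>z. 0)"
    and "\<And>c a r. sum a UNIV = m \<Longrightarrow> r \<in> hom_polys m \<Longrightarrow> P r \<Longrightarrow> P (\<lambda>z. c * cmonom a z + r z)"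
  shows "P q"
proof -
  have "q \<in> hom_polys m \<and> P q"
    using assms(1) unfolding hom_polys_def
  proof (induction rule: cfun.span_induct_alt)
    case base
    then show ?case using assms(2) cfun.span_zero by (simp add: zero_fun_def)
  next
    case (step c x y)
    then obtain a where a: "x = cmonom a" "sum a UNIV = m" by (auto simp: multidegs_def)
    have "(\<lambda>z. c * x z) + y = (\<lambda>z. c * cmonom a z + y z)" by (simp add: a plus_fun_def)
    then show ?case
      using assms(3)[of a y c] a step hom_polys_add hom_polys_cmult hom_polys_cmonom
      unfolding hom_polys_def[symmetric] by metis
  qed
  then show ?thesis ..
qed

lemma hom_polys_entire: "q \<in> hom_polys m \<Longrightarrow> entire q"
  by (induction rule: hom_polys_induct) (simp, intro entire_add entire_cmult entire_cmonom)

lemma hom_polys_homogeneous: "q \<in> hom_polys m \<Longrightarrow> q (t *s z) = t ^ m * q z"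
  by (induction rule: hom_polys_induct) (auto simp: cmonom_scale algebra_simps)

lemma hom_polys_coord_mult: "q \<in> hom_polys m \<Longrightarrow> (\<lambda>z. z $ j * q z) \<in> hom_polys (Suc m)"
proof (induction rule: hom_polys_induct)
  case (step c a r)
  have "sum (a(j := Suc (a j))) UNIV = Suc m" using sum_fun_upd_add[of a j "Suc (a j)"] step by simp
  then have "(\<lambda>z. c * cmonom (a(j := Suc (a j))) z + z $ j * r z) \<in> hom_polys (Suc m)"
    using step by (intro hom_polys_add hom_polys_cmult hom_polys_cmonom)
  moreover have "z $ j * (c * cmonom a z + r z) = c * cmonom (a(j := Suc (a j))) z + z $ j * r z" for z
    using coord_mult_cmonom[of z j a] by (simp add: algebra_simps)
  ultimately show ?case by simp
qed (simp add: hom_polys_zero)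

lemma hom_polys_partial_z: "q \<in> hom_polys (Suc m) \<Longrightarrow> partial_z j q \<in> hom_polys m"
proof (induction rule: hom_polys_induct)
  case (step c a r)
  have "partial_z j (\<lambda>z. c * cmonom a z + r z) = (\<lambda>z. (c * of_nat (a j)) * cmonom (a(j := a j - 1)) z + partial_z j r z)"
    using hom_polys_entire[OF step(2)]
    by (intro ext) (simp add: partial_z_add partial_z_cmult entire_cmult entire_cmonom partial_z_cmonom)
  moreover have "(\<lambda>z. (c * of_nat (a j)) * cmonom (a(j := a j - 1)) z + partial_z j r z) \<in> hom_polys m"
  \<comment> \<open>If \<open>a j = 0\<close>, the truncated exponent \<open>a j - 1\<close> does
    not lower the degree, but the coefficient \<open>of_nat (a j)\<close> removes the term.\<close>
  proof (cases "a j = 0")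
    case False
    have "sum (a(j := a j - 1)) UNIV = m" using sum_fun_upd_add[of a j "a j - 1"] step False by simp
    then show ?thesis using step by (intro hom_polys_add hom_polys_cmult hom_polys_cmonom)
  qed (use step in simp)
  ultimately show ?case by simp
qed (simp add: hom_polys_zero)

lemma hom_polys_partial_z_0:
  assumes "q \<in> hom_polys 0" shows "partial_z j q z = 0"
  using assms
proof (induction rule: hom_polys_induct)
  case (step c a r)
  then show ?case
    using hom_polys_entire[OF step(2)]
    by (simp add: partial_z_add partial_z_cmult entire_cmult entire_cmonom partial_z_cmonom)
qed simp

lemma hom_polys_euler: "q \<in> hom_polys m \<Longrightarrow> (\<Sum>j\<in>UNIV. z $ j * partial_z j q z) = of_nat m * q z"
proof (induction rule: hom_polys_induct)
  case (step c a r)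
  have "(\<Sum>j\<in>UNIV. z $ j * partial_z j (\<lambda>z. c * cmonom a z + r z) z)
      = c * (\<Sum>j\<in>UNIV. z $ j * partial_z j (cmonom a) z) + (\<Sum>j\<in>UNIV. z $ j * partial_z j r z)"
    using hom_polys_entire[OF step(2)]
    by (simp add: partial_z_add partial_z_cmult entire_cmult entire_cmonom sum.distrib sum_distrib_left algebra_simps)
  then show ?case using step by (simp add: euler_cmonom algebra_simps)
qed simp

text \<open>Scaling to the unit sphere carries the bound on the unit ball to all of space. At the
  origin homogeneity forces the value 0, except for \<open>m = 0\<close>, where
  \<open>0 ^ 0 = 1\<close>.\<close>

lemma homogeneous_bound:
  fixes q :: "complex^'n::finite \<Rightarrow> complex"
  assumes M: "\<And>z. norm z \<le> 1 \<Longrightarrow> cmod (q z) \<le> M" and h: "\<And>t z. q (t *s z) = t ^ m * q z"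
  obtains C where "C \<ge> 0" "\<And>z. cmod (q z) \<le> C * norm z ^ m"
proof -
  have "cmod (q z) \<le> max 0 M * norm z ^ m" for z
  proof (cases "z = 0")
    case True
    have "q 0 = 0 ^ m * q 0" using h[of 0 0] by simp
    then have "m \<noteq> 0 \<Longrightarrow> q 0 = 0" by (simp add: zero_power)
    then show ?thesis using M[of 0] True by (cases "m = 0") (auto simp: le_max_iff_disj)
  next
    case False
    define u where "u = of_real (1 / norm z) *s z"
    have "norm u = 1" using False by (simp add: u_def norm_scalar_mult norm_divide)
    then have u: "cmod (q u) \<le> max 0 M" using M[of u] by (auto simp: le_max_iff_disj)
    have "z = of_real (norm z) *s u" using False by (simp add: u_def vec_eq_iff)
    then have "q z = of_real (norm z) ^ m * q u" using h by metis
    then have "cmod (q z) = norm z ^ m * cmod (q u)" by (simp add: norm_mult norm_power)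
    then show ?thesis using mult_left_mono[OF u, of "norm z ^ m"] by (simp add: mult.commute)
  qed
  then show ?thesis by (intro that[of "max 0 M"]) auto
qed

lemma hom_polys_bound:
  fixes q :: "complex^'n::finite \<Rightarrow> complex"
  assumes "q \<in> hom_polys m"
  obtains C where "C \<ge> 0" "\<And>z. cmod (q z) \<le> C * norm z ^ m"
proof -
  obtain M where "\<And>z. norm z \<le> 1 \<Longrightarrow> cmod (q z) \<le> M"
    using entire_bounded[OF hom_polys_entire[OF assms], of 1] by blast
  then show ?thesis using homogeneous_bound[of q M m] hom_polys_homogeneous[OF assms] that by blast
qed

section \<open>Polynomials of arbitrary degree and interpolation\<close>

definition polys :: "(complex^'n::finite \<Rightarrow> complex) set" where
  "polys = cfun.span (range cmonom)"

lemma polys_coord_mult: "q \<in> polys \<Longrightarrow> (\<lambda>z. z $ j * q z) \<in> polys"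
  unfolding polys_def
proof (induction rule: cfun.span_induct_alt)
  case base
  then show ?case using cfun.span_zero by (simp add: zero_fun_def)
next
  case (step c x y)
  then obtain a where a: "x = cmonom a" by auto
  have eq: "(\<lambda>z. z $ j * ((\<lambda>z. c * x z) + y) z) = (\<lambda>z. c * cmonom (a(j := Suc (a j))) z) + (\<lambda>z. z $ j * y z)"
  proof
    fix z
    have "z $ j * (c * x z + y z) = c * (z $ j * cmonom a z) + z $ j * y z" by (simp add: a algebra_simps)
    then show "z $ j * ((\<lambda>z. c * x z) + y) z = ((\<lambda>z. c * cmonom (a(j := Suc (a j))) z) + (\<lambda>z. z $ j * y z)) z"
      by (simp only: coord_mult_cmonom plus_fun_apply)
  qed
  show ?case unfolding eq by (intro cfun.span_add cfun.span_scale cfun.span_base step(2)) auto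
qed

lemma polys_add: "q \<in> polys \<Longrightarrow> r \<in> polys \<Longrightarrow> (\<lambda>z. q z + r z) \<in> polys"
  unfolding polys_def using cfun.span_add by (fastforce simp: plus_fun_def)

lemma polys_cmult: "q \<in> polys \<Longrightarrow> (\<lambda>z. c * q z) \<in> polys"
  unfolding polys_def using cfun.span_scale by blast

lemma polys_sum: "(\<And>i. i \<in> I \<Longrightarrow> f i \<in> polys) \<Longrightarrow> (\<lambda>z. \<Sum>i\<in>I. f i z) \<in> polys"
proof (induction I rule: infinite_finite_induct)
  case (insert x F)
  then show ?case by (simp add: polys_add)
qed (use cfun.span_zero in \<open>auto simp: polys_def zero_fun_def\<close>)

lemma polys_poly_mult:
  assumes "q \<in> polys" shows "(\<lambda>z. poly p (z $ j) * q z) \<in> polys"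
proof (induction p)
  case 0
  then show ?case using cfun.span_zero by (simp add: polys_def zero_fun_def)
next
  case (pCons c p)
  have "(\<lambda>z. poly (pCons c p) (z $ j) * q z) = (\<lambda>z. c * q z + z $ j * (poly p (z $ j) * q z))"
    by (simp add: algebra_simps)
  then show ?case using polys_add[OF polys_cmult[OF assms] polys_coord_mult[OF pCons(2)]] by simp
qed

lemma sum_fun_apply: "(\<Sum>i\<in>I. f i) z = (\<Sum>i\<in>I. f i z)"
  by (induction I rule: infinite_finite_induct) auto

text \<open>For fixed \<open>z\<close> the function \<open>q (t *s z)\<close> is a polynomial in
  \<open>t\<close> that equals \<open>q z * t ^ m\<close>. Comparing the coefficients of
  \<open>t ^ m\<close> discards all monomials of other degrees.\<close>

lemma polys_homogeneous:
  fixes q :: "complex^'n::finite \<Rightarrow> complex"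
  assumes "q \<in> polys" and h: "\<And>t z. q (t *s z) = t ^ m * q z"
  shows "q \<in> hom_polys m"
proof -
  obtain S c where S: "finite S" "S \<subseteq> range cmonom" and q: "q = (\<Sum>f\<in>S. (\<lambda>z. c f * f z))"
    using assms(1) unfolding polys_def cfun.span_explicit by blast
  obtain A where A: "S = cmonom ` A" "inj_on cmonom A"
    using S(2) by (metis subset_image_inj)
  define d where "d = c \<circ> cmonom"
  have fA: "finite A" using S(1) A by (simp add: finite_image_iff)
  have qz: "q z = (\<Sum>a\<in>A. d a * cmonom a z)" for z
    unfolding q A(1) by (subst sum.reindex[OF A(2)]) (simp add: d_def sum_fun_apply)
  have "q z = (\<Sum>a\<in>A \<inter> {a. sum a UNIV = m}. d a * cmonom a z)" for z
  proof -
    define p where "p = (\<Sum>a\<in>A. monom (d a * cmonom a z) (sum a UNIV))"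
    have "poly p = poly (monom (q z) m)"
    proof
      fix x
      have "poly p x = q (x *s z)" by (simp add: p_def poly_sum poly_monom qz cmonom_scale mult_ac)
      then show "poly p x = poly (monom (q z) m) x" by (simp add: h poly_monom mult.commute)
    qed
    then have "p = monom (q z) m" by (simp add: poly_eq_poly_eq_iff)
    then have "coeff p m = q z" by simp
    moreover have "coeff p m = (\<Sum>a\<in>A. if sum a UNIV = m then d a * cmonom a z else 0)"
      by (simp add: p_def coeff_sum)
    ultimately show ?thesis using fA by (simp add: sum.inter_restrict)
  qed
  then have "q = (\<lambda>z. \<Sum>a\<in>A \<inter> {a. sum a UNIV = m}. d a * cmonom a z)" by blast
  also have "\<dots> \<in> hom_polys m"
  proof -
    have "finite B \<Longrightarrow> B \<subseteq> {a. sum a UNIV = m} \<Longrightarrow> (\<lambda>z. \<Sum>a\<in>B. d a * cmonom a z) \<in> hom_polys m" for B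
      by (induction B rule: finite_induct)
        (auto intro!: hom_polys_add hom_polys_cmult hom_polys_cmonom hom_polys_zero)
    then show ?thesis using fA by simp
  qed
  finally show ?thesis .
qed

text \<open>The nodes are the numbers from 0 to \<open>m\<close>, and polynomials of degree at most
  \<open>m\<close> that agree there are equal. The basis \<open>L\<close> is the same for all
  \<open>p\<close>, so the formula can be applied with the other coordinates as parameters.\<close>

lemma lagrange_interpolation:
  obtains L :: "nat \<Rightarrow> complex poly" where
    "\<And>p t. degree p \<le> m \<Longrightarrow> poly p t = (\<Sum>k\<le>m. poly p (of_nat k) * poly (L k) t)"
proof -
  define L where "L = (\<lambda>k. \<Prod>i\<in>{..m}-{k}. smult (inverse (of_nat k - of_nat i)) [:- of_nat i, 1 :: complex:])"
  have deg: "degree (L k) \<le> m" if "k \<le> m" for k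
  proof -
    have "degree (L k) \<le> (\<Sum>i\<in>{..m}-{k}. degree (smult (inverse (of_nat k - of_nat i)) [:- of_nat i, 1 :: complex:]))"
      unfolding L_def by (rule degree_prod_sum_le[unfolded o_def]) simp
    also have "\<dots> \<le> (\<Sum>i\<in>{..m}-{k}. 1)" by (intro sum_mono) simp
    also have "\<dots> = m" using that by simp
    finally show ?thesis .
  qed
  have val: "poly (L k) (of_nat l) = (if k = l then 1 else 0)" if "k \<le> m" "l \<le> m" for k l
  proof -
    have "poly (L k) (of_nat l) = (\<Prod>i\<in>{..m}-{k}. inverse (of_nat k - of_nat i) * (of_nat l - of_nat i))"
      by (simp add: L_def poly_prod algebra_simps)
    also have "\<dots> = (if k = l then 1 else 0)"
      using that by (auto intro!: prod.neutral prod_zero bexI[of _ l])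
    finally show ?thesis .
  qed
  show ?thesis
  proof (rule that)
    fix p :: "complex poly" and t assume p: "degree p \<le> m"
    define r where "r = (\<Sum>k\<le>m. smult (poly p (of_nat k)) (L k))"
    have "p = r"
    proof (rule poly_eqI_degree[where A = "of_nat ` {..m}"])
      have dr: "degree r \<le> m" unfolding r_def
        by (rule degree_sum_le) (simp, metis atMost_iff deg degree_smult_le order_trans)
      have "card (of_nat ` {..m} :: complex set) = Suc m" by (subst card_image) (auto simp: inj_on_def)
      then show "card (of_nat ` {..m} :: complex set) > degree p" "card (of_nat ` {..m} :: complex set) > degree r"
        using p dr by auto
      fix x :: complex assume "x \<in> of_nat ` {..m}"
      then obtain l where "x = of_nat l" "l \<le> m" by auto
      have "(\<Sum>k\<le>m. poly p (of_nat k) * poly (L k) (of_nat l)) = (\<Sum>k\<le>m. if k = l then poly p (of_nat k) else 0)"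
        by (intro sum.cong) (simp_all add: val \<open>l \<le> m\<close>)
      then show "poly p x = poly r x"
        using \<open>l \<le> m\<close> by (simp add: r_def poly_sum \<open>x = of_nat l\<close>)
    qed
    then have "poly p t = poly r t" by simp
    then show "poly p t = (\<Sum>k\<le>m. poly p (of_nat k) * poly (L k) t)" by (simp add: r_def poly_sum)
  qed
qed

definition vec_upd :: "complex^'n \<Rightarrow> 'n \<Rightarrow> complex \<Rightarrow> complex^'n" where
  "vec_upd z j t = (\<chi> i. if i = j then t else z $ i)"

text \<open>Interpolating in one coordinate at a time expresses the function through its values on a
  finite grid.\<close>

lemma separately_polynomial_imp_polys:
  fixes g :: "complex^'n::finite \<Rightarrow> complex"
  assumes "finite S"
    and "\<And>z j. \<exists>p. degree p \<le> m \<and> (\<forall>t. g (vec_upd z j t) = poly p t)"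
    and "\<And>z z'. (\<forall>i\<in>S. z $ i = z' $ i) \<Longrightarrow> g z = g z'"
  shows "g \<in> polys"
  using assms
proof (induction S arbitrary: g rule: finite_induct)
  case empty
  have eq: "(\<lambda>z. g 0 * cmonom (\<lambda>_. 0) z) = g" using empty(2) by (simp add: cmonom_def fun_eq_iff)
  have "(\<lambda>z :: complex^'n. g 0 * cmonom (\<lambda>_. 0) z) \<in> polys" unfolding polys_def by (intro cfun.span_scale cfun.span_base) auto
  then show ?case unfolding eq .
next
  case (insert j S)
  obtain L :: "nat \<Rightarrow> complex poly" where
    L: "\<And>p t. degree p \<le> m \<Longrightarrow> poly p t = (\<Sum>k\<le>m. poly p (of_nat k) * poly (L k) t)"
    by (rule lagrange_interpolation[of m]) blast
  have eq: "g z = (\<Sum>k\<le>m. poly (L k) (z $ j) * g (vec_upd z j (of_nat k)))" for z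
  proof -
    obtain p where p: "degree p \<le> m" "\<And>t. g (vec_upd z j t) = poly p t" using insert(4) by blast
    have "vec_upd z j (z $ j) = z" by (simp add: vec_upd_def vec_eq_iff)
    then have "g z = poly p (z $ j)" using p(2)[of "z $ j"] by simp
    also have "\<dots> = (\<Sum>k\<le>m. poly p (of_nat k) * poly (L k) (z $ j))" by (rule L[OF p(1)])
    also have "\<dots> = (\<Sum>k\<le>m. poly (L k) (z $ j) * g (vec_upd z j (of_nat k)))"
      by (simp add: p(2) mult.commute)
    finally show ?thesis .
  qed
  have "(\<lambda>z. g (vec_upd z j (of_nat k))) \<in> polys" for k
  proof (rule insert(3))
    fix z i
    show "\<exists>p. degree p \<le> m \<and> (\<forall>t. g (vec_upd (vec_upd z i t) j (of_nat k)) = poly p t)"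
    proof (cases "i = j")
      case True
      have "vec_upd (vec_upd z j t) j (of_nat k) = vec_upd z j (of_nat k)" for t
        by (simp add: vec_upd_def vec_eq_iff)
      then show ?thesis using True by (intro exI[of _ "[:g (vec_upd z j (of_nat k)):]"]) auto
    next
      case False
      have "vec_upd (vec_upd z i t) j (of_nat k) = vec_upd (vec_upd z j (of_nat k)) i t" for t
        using False by (simp add: vec_upd_def vec_eq_iff)
      then show ?thesis using insert(4)[of "vec_upd z j (of_nat k)" i] by simp
    qed
  next
    fix z z' :: "complex^'n" assume "\<forall>i\<in>S. z $ i = z' $ i"
    then show "g (vec_upd z j (of_nat k)) = g (vec_upd z' j (of_nat k))"
      by (intro insert(5)) (auto simp: vec_upd_def)
  qed
  then have "(\<lambda>z. \<Sum>k\<le>m. poly (L k) (z $ j) * g (vec_upd z j (of_nat k))) \<in> polys"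
    by (intro polys_sum polys_poly_mult)
  moreover have "(\<lambda>z. \<Sum>k\<le>m. poly (L k) (z $ j) * g (vec_upd z j (of_nat k))) = g"
    by (rule ext) (rule eq[symmetric])
  ultimately show ?case by (rule subst[of _ _ "\<lambda>h. h \<in> polys", rotated])
qed

section \<open>Homogeneous expansion\<close>

text \<open>The Taylor coefficient of order \<open>m\<close> at 0 along the complex line through
  \<open>z\<close>. Homogeneity in \<open>z\<close> is then immediate, while polynomial dependence
  on \<open>z\<close> has to be proved.\<close>

definition hom_comp :: "(complex^'n::finite \<Rightarrow> complex) \<Rightarrow> nat \<Rightarrow> complex^'n \<Rightarrow> complex" where
  "hom_comp f m z = (deriv ^^ m) (\<lambda>t. f (t *s z)) 0 / fact m"

lemma hom_comp_sums_ray: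
  assumes "entire f" shows "(\<lambda>m. hom_comp f m z * t ^ m) sums f (t *s z)"
  unfolding hom_comp_def
  using holomorphic_power_series[of "\<lambda>t. f (t *s z)" 0 "cmod t + 1" t] entire_ray_holomorphic[OF assms]
  by simp

lemma hom_comp_sums:
  assumes "entire f" shows "(\<lambda>m. hom_comp f m z) sums f z"
  using hom_comp_sums_ray[OF assms, of z 1] by (simp add: vector_smult_lid)

lemma hom_comp_homogeneous:
  assumes "entire f" shows "hom_comp f m (s *s z) = s ^ m * hom_comp f m z"
proof -
  have "(deriv ^^ m) (\<lambda>t. (\<lambda>t. f (t *s z)) (s * t)) 0 = s ^ m * (deriv ^^ m) (\<lambda>t. f (t *s z)) (s * 0)"
    by (rule higher_deriv_compose_linear[where S = UNIV and T = UNIV])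
      (auto intro: entire_ray_holomorphic assms)
  then show ?thesis by (simp add: hom_comp_def vector_smult_assoc mult.commute)
qed

text \<open>Cauchy's estimate on the circle of radius 2 supplies the factor \<open>2 ^ m\<close>,
  which makes the bounds summable over \<open>m\<close> on each ball.\<close>

lemma hom_comp_bound:
  assumes f: "entire f" and M: "\<And>w. norm w \<le> 2 * r \<Longrightarrow> cmod (f w) \<le> M" and z: "norm z \<le> r"
  shows "cmod (hom_comp f m z) \<le> M / 2 ^ m"
proof -
  have "cmod ((deriv ^^ m) (\<lambda>t. f (t *s z)) 0) \<le> fact m * M / 2 ^ m"
  proof (rule Cauchy_inequality)
    fix x :: complex assume "norm (0 - x) = 2"
    then show "norm (f (x *s z)) \<le> M" using z by (intro M) (simp add: norm_scalar_mult)
  qed (auto intro!: holomorphic_on_imp_continuous_on entire_ray_holomorphic f)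
  then show ?thesis by (simp add: hom_comp_def norm_divide field_simps)
qed

lemma hom_comp_bounded:
  assumes f: "entire f"
  shows "\<exists>M. \<forall>m z. norm z \<le> r \<longrightarrow> cmod (hom_comp f m z) \<le> M / 2 ^ m"
proof -
  obtain M where "\<And>z. norm z \<le> 2 * r \<Longrightarrow> cmod (f z) \<le> M" using entire_bounded[OF f, of "2 * r"] by blast
  then show ?thesis using hom_comp_bound[OF f] by blast
qed

text \<open>With \<open>t = 1 / N\<close>, \<open>(f (t z) - (\<Sum>k<m. t ^ k * f\<^sub>k z)) / t ^ m\<close> converges locally uniformly to \<open>f\<^sub>m z\<close>
  as \<open>N \<rightarrow> \<infinity>\<close>.\<close>

lemma hom_comp_line_holomorphic:
  fixes f :: "complex^'n::finite \<Rightarrow> complex"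
  assumes f: "entire f"
  shows "(\<lambda>t. hom_comp f m (a + t *s v)) holomorphic_on UNIV"
\<comment> \<open>The approximants subtract all components of lower degree, whose holomorphy along
  the line is the induction hypothesis.\<close>
proof (induction m rule: less_induct)
  case (less m)
  define h where "h = (\<lambda>N t. of_nat (Suc N) ^ m * (f ((1 / of_nat (Suc N)) *s (a + t *s v))
      - (\<Sum>k<m. hom_comp f k (a + t *s v) * (1 / of_nat (Suc N)) ^ k)))"
  show ?case
  proof (rule holomorphic_uniform_sequence[where f = h])
    fix N
    have "(\<lambda>t. f ((1 / of_nat (Suc N)) *s (a + t *s v)))
        = (\<lambda>t. f ((1 / of_nat (Suc N)) *s a + t *s ((1 / of_nat (Suc N)) *s v)))"
      by (simp add: vector_add_ldistrib vector_smult_assoc mult.commute)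
    then have "(\<lambda>t. f ((1 / of_nat (Suc N)) *s (a + t *s v))) holomorphic_on UNIV"
      using entire_line_holomorphic[OF f] by (simp only:)
    then show "h N holomorphic_on UNIV"
      unfolding h_def by (intro holomorphic_intros less) auto
  next
    fix x :: complex
    obtain M where M: "\<And>m z. norm z \<le> norm a + (cmod x + 1) * norm v \<Longrightarrow> cmod (hom_comp f m z) \<le> M / 2 ^ m"
      using hom_comp_bounded[OF f] by blast
    have "uniform_limit (cball x 1) h (\<lambda>t. hom_comp f m (a + t *s v)) sequentially"
    proof (rule uniform_limitI)
      fix e :: real assume e: "e > 0"
      obtain N0 :: nat where N0: "real N0 > 2 * M / e" using reals_Archimedean2 by blast
      show "\<forall>\<^sub>F N in sequentially. \<forall>t\<in>cball x 1. dist (h N t) (hom_comp f m (a + t *s v)) < e"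
        using eventually_ge_at_top[of N0]
      proof eventually_elim
        fix N assume N: "N \<ge> N0"
        show "\<forall>t\<in>cball x 1. dist (h N t) (hom_comp f m (a + t *s v)) < e"
        proof
          fix t assume t: "t \<in> cball x 1"
          define z where "z = a + t *s v"
          define c where "c = (1 / of_nat (Suc N) :: complex)"
          have c: "c * of_nat (Suc N) = 1" "cmod c = 1 / real (Suc N)" "c \<noteq> 0"
            by (auto simp: c_def norm_divide simp del: of_nat_Suc)
          have cle: "cmod c \<le> 1" by (simp add: c del: of_nat_Suc)
          have "cmod t \<le> cmod x + 1"
            using t norm_triangle_ineq4[of x "x - t"] by (simp add: dist_norm)
          then have "norm z \<le> norm a + (cmod x + 1) * norm v"
            unfolding z_def by (intro order_trans[OF norm_triangle_ineq]) (simp add: norm_scalar_mult mult_right_mono)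
          then have Mz: "cmod (hom_comp f k z) \<le> M / 2 ^ k" for k by (rule M)
          have S: "(\<lambda>k. hom_comp f k z * c ^ k) sums f (c *s z)" by (rule hom_comp_sums_ray[OF f])
          have "(\<lambda>k. hom_comp f (k + m) z * c ^ (k + m)) sums (f (c *s z) - (\<Sum>k<m. hom_comp f k z * c ^ k))"
            using sums_iff_shift[of "\<lambda>k. hom_comp f k z * c ^ k" m] S by (simp add: algebra_simps)
          then have "(\<lambda>k. of_nat (Suc N) ^ m * (hom_comp f (k + m) z * c ^ (k + m))) sums h N t"
            unfolding h_def c_def[symmetric] z_def[symmetric] by (rule sums_mult)
          moreover have "of_nat (Suc N) ^ m * (hom_comp f (k + m) z * c ^ (k + m)) = hom_comp f (k + m) z * c ^ k" for k
          proof -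
            have "of_nat (Suc N) ^ m * c ^ m = 1" by (metis c(1) mult.commute power_mult_distrib power_one)
            then show ?thesis by (simp add: power_add mult_ac del: of_nat_Suc) 
          qed
          ultimately have "(\<lambda>k. hom_comp f (k + m) z * c ^ k) sums h N t" by (simp only:)
          \<comment> \<open>Once the leading term is removed, every summand carries a factor
            \<open>c\<close>, so the error is at most \<open>2 * M * cmod c\<close>; this explains
            the choice of \<open>N0\<close>.\<close>
          then have S2: "(\<lambda>k. hom_comp f (Suc k + m) z * c ^ (Suc k)) sums (h N t - hom_comp f m z)"
            using sums_Suc_iff[of "\<lambda>k. hom_comp f (k + m) z * c ^ k" "h N t - hom_comp f m z"] by simp
          have M0: "M \<ge> 0" using Mz[of 0] by (simp add: order_trans[OF norm_ge_zero])
          have G: "(\<lambda>k. cmod c * M * (1/2) ^ k) sums (cmod c * M * 2)"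
            using sums_mult[OF geometric_sums[of "1/2::real"], of "cmod c * M"] by simp
          have "cmod (hom_comp f (Suc k + m) z * c ^ (Suc k)) \<le> cmod c * M * (1/2) ^ k" for k
          proof -
            have "cmod (hom_comp f (Suc k + m) z * c ^ Suc k) \<le> (M / 2 ^ (Suc k + m)) * (cmod c * 1)"
              unfolding norm_mult norm_power power_Suc using M0 cle
              by (intro mult_mono Mz power_le_one) auto
            also have "M / 2 ^ (Suc k + m) \<le> M / 2 ^ k"
              using M0 by (intro divide_left_mono power_increasing) auto
            then have "(M / 2 ^ (Suc k + m)) * (cmod c * 1) \<le> M / 2 ^ k * (cmod c * 1)"
              by (rule mult_right_mono) simp
            finally show ?thesis by (simp add: power_divide mult_ac)
          qed
          then have "cmod (\<Sum>k. hom_comp f (Suc k + m) z * c ^ (Suc k)) \<le> (\<Sum>k. cmod c * M * (1/2) ^ k)"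
            using G by (intro norm_suminf_le) (auto simp: sums_iff)
          then have "cmod (h N t - hom_comp f m z) \<le> 2 * M / real (Suc N)"
            using S2 G c(2) by (simp add: sums_iff mult_ac del: of_nat_Suc)
          also have "\<dots> < e"
          proof -
            have "2 * M / e < real (Suc N)" using N0 N by linarith
            then show ?thesis using e by (simp add: field_simps del: of_nat_Suc)
          qed
          finally show "dist (h N t) (hom_comp f m (a + t *s v)) < e" by (simp add: dist_norm z_def)
        qed
      qed
    qed
    then show "\<exists>d>0. cball x d \<subseteq> UNIV \<and> uniform_limit (cball x d) h (\<lambda>t. hom_comp f m (a + t *s v)) sequentially"
      by (intro exI[of _ 1]) auto
  qed auto
qed

text \<open>On a coordinate line the component is an entire function of one variable with growth of
  order at most \<open>m\<close>, hence a polynomial of degree at most \<open>m\<close> by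
  Liouville's theorem. The degree bound is the same on all coordinate lines, so the component is a
  polynomial in all variables, and homogeneity selects its degree.\<close>

lemma hom_comp_hom_polys:
  fixes f :: "complex^'n::finite \<Rightarrow> complex"
  assumes f: "entire f"
  shows "hom_comp f m \<in> hom_polys m"
proof (rule polys_homogeneous)
  show hom: "hom_comp f m (t *s z) = t ^ m * hom_comp f m z" for t z
    by (rule hom_comp_homogeneous[OF f])
  obtain M where "\<And>z. norm z \<le> 1 \<Longrightarrow> cmod (hom_comp f m z) \<le> M / 2 ^ m"
    using hom_comp_bounded[OF f] by blast
  then obtain C where C: "C \<ge> 0" "\<And>z. cmod (hom_comp f m z) \<le> C * norm z ^ m"
    using homogeneous_bound[of "hom_comp f m" "M / 2 ^ m" m] hom by blast
  have "\<exists>p. degree p \<le> m \<and> (\<forall>t. hom_comp f m (vec_upd z j t) = poly p t)" for z j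
  proof -
    define a where "a = vec_upd z j 0"
    have upd: "vec_upd z j t = a + t *s axis j 1" for t
      by (auto simp: a_def vec_upd_def vec_eq_iff axis_def)
    define h where "h = (\<lambda>t. hom_comp f m (a + t *s axis j 1))"
    have bound: "cmod (h t) \<le> (C * (norm a + 1) ^ m) * norm t ^ m" if "1 \<le> norm t" for t
    proof -
      have "norm (a + t *s axis j 1) \<le> norm a + norm t"
        by (intro order_trans[OF norm_triangle_ineq]) (simp add: norm_scalar_mult)
      also have "\<dots> \<le> (norm a + 1) * norm t"
        using mult_left_mono[OF that, of "norm a"] by (simp add: algebra_simps)
      finally have "norm (a + t *s axis j 1) ^ m \<le> ((norm a + 1) * norm t) ^ m" by (rule power_mono) simp
      then have "C * norm (a + t *s axis j 1) ^ m \<le> C * ((norm a + 1) * norm t) ^ m"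
        using C(1) by (rule mult_left_mono)
      then show ?thesis
        unfolding h_def using order_trans[OF C(2)] by (simp add: power_mult_distrib mult.assoc)
    qed
    have "h t = (\<Sum>k\<le>m. (deriv ^^ k) h 0 / fact k * t ^ k)" for t
      by (rule Liouville_polynomial[OF _ bound]) (auto simp: h_def hom_comp_line_holomorphic[OF f])
    then have "h t = poly (\<Sum>k\<le>m. monom ((deriv ^^ k) h 0 / fact k) k) t" for t
      by (simp add: poly_sum poly_monom)
    moreover have "degree (\<Sum>k\<le>m. monom ((deriv ^^ k) h 0 / fact k) k) \<le> m"
      by (intro degree_sum_le) (auto intro: order_trans[OF degree_monom_le])
    ultimately show ?thesis unfolding upd h_def by blast
  qed
  then show "hom_comp f m \<in> polys"
    by (intro separately_polynomial_imp_polys[of UNIV m]) (auto simp: vec_eq_iff[symmetric])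
qed

text \<open>The geometric bound on every ball is included because it makes the sum entire and
  survives multiplication by coordinates, bounded multipliers and differentiation.\<close>

definition expands :: "(complex^'n::finite \<Rightarrow> complex) \<Rightarrow> (nat \<Rightarrow> complex^'n \<Rightarrow> complex) \<Rightarrow> bool" where
  "expands f q \<longleftrightarrow> (\<forall>m. q m \<in> hom_polys m) \<and>
     (\<forall>r. \<exists>M. \<forall>m z. norm z \<le> r \<longrightarrow> cmod (q m z) \<le> M / 2 ^ m) \<and> (\<forall>z. (\<lambda>m. q m z) sums f z)"

lemma expands_hom_comp: "entire f \<Longrightarrow> expands f (hom_comp f)"
  unfolding expands_def by (simp add: hom_comp_hom_polys hom_comp_bounded hom_comp_sums)

lemma expandsD:
  assumes "expands f q"
  shows "q m \<in> hom_polys m" "(\<lambda>m. q m z) sums f z"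
  using assms unfolding expands_def by blast+

lemma expandsE:
  assumes "expands f q"
  obtains M where "\<And>m z. norm z \<le> r \<Longrightarrow> cmod (q m z) \<le> M / 2 ^ m"
  using assms unfolding expands_def by meson

lemma expands_imp_entire:
  assumes "expands f q" shows "entire f"
proof (rule entire_series[of q])
  show "entire (q m)" for m
    using assms unfolding expands_def by (blast intro: hom_polys_entire)
next
  show "\<exists>M. \<forall>m z. norm z \<le> r \<longrightarrow> cmod (q m z) \<le> M / 2 ^ m" for r
    using assms unfolding expands_def by simp
qed (rule expandsD(2)[OF assms])

text \<open>On each ray the expansion is a power series in \<open>t\<close>, whose coefficients are
  determined by its sum. The components of any function can therefore be computed by exhibiting one
  expansion of it.\<close>

lemma expands_imp_hom_comp:
  assumes "expands f q" shows "hom_comp f = q"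
proof (intro ext)
  fix m z
  have "(\<lambda>m. q m (t *s z)) sums f (t *s z)" for t by (rule expandsD(2)[OF assms])
  then have "(\<lambda>m. q m z * t ^ m) sums f (t *s z)" for t
    by (simp add: hom_polys_homogeneous[OF expandsD(1)[OF assms]] mult.commute)
  then have "(\<lambda>t. f (t *s z)) has_fps_expansion Abs_fps (\<lambda>m. q m z)"
    by (intro has_fps_expansionI) simp
  then show "hom_comp f m z = q m z"
    unfolding hom_comp_def using fps_nth_fps_expansion[of "\<lambda>t. f (t *s z)"] by fastforce
qed

lemma hom_comp_hom_poly:
  assumes q: "q \<in> hom_polys k"
  shows "hom_comp q m = (if m = k then q else (\<lambda>z. 0))"
proof -
  have "expands q (\<lambda>m. if m = k then q else (\<lambda>z. 0))"
    unfolding expands_def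
  proof (intro conjI allI)
    fix r :: real
    obtain M where M: "M \<ge> 0" "\<And>z. norm z \<le> r \<Longrightarrow> cmod (q z) \<le> M"
      using entire_bounded[OF hom_polys_entire[OF q], of r] by blast
    \<comment> \<open>The factor \<open>2 ^ k\<close> compensates for the required decay at the only
      index with a nonzero term.\<close>
    then show "\<exists>M. \<forall>m z. norm z \<le> r \<longrightarrow> cmod ((if m = k then q else (\<lambda>z. 0)) z) \<le> M / 2 ^ m"
      by (intro exI[of _ "M * 2 ^ k"]) auto
  next
    fix z
    show "(\<lambda>m. (if m = k then q else (\<lambda>z. 0)) z) sums q z"
      using sums_single[of k "\<lambda>_. q z"] by (rule sums_cong[THEN iffD1, rotated]) auto
  next
    fix m show "(if m = k then q else (\<lambda>z. 0)) \<in> hom_polys m" by (simp add: q hom_polys_zero)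
  qed
  then show ?thesis by (simp add: expands_imp_hom_comp)
qed

section \<open>Operations on homogeneous expansions\<close>

lemma expands_add:
  assumes "expands f q" "expands g r" shows "expands (\<lambda>z. f z + g z) (\<lambda>m z. q m z + r m z)"
  unfolding expands_def
proof (intro conjI allI)
  fix \<rho> :: real
  obtain M N where "\<And>m z. norm z \<le> \<rho> \<Longrightarrow> cmod (q m z) \<le> M / 2 ^ m" "\<And>m z. norm z \<le> \<rho> \<Longrightarrow> cmod (r m z) \<le> N / 2 ^ m"
    using expandsE[OF assms(1)] expandsE[OF assms(2)] by (metis (no_types))
  then have "norm z \<le> \<rho> \<Longrightarrow> cmod (q m z + r m z) \<le> (M + N) / 2 ^ m" for m z
    unfolding add_divide_distrib by (meson add_mono norm_triangle_ineq order_trans)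
  then show "\<exists>M. \<forall>m z. norm z \<le> \<rho> \<longrightarrow> cmod (q m z + r m z) \<le> M / 2 ^ m" by blast
qed (rule hom_polys_add sums_add expandsD[OF assms(1)] expandsD[OF assms(2)])+

text \<open>Bounded factors preserve the geometric bounds. With the reciprocals of
  \<open>of_nat (m + p) - c\<close> as factors, this constructs the preimages under the shifted
  Laplacian.\<close>

lemma expands_multiplier:
  assumes "expands f q" and a: "\<And>m. cmod (a m) \<le> A"
  shows "expands (\<lambda>z. \<Sum>m. a m * q m z) (\<lambda>m z. a m * q m z)"
  unfolding expands_def
proof (intro conjI allI)
  have A: "A \<ge> 0" using a[of 0] by (meson norm_ge_zero order_trans)
  have bnd: "\<exists>M. \<forall>m z. norm z \<le> r \<longrightarrow> cmod (a m * q m z) \<le> M / 2 ^ m" for r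
  proof -
    obtain M where "\<And>m z. norm z \<le> r \<Longrightarrow> cmod (q m z) \<le> M / 2 ^ m"
      using expandsE[OF assms(1)] by blast
    then have "norm z \<le> r \<Longrightarrow> cmod (a m * q m z) \<le> A * M / 2 ^ m" for m z
      unfolding norm_mult times_divide_eq_right[symmetric] by (intro mult_mono a A) auto
    then show ?thesis by blast
  qed
  then show "\<exists>M. \<forall>m z. norm z \<le> r \<longrightarrow> cmod (a m * q m z) \<le> M / 2 ^ m" for r .
  show "(\<lambda>m. a m * q m z) sums (\<Sum>m. a m * q m z)" for z
  proof -
    obtain M where M: "\<And>m. cmod (a m * q m z) \<le> M / 2 ^ m" using bnd[of "norm z"] by (meson order_refl)
    have "summable (\<lambda>m. M / 2 ^ m)"
      using summable_mult[OF summable_geometric[of "1/2::real"], of M] by (simp add: power_divide)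
    then have "summable (\<lambda>m. a m * q m z)"
      by (rule summable_comparison_test'[of _ 0]) (rule M)
    then show ?thesis by (rule summable_sums)
  qed
qed (rule hom_polys_cmult expandsD(1)[OF assms(1)])+

lemma expands_cmult:
  assumes "expands f q" shows "expands (\<lambda>z. c * f z) (\<lambda>m z. c * q m z)"
proof -
  have "(\<Sum>m. c * q m z) = c * f z" for z
    using sums_mult[OF expandsD(2)[OF assms], of c z] by (simp add: sums_iff)
  then show ?thesis using expands_multiplier[OF assms, of "\<lambda>_. c" "cmod c"] by simp
qed

lemma expands_coord_mult:
  assumes "expands f q"
  shows "expands (\<lambda>z. z $ j * f z) (\<lambda>m. case m of 0 \<Rightarrow> (\<lambda>z. 0) | Suc k \<Rightarrow> (\<lambda>z. z $ j * q k z))"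
  unfolding expands_def
proof (intro conjI allI)
  fix r :: real
  obtain M where M: "\<And>m z. norm z \<le> r \<Longrightarrow> cmod (q m z) \<le> M / 2 ^ m"
    using expandsE[OF assms(1)] by blast
  \<comment> \<open>The coordinate costs a factor \<open>r\<close>, and the shift of the index a
    factor 2.\<close>
  have "cmod ((case m of 0 \<Rightarrow> (\<lambda>z. 0) | Suc k \<Rightarrow> (\<lambda>z. z $ j * q k z)) z) \<le> (r * M * 2) / 2 ^ m" if "norm z \<le> r" for m z
  proof -
    have r: "r \<ge> 0" using that norm_ge_zero order_trans by blast
    have "M \<ge> 0" using M[OF that, of 0] by (simp add: order_trans[OF norm_ge_zero])
    moreover have "cmod (z $ j) * cmod (q k z) \<le> r * (M / 2 ^ k)" for k
      using M[OF that, of k] Finite_Cartesian_Product.norm_nth_le[of z j] that r by (intro mult_mono) auto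
    ultimately show ?thesis using r by (cases m) (auto simp: norm_mult)
  qed
  then show "\<exists>M. \<forall>m z. norm z \<le> r \<longrightarrow> cmod ((case m of 0 \<Rightarrow> (\<lambda>z. 0) | Suc k \<Rightarrow> (\<lambda>z. z $ j * q k z)) z) \<le> M / 2 ^ m"
    by blast
next
  fix z
  have "(\<lambda>m. z $ j * q m z) sums (z $ j * f z)" by (intro sums_mult expandsD(2)[OF assms])
  then show "(\<lambda>m. (case m of 0 \<Rightarrow> (\<lambda>z. 0) | Suc k \<Rightarrow> (\<lambda>z. z $ j * q k z)) z) sums (z $ j * f z)"
    using sums_Suc_iff[of "\<lambda>m. (case m of 0 \<Rightarrow> (\<lambda>z. 0) | Suc k \<Rightarrow> (\<lambda>z. z $ j * q k z)) z" "z $ j * f z"]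
    by simp
next
  fix m show "(case m of 0 \<Rightarrow> (\<lambda>z. 0) | Suc k \<Rightarrow> (\<lambda>z. z $ j * q k z)) \<in> hom_polys m"
    by (cases m) (simp_all add: hom_polys_zero hom_polys_coord_mult expandsD(1)[OF assms])
qed

text \<open>Complex derivatives of a uniformly convergent sequence of holomorphic functions converge
  to the derivative of the limit; this is applied to the partial sums on the unit disc in direction
  \<open>j\<close>. The component of degree 0 has derivative 0, so shifting the index loses no
  term.\<close>

lemma expands_partial_z:
  fixes f :: "complex^'n::finite \<Rightarrow> complex"
  assumes E: "expands f q"
  shows "expands (partial_z j f) (\<lambda>m. partial_z j (q (Suc m)))"
  unfolding expands_def
proof (intro conjI allI)
  have q: "q m \<in> hom_polys m" "entire (q m)" for m
    using expandsD(1)[OF E] hom_polys_entire by blast+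
  show "partial_z j (q (Suc m)) \<in> hom_polys m" for m
    using q by (intro hom_polys_partial_z)
  have bnd: "\<exists>M. \<forall>m z. norm z \<le> r \<longrightarrow> cmod (partial_z j (q m) z) \<le> M / 2 ^ m" for r
  proof -
    obtain M where "\<And>m z. norm z \<le> r + 1 \<Longrightarrow> cmod (q m z) \<le> M / 2 ^ m"
      using expandsE[OF E] by blast
    then have "norm z \<le> r \<Longrightarrow> cmod (partial_z j (q m) z) \<le> M / 2 ^ m" for m z
      by (intro partial_z_cauchy q) auto
    then show ?thesis by blast
  qed
  show "\<exists>M. \<forall>m z. norm z \<le> r \<longrightarrow> cmod (partial_z j (q (Suc m)) z) \<le> M / 2 ^ m" for r
  proof -
    obtain M where M: "\<And>m z. norm z \<le> r \<Longrightarrow> cmod (partial_z j (q m) z) \<le> M / 2 ^ m"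
      using bnd by blast
    have "cmod (partial_z j (q (Suc m)) z) \<le> (M / 2) / 2 ^ m" if "norm z \<le> r" for m z
      using M[OF that, of "Suc m"] by simp
    then show ?thesis by blast
  qed
  fix z
  define F where "F = (\<lambda>n w. \<Sum>m<n. q m (z + w *s axis j 1))"
  obtain M where M: "\<And>m y. norm y \<le> norm z + 1 \<Longrightarrow> cmod (q m y) \<le> M / 2 ^ m"
    using expandsE[OF E] by blast
  have "uniform_limit (cball 0 1) F (\<lambda>w. f (z + w *s axis j 1)) sequentially"
  proof -
    have "uniform_limit (cball 0 1) F (\<lambda>w. \<Sum>m. q m (z + w *s axis j 1)) sequentially"
      unfolding F_def
    proof (rule Weierstrass_m_test)
      show "summable (\<lambda>m. M / 2 ^ m)"
        using summable_mult[OF summable_geometric[of "1/2::real"], of M] by (simp add: power_divide)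
      fix m and w :: complex assume "w \<in> cball 0 1"
      then have "norm (z + w *s axis j 1) \<le> norm z + 1"
        by (intro order_trans[OF norm_triangle_ineq]) (simp add: norm_scalar_mult)
      then show "norm (q m (z + w *s axis j 1)) \<le> M / 2 ^ m" by (rule M)
    qed
    moreover have "(\<Sum>m. q m y) = f y" for y using expandsD(2)[OF E] by (simp add: sums_iff)
    ultimately show ?thesis by simp
  qed
  then obtain g' where g': "\<And>w. w \<in> ball 0 1 \<Longrightarrow> ((\<lambda>w. f (z + w *s axis j 1)) has_field_derivative g' w) (at w) \<and>
      (\<lambda>n. \<Sum>m<n. partial_z j (q m) (z + w *s axis j 1)) \<longlonglongrightarrow> g' w"
  proof (rule has_complex_derivative_uniform_limit[rotated])
    show "\<forall>\<^sub>F n in sequentially. continuous_on (cball 0 1) (F n) \<and>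
      (\<forall>w\<in>ball 0 1. (F n has_field_derivative (\<Sum>m<n. partial_z j (q m) (z + w *s axis j 1))) (at w))"
    proof (intro always_eventually allI conjI ballI)
      fix n w
      show D: "(F n has_field_derivative (\<Sum>m<n. partial_z j (q m) (z + w *s axis j 1))) (at w)" for w
        unfolding F_def by (intro DERIV_sum entire_partial_z q)
      show "continuous_on (cball 0 1) (F n)"
        using D by (meson DERIV_isCont continuous_at_imp_continuous_on)
    qed
  qed auto
  have "partial_z j f z = g' 0"
    using g'[of 0] DERIV_imp_deriv by (auto simp: partial_z_def shift_axis)
  then have "(\<lambda>m. partial_z j (q m) z) sums partial_z j f z"
    using g'[of 0] by (simp add: sums_def)
  then show "(\<lambda>m. partial_z j (q (Suc m)) z) sums partial_z j f z"
    using hom_polys_partial_z_0[of "q 0" j z] q(1)[of 0]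
      sums_Suc_iff[of "\<lambda>m. partial_z j (q m) z" "partial_z j f z"] by simp
qed

section \<open>Homogeneous components under the basic operations\<close>

lemma entire_imp_entire_partial_z: "entire f \<Longrightarrow> entire (partial_z j f)"
  using expands_imp_entire expands_partial_z expands_hom_comp by blast

lemma hom_comp_partial_z: "entire f \<Longrightarrow> hom_comp (partial_z j f) m = partial_z j (hom_comp f (Suc m))"
  using expands_imp_hom_comp[OF expands_partial_z[OF expands_hom_comp]] by metis

lemma hom_comp_coord_mult_Suc:
  "entire f \<Longrightarrow> hom_comp (\<lambda>z. z $ j * f z) (Suc m) = (\<lambda>z. z $ j * hom_comp f m z)"
  by (simp add: expands_imp_hom_comp[OF expands_coord_mult[OF expands_hom_comp]])

lemma hom_comp_coord_mult_0:
  "entire f \<Longrightarrow> hom_comp (\<lambda>z. z $ j * f z) 0 = (\<lambda>z. 0)"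
  by (simp add: expands_imp_hom_comp[OF expands_coord_mult[OF expands_hom_comp]])

lemma hom_comp_add:
  "entire f \<Longrightarrow> entire g \<Longrightarrow> hom_comp (\<lambda>z. f z + g z) m = (\<lambda>z. hom_comp f m z + hom_comp g m z)"
  by (simp add: expands_imp_hom_comp[OF expands_add[OF expands_hom_comp expands_hom_comp]])

lemma hom_comp_cmult:
  "entire f \<Longrightarrow> hom_comp (\<lambda>z. c * f z) m = (\<lambda>z. c * hom_comp f m z)"
  by (simp add: expands_imp_hom_comp[OF expands_cmult[OF expands_hom_comp]])

lemma hom_comp_diff:
  "entire f \<Longrightarrow> entire g \<Longrightarrow> hom_comp (\<lambda>z. f z - g z) m = (\<lambda>z. hom_comp f m z - hom_comp g m z)"
  using hom_comp_add[of f "\<lambda>z. (-1) * g z" m] hom_comp_cmult[of g "-1" m] entire_cmult[of g "-1"] by simp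

lemma hom_comp_zero: "hom_comp (\<lambda>z. 0) m = (\<lambda>z. 0)"
  using hom_comp_hom_poly[OF hom_polys_zero, of m m] by simp

lemma hom_comp_sum:
  "(\<And>i. i \<in> I \<Longrightarrow> entire (f i)) \<Longrightarrow> hom_comp (\<lambda>z. \<Sum>i\<in>I. f i z) m = (\<lambda>z. \<Sum>i\<in>I. hom_comp (f i) m z)"
  by (induction I rule: infinite_finite_induct) (auto simp: hom_comp_zero hom_comp_add entire_sum)

lemma entire_eqI:
  assumes "entire f" "entire g" "\<And>m z. hom_comp f m z = hom_comp g m z"
  shows "f = g"
proof
  fix z
  have "hom_comp f = hom_comp g" using assms(3) by blast
  then show "f z = g z" using hom_comp_sums[OF assms(1), of z] hom_comp_sums[OF assms(2), of z] sums_unique2 by metis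
qed

section \<open>Orthogonality of homogeneous components\<close>

lemma fock_integrand_measurable:
  fixes f g :: "complex^'n::finite \<Rightarrow> complex"
  assumes "f \<in> borel_measurable borel" "g \<in> borel_measurable borel"
  shows "(\<lambda>z. f z * cnj (g z) * of_real (exp (- (norm z)\<^sup>2))) \<in> borel_measurable borel"
proof -
  have [measurable]: "(\<lambda>z. cnj (g z)) \<in> borel_measurable borel"
    by (rule borel_measurable_continuous_on[OF _ assms(2)]) (auto intro: continuous_intros)
  show ?thesis using assms(1) by measurable
qed

lemma fock_space_entire: "f \<in> fock_space \<Longrightarrow> entire f"
  by (simp add: fock_space_def)

lemma fock_norm_square:
  "(fock_norm f)\<^sup>2 = (LINT z|lborel. (cmod (f z))\<^sup>2 * exp (- (norm z)\<^sup>2))"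
  unfolding fock_norm_def by (rule real_sqrt_pow2) (auto intro: integral_nonneg_AE)

lemma fock_inner_self: "fock_inner f f = of_real ((fock_norm f)\<^sup>2)"
  unfolding fock_norm_square fock_inner_def
  by (simp only: integral_complex_of_real[symmetric] of_real_mult complex_norm_square)

lemma fock_integrable:
  fixes f g :: "complex^'n::finite \<Rightarrow> complex"
  assumes f: "f \<in> fock_space" and g: "g \<in> fock_space"
  shows "integrable lborel (\<lambda>z. f z * cnj (g z) * of_real (exp (- (norm z)\<^sup>2)))"
proof (rule Bochner_Integration.integrable_bound)
  show "integrable lborel (\<lambda>z. (cmod (f z))\<^sup>2 * exp (- (norm z)\<^sup>2) + (cmod (g z))\<^sup>2 * exp (- (norm z)\<^sup>2))"
    using f g by (intro Bochner_Integration.integrable_add) (auto simp: fock_space_def)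
  show "(\<lambda>z. f z * cnj (g z) * of_real (exp (- (norm z)\<^sup>2))) \<in> borel_measurable lborel"
    using fock_integrand_measurable[OF entire_measurable[OF fock_space_entire[OF f]] entire_measurable[OF fock_space_entire[OF g]]]
    by simp
  have "norm (f z * cnj (g z) * of_real (exp (- (norm z)\<^sup>2)))
      \<le> norm ((cmod (f z))\<^sup>2 * exp (- (norm z)\<^sup>2) + (cmod (g z))\<^sup>2 * exp (- (norm z)\<^sup>2))" for z
  proof -
    have "0 \<le> (cmod (f z) - cmod (g z))\<^sup>2" by simp
    then have "cmod (f z) * cmod (g z) \<le> (cmod (f z))\<^sup>2 + (cmod (g z))\<^sup>2"
      using mult_nonneg_nonneg[OF norm_ge_zero[of "f z"] norm_ge_zero[of "g z"]]
      unfolding power2_diff by linarith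
    then have "cmod (f z) * cmod (g z) * exp (- (norm z)\<^sup>2) \<le> ((cmod (f z))\<^sup>2 + (cmod (g z))\<^sup>2) * exp (- (norm z)\<^sup>2)"
      by (rule mult_right_mono) simp
    then show ?thesis by (simp add: norm_mult distrib_right)
  qed
  then show "AE z in lborel. norm (f z * cnj (g z) * of_real (exp (- (norm z)\<^sup>2)))
      \<le> norm ((cmod (f z))\<^sup>2 * exp (- (norm z)\<^sup>2) + (cmod (g z))\<^sup>2 * exp (- (norm z)\<^sup>2))"
    by simp
qed

lemma fock_space_cmult: "f \<in> fock_space \<Longrightarrow> (\<lambda>z. c * f z) \<in> fock_space"
  by (auto simp: fock_space_def norm_mult power_mult_distrib mult.assoc intro: entire_cmult)

lemma fock_space_zero: "(\<lambda>z. 0) \<in> fock_space"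
  by (simp add: fock_space_def)

lemma fock_space_add:
  fixes f g :: "complex^'n::finite \<Rightarrow> complex"
  assumes f: "f \<in> fock_space" and g: "g \<in> fock_space"
  shows "(\<lambda>z. f z + g z) \<in> fock_space"
proof -
  let ?I = "\<lambda>z. (f z + g z) * cnj (f z + g z) * complex_of_real (exp (- (norm z)\<^sup>2))"
  have "integrable lborel (\<lambda>z. f z * cnj (f z) * complex_of_real (exp (- (norm z)\<^sup>2))
      + f z * cnj (g z) * complex_of_real (exp (- (norm z)\<^sup>2))
      + g z * cnj (f z) * complex_of_real (exp (- (norm z)\<^sup>2))
      + g z * cnj (g z) * complex_of_real (exp (- (norm z)\<^sup>2)))"
    by (intro Bochner_Integration.integrable_add fock_integrable f g)
  then have "integrable lborel ?I" by (simp add: algebra_simps)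
  then have "integrable lborel (\<lambda>z. norm (?I z))" by (rule integrable_norm)
  moreover have "norm (?I z) = (cmod (f z + g z))\<^sup>2 * exp (- (norm z)\<^sup>2)" for z
    by (simp only: norm_mult complex_mod_cnj power2_eq_square) simp
  ultimately show ?thesis
    using f g by (simp add: fock_space_def entire_add)
qed

lemma fock_inner_add_left:
  fixes f g h :: "complex^'n::finite \<Rightarrow> complex"
  assumes "f \<in> fock_space" "g \<in> fock_space" "h \<in> fock_space"
  shows "fock_inner (\<lambda>z. f z + g z) h = fock_inner f h + fock_inner g h"
  unfolding fock_inner_def distrib_right
  by (rule Bochner_Integration.integral_add) (intro fock_integrable assms)+

lemma fock_inner_add_right:
  fixes f g h :: "complex^'n::finite \<Rightarrow> complex"
  assumes "f \<in> fock_space" "g \<in> fock_space" "h \<in> fock_space"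
  shows "fock_inner h (\<lambda>z. f z + g z) = fock_inner h f + fock_inner h g"
  unfolding fock_inner_def distrib_right distrib_left complex_cnj_add
  by (rule Bochner_Integration.integral_add) (intro fock_integrable assms)+

lemma fock_inner_cmult_left: "fock_inner (\<lambda>z. c * f z) g = c * fock_inner f g"
  unfolding fock_inner_def by (simp add: mult.assoc)

lemma fock_inner_cmult_right: "fock_inner f (\<lambda>z. c * g z) = cnj c * fock_inner f g"
  unfolding fock_inner_def by (simp add: mult_ac)

lemma fock_inner_zero [simp]: "fock_inner f (\<lambda>z. 0) = 0" "fock_inner (\<lambda>z. 0) f = 0"
  unfolding fock_inner_def by simp_all

lemma hom_polys_fock_space:
  fixes q :: "complex^'n::finite \<Rightarrow> complex"
  assumes q: "q \<in> hom_polys m" shows "q \<in> fock_space"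
proof -
  obtain C where C: "C \<ge> 0" "\<And>z. cmod (q z) \<le> C * norm z ^ m"
    by (rule hom_polys_bound[OF q]) blast
  have "norm ((cmod (q z))\<^sup>2) \<le> C\<^sup>2 * (1 + norm z) ^ (2 * m)" for z
  proof -
    have "C * norm z ^ m \<le> C * (1 + norm z) ^ m" using C(1) by (intro mult_left_mono power_mono) auto
    then have "cmod (q z) \<le> C * (1 + norm z) ^ m" using C(2)[of z] by linarith
    then have "(cmod (q z))\<^sup>2 \<le> (C * (1 + norm z) ^ m)\<^sup>2" by (rule power_mono) simp
    then show ?thesis by (simp add: power_mult_distrib power_mult[symmetric] mult.commute)
  qed
  moreover have [measurable]: "q \<in> borel_measurable borel" by (intro entire_measurable hom_polys_entire[OF q])
  ultimately have "integrable lborel (\<lambda>z. exp (- (norm z)\<^sup>2) *\<^sub>R (cmod (q z))\<^sup>2)"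
    by (intro integrable_polynomial_growth_gaussian) measurable
  then show ?thesis using hom_polys_entire[OF q] by (simp add: fock_space_def mult.commute)
qed

text \<open>Substituting \<open>c z\<close> with \<open>c = e\<^sup>i\<^sup>\<theta>\<close>, \<open>\<theta> = \<pi> / (m - k)\<close>, multiplies the integrand by \<open>-1\<close>.\<close>

lemma hom_polys_orthogonal:
  fixes q r :: "complex^'n::finite \<Rightarrow> complex"
  assumes q: "q \<in> hom_polys m" and r: "r \<in> hom_polys k" and mk: "m \<noteq> k"
    and w: "w \<in> borel_measurable borel"
  shows "(LINT z|lborel. q z * cnj (r z) * of_real (w (norm z) :: real)) = 0"
proof -
  define \<theta> where "\<theta> = pi / (real m - real k)"
  define c where "c = cis \<theta>"
  have nc: "norm (c *s z) = norm z" for z :: "complex^'n" by (simp add: norm_scalar_mult c_def)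
  have [measurable]: "q \<in> borel_measurable borel" by (intro entire_measurable hom_polys_entire[OF q])
  have [measurable]: "(\<lambda>z. cnj (r z)) \<in> borel_measurable borel"
    by (rule borel_measurable_continuous_on[OF _ entire_measurable[OF hom_polys_entire[OF r]]])
      (auto intro: continuous_intros)
  have F: "(\<lambda>z. q z * cnj (r z) * of_real (w (norm z))) \<in> borel_measurable borel"
    using w by measurable
  have "c ^ m * cnj c ^ k = cis (real m * \<theta>) * cis (- (real k * \<theta>))"
    by (simp add: c_def Complex.DeMoivre cis_cnj)
  also have "\<dots> = cis ((real m - real k) * \<theta>)" by (simp add: cis_mult algebra_simps)
  also have "\<dots> = -1" using mk by (simp add: \<theta>_def)
  finally have c: "c ^ m * cnj c ^ k = -1" .
  have "(LINT z|lborel. q z * cnj (r z) * of_real (w (norm z)))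
      = (LINT z|lborel. q (c *s z) * cnj (r (c *s z)) * of_real (w (norm (c *s z))))"
    using integral_linear_isometry[OF linear_scalar_mult_right nc F] by simp
  also have "\<dots> = (LINT z|lborel. (c ^ m * cnj c ^ k) * (q z * cnj (r z) * of_real (w (norm z))))"
    by (simp add: hom_polys_homogeneous[OF q] hom_polys_homogeneous[OF r] nc mult_ac)
  also have "\<dots> = - (LINT z|lborel. q z * cnj (r z) * of_real (w (norm z)))"
    unfolding c by simp
  finally show ?thesis by (simp add: complex_eq_iff)
qed

section \<open>Parseval's identity\<close>

text \<open>The Gaussian cut off to an open ball: there the homogeneous expansion converges
  uniformly and every entire function is square integrable. The weight stays rotation invariant, so
  components remain orthogonal.\<close>

definition ball_weight :: "real \<Rightarrow> real \<Rightarrow> real" where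
  "ball_weight R x = indicator {..<R} x * exp (- x\<^sup>2)"

lemma ball_weight_measurable [measurable]: "ball_weight R \<in> borel_measurable borel"
  unfolding ball_weight_def by measurable

lemma ball_weight_bounds: "0 \<le> ball_weight R x" "ball_weight R x \<le> indicator {..<R} x"
  by (auto simp: ball_weight_def indicator_def)

lemma ball_weight_integrable:
  fixes F :: "complex^'n::finite \<Rightarrow> 'b::{banach, second_countable_topology}"
  assumes m: "F \<in> borel_measurable borel" and B: "\<And>z. norm z \<le> R \<Longrightarrow> norm (F z) \<le> B"
  shows "integrable lborel (\<lambda>z. ball_weight R (norm z) *\<^sub>R F z)"
proof (rule Bochner_Integration.integrable_bound)
  show "integrable lborel (\<lambda>z::complex^'n. B * indicator (ball 0 R) z)"
    by (intro integrable_mult_right integrable_real_indicator) (simp_all only: emeasure_lborel_ball_finite sets_lborel borel_open open_ball)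
  have "norm (ball_weight R (norm z) *\<^sub>R F z) \<le> norm (B * indicator (ball 0 R) z)" for z
  proof (cases "norm z < R")
    case True
    have "ball_weight R (norm z) * norm (F z) \<le> 1 * B"
      using True ball_weight_bounds[of R "norm z"] B[of z] by (intro mult_mono) auto
    then show ?thesis using True ball_weight_bounds(1)[of R "norm z"] by simp
  qed (simp add: ball_weight_def)
  then show "AE z in lborel. norm (ball_weight R (norm z) *\<^sub>R F z) \<le> norm (B * indicator (ball 0 R) z)" by simp
qed (use m in measurable)

text \<open>Orthogonality gives the identity for partial sums. On the ball these are bounded by
  \<open>2 * M\<close>, the sum of the geometric majorant, so dominated convergence passes to the
  limit.\<close>

lemma ball_parseval:
  fixes f :: "complex^'n::finite \<Rightarrow> complex"
  assumes f: "entire f"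
  shows "(\<lambda>m. LINT z|lborel. ball_weight R (norm z) *\<^sub>R (cmod (hom_comp f m z))\<^sup>2) sums
    (LINT z|lborel. ball_weight R (norm z) *\<^sub>R (cmod (f z))\<^sup>2)"
proof -
  define q where "q = hom_comp f"
  have q: "q m \<in> hom_polys m" "entire (q m)" for m
    unfolding q_def using hom_comp_hom_polys[OF f] hom_polys_entire by blast+
  have qm[measurable]: "q m \<in> borel_measurable borel" for m using entire_measurable q by blast
  have fm[measurable]: "f \<in> borel_measurable borel" using entire_measurable f by blast
  have [measurable]: "(\<lambda>z. cnj (q m z)) \<in> borel_measurable borel" for m
    by (rule borel_measurable_continuous_on[OF _ qm]) (auto intro: continuous_intros)
  define S where "S = (\<lambda>n z. \<Sum>m<n. q m z)"
  have Sm[measurable]: "S n \<in> borel_measurable borel" for n unfolding S_def by measurable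
  obtain M where M: "\<And>m z. norm z \<le> R \<Longrightarrow> cmod (q m z) \<le> M / 2 ^ m"
    unfolding q_def using expandsE[OF expands_hom_comp[OF f]] by blast
  have int: "integrable lborel (\<lambda>z. ball_weight R (norm z) *\<^sub>R (q m z * cnj (q k z)))" for m k
  proof (rule ball_weight_integrable)
    fix z :: "complex^'n" assume "norm z \<le> R"
    then show "norm (q m z * cnj (q k z)) \<le> (M / 2 ^ m) * (M / 2 ^ k)"
      unfolding norm_mult complex_mod_cnj using M order_trans[OF norm_ge_zero]
      by (intro mult_mono) blast+
  qed measurable
  have orth: "(LINT z|lborel. ball_weight R (norm z) *\<^sub>R (q m z * cnj (q k z))) = 0" if "m \<noteq> k" for m k
    using hom_polys_orthogonal[OF q(1) q(1) that ball_weight_measurable[of R]]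
    by (simp add: scaleR_conv_of_real mult_ac)
  have partial: "(LINT z|lborel. ball_weight R (norm z) *\<^sub>R (cmod (S n z))\<^sup>2)
      = (\<Sum>m<n. LINT z|lborel. ball_weight R (norm z) *\<^sub>R (cmod (q m z))\<^sup>2)" for n
  proof -
    have sq: "complex_of_real (LINT z|lborel. ball_weight R (norm z) *\<^sub>R (cmod (g z))\<^sup>2)
        = (LINT z|lborel. ball_weight R (norm z) *\<^sub>R (g z * cnj (g z)))" for g :: "complex^'n \<Rightarrow> complex"
      unfolding integral_complex_of_real[symmetric]
      by (intro Bochner_Integration.integral_cong refl)
        (simp only: real_scaleR_def of_real_mult complex_norm_square scaleR_conv_of_real)
    have "complex_of_real (LINT z|lborel. ball_weight R (norm z) *\<^sub>R (cmod (S n z))\<^sup>2)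
        = (LINT z|lborel. (\<Sum>m<n. \<Sum>k<n. ball_weight R (norm z) *\<^sub>R (q m z * cnj (q k z))))"
      unfolding sq S_def by (simp add: sum_product scaleR_sum_right)
    also have "\<dots> = (\<Sum>m<n. \<Sum>k<n. LINT z|lborel. ball_weight R (norm z) *\<^sub>R (q m z * cnj (q k z)))"
      by (simp add: Bochner_Integration.integral_sum int Bochner_Integration.integrable_sum)
    also have "\<dots> = (\<Sum>m<n. \<Sum>k<n. if k = m then (LINT z|lborel. ball_weight R (norm z) *\<^sub>R (q m z * cnj (q m z))) else 0)"
      by (intro sum.cong refl) (auto simp: orth)
    also have "\<dots> = (\<Sum>m<n. LINT z|lborel. ball_weight R (norm z) *\<^sub>R (q m z * cnj (q m z)))"
      by simp
    also have "\<dots> = complex_of_real (\<Sum>m<n. LINT z|lborel. ball_weight R (norm z) *\<^sub>R (cmod (q m z))\<^sup>2)"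
      unfolding of_real_sum sq ..
    finally show ?thesis by (simp only: of_real_eq_iff)
  qed
  have lim: "(\<lambda>n. LINT z|lborel. ball_weight R (norm z) *\<^sub>R (cmod (S n z))\<^sup>2) \<longlonglongrightarrow>
      (LINT z|lborel. ball_weight R (norm z) *\<^sub>R (cmod (f z))\<^sup>2)"
  proof (rule integral_dominated_convergence)
    show "integrable lborel (\<lambda>z::complex^'n. ball_weight R (norm z) *\<^sub>R (2 * M)\<^sup>2)"
      by (rule ball_weight_integrable) auto
    show "AE z in lborel. (\<lambda>n. ball_weight R (norm z) *\<^sub>R (cmod (S n z))\<^sup>2) \<longlonglongrightarrow> ball_weight R (norm z) *\<^sub>R (cmod (f z))\<^sup>2"
      using hom_comp_sums[OF f] unfolding S_def q_def sums_def
      by (intro always_eventually allI tendsto_intros) auto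
    show "AE z in lborel. norm (ball_weight R (norm z) *\<^sub>R (cmod (S n z))\<^sup>2) \<le> ball_weight R (norm z) *\<^sub>R (2 * M)\<^sup>2" for n
    proof (intro always_eventually allI)
      fix z :: "complex^'n"
      show "norm (ball_weight R (norm z) *\<^sub>R (cmod (S n z))\<^sup>2) \<le> ball_weight R (norm z) *\<^sub>R (2 * M)\<^sup>2"
      proof (cases "norm z < R")
        case True
        have M0: "M \<ge> 0" using M[of z 0] True by (simp add: order_trans[OF norm_ge_zero])
        have G: "(\<lambda>m. M / 2 ^ m) sums (2 * M)"
          using sums_mult[OF geometric_sums[of "1/2::real"], of M] by (simp add: power_divide mult.commute)
        have "cmod (S n z) \<le> (\<Sum>m<n. M / 2 ^ m)" unfolding S_def using True by (intro sum_norm_le M) auto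
        also have "\<dots> \<le> 2 * M" using sum_le_suminf[of "\<lambda>m. M / 2 ^ m" "{..<n}"] G M0 by (simp add: sums_iff)
        finally have "(cmod (S n z))\<^sup>2 \<le> (2 * M)\<^sup>2" by (rule power_mono) simp
        then show ?thesis using ball_weight_bounds(1)[of R "norm z"]
          by (simp add: mult_left_mono)
      qed (simp add: ball_weight_def)
    qed
  qed measurable
  show ?thesis using lim unfolding partial sums_def q_def .
qed

text \<open>The radius of the balls tends to infinity; for values in \<open>ennreal\<close>, both
  the integral and the series over \<open>m\<close> commute with this monotone limit. Holding for
  all entire functions, with infinite values allowed, the identity can serve as a test for
  membership in the Fock space.\<close>

lemma nn_parseval:
  fixes f :: "complex^'n::finite \<Rightarrow> complex"
  assumes f: "entire f"
  shows "(\<integral>\<^sup>+z. ennreal ((cmod (f z))\<^sup>2 * exp (- (norm z)\<^sup>2)) \<partial>lborel)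
    = (\<Sum>m. \<integral>\<^sup>+z. ennreal ((cmod (hom_comp f m z))\<^sup>2 * exp (- (norm z)\<^sup>2)) \<partial>lborel)"
proof -
  define B where "B = (\<lambda>(g :: complex^'n \<Rightarrow> complex) (R::nat). \<integral>\<^sup>+z. ennreal (ball_weight R (norm z) *\<^sub>R (cmod (g z))\<^sup>2) \<partial>lborel)"
  have mono: "ball_weight (real R) x \<le> ball_weight (real R') x" if "R \<le> R'" for R R' :: nat and x
    using that by (auto simp: ball_weight_def indicator_def)
  have B_int: "B g R = ennreal (LINT z|lborel. ball_weight R (norm z) *\<^sub>R (cmod (g z))\<^sup>2)" if g: "entire g" for g R
  proof -
    obtain M where M: "\<And>z. norm z \<le> R \<Longrightarrow> cmod (g z) \<le> M" using entire_bounded[OF g, of R] by blast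
    have [measurable]: "g \<in> borel_measurable borel" using entire_measurable g by blast
    have "integrable lborel (\<lambda>z. ball_weight R (norm z) *\<^sub>R (cmod (g z))\<^sup>2)"
      by (rule ball_weight_integrable[where B = "M\<^sup>2"]) (auto intro!: power_mono M)
    then show ?thesis unfolding B_def
      by (intro nn_integral_eq_integral) (auto simp: ball_weight_bounds)
  qed
  have B_SUP: "(\<integral>\<^sup>+z. ennreal ((cmod (g z))\<^sup>2 * exp (- (norm z)\<^sup>2)) \<partial>lborel) = (SUP R. B g R)" if g: "entire g" for g
  proof -
    have [measurable]: "g \<in> borel_measurable borel" using entire_measurable g by blast
    have "(SUP R::nat. ennreal (ball_weight R (norm z) *\<^sub>R (cmod (g z))\<^sup>2)) = ennreal ((cmod (g z))\<^sup>2 * exp (- (norm z)\<^sup>2))" for z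
    proof (rule antisym)
      show "(SUP R::nat. ennreal (ball_weight R (norm z) *\<^sub>R (cmod (g z))\<^sup>2)) \<le> ennreal ((cmod (g z))\<^sup>2 * exp (- (norm z)\<^sup>2))"
        by (intro SUP_least ennreal_leI) (auto simp: ball_weight_def indicator_def)
      obtain R :: nat where "norm z < R" using reals_Archimedean2 by blast
      then show "ennreal ((cmod (g z))\<^sup>2 * exp (- (norm z)\<^sup>2)) \<le> (SUP R::nat. ennreal (ball_weight R (norm z) *\<^sub>R (cmod (g z))\<^sup>2))"
        by (intro SUP_upper2[of R]) (auto simp: ball_weight_def)
    qed
    then have "(\<integral>\<^sup>+z. ennreal ((cmod (g z))\<^sup>2 * exp (- (norm z)\<^sup>2)) \<partial>lborel)
        = (\<integral>\<^sup>+z. (SUP R::nat. ennreal (ball_weight R (norm z) *\<^sub>R (cmod (g z))\<^sup>2)) \<partial>lborel)" by simp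
    also have "\<dots> = (SUP R. B g R)" unfolding B_def
    proof (rule nn_integral_monotone_convergence_SUP)
      show "incseq (\<lambda>(R::nat) z. ennreal (ball_weight R (norm z) *\<^sub>R (cmod (g z))\<^sup>2))"
        by (auto simp: incseq_def le_fun_def intro!: ennreal_leI mult_right_mono mono)
    qed measurable
    finally show ?thesis .
  qed
  have q: "entire (hom_comp f m)" for m using hom_polys_entire hom_comp_hom_polys[OF f] by blast
  have "B f R = (\<Sum>m. B (hom_comp f m) R)" for R
  proof -
    have "(\<Sum>m. ennreal (LINT z|lborel. ball_weight R (norm z) *\<^sub>R (cmod (hom_comp f m z))\<^sup>2))
        = ennreal (LINT z|lborel. ball_weight R (norm z) *\<^sub>R (cmod (f z))\<^sup>2)"
      using ball_parseval[OF f, of R]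
      by (intro suminf_ennreal_eq) (auto intro!: integral_nonneg_AE simp: ball_weight_bounds)
    then show ?thesis by (simp add: B_int f q)
  qed
  then have "(SUP R. B f R) = (SUP R. \<Sum>m. B (hom_comp f m) R)" by simp
  also have "\<dots> = (\<Sum>m. SUP R. B (hom_comp f m) R)"
  proof (rule ennreal_suminf_SUP_eq[symmetric])
    show "incseq (\<lambda>n. B (hom_comp f i) n)" for i
      unfolding incseq_def B_def by (auto intro!: nn_integral_mono ennreal_leI mult_right_mono mono)
  qed
  finally show ?thesis by (simp add: B_SUP f q)
qed

lemma nn_integral_fock_norm:
  assumes "f \<in> fock_space"
  shows "(\<integral>\<^sup>+z. ennreal ((cmod (f z))\<^sup>2 * exp (- (norm z)\<^sup>2)) \<partial>lborel) = ennreal ((fock_norm f)\<^sup>2)"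
  unfolding fock_norm_square using assms
  by (intro nn_integral_eq_integral) (auto simp: fock_space_def)

text \<open>Square integrability becomes a condition on the component norms; this is how the
  resolvent and the domain of the Laplacian are handled below.\<close>

lemma fock_space_iff_summable:
  fixes f :: "complex^'n::finite \<Rightarrow> complex"
  assumes f: "entire f"
  shows "f \<in> fock_space \<longleftrightarrow> summable (\<lambda>m. (fock_norm (hom_comp f m))\<^sup>2)"
    and fock_norm_sums: "f \<in> fock_space \<Longrightarrow> (\<lambda>m. (fock_norm (hom_comp f m))\<^sup>2) sums (fock_norm f)\<^sup>2"
proof -
  have q: "hom_comp f m \<in> fock_space" for m using hom_polys_fock_space hom_comp_hom_polys[OF f] by blast
  have P: "(\<integral>\<^sup>+z. ennreal ((cmod (f z))\<^sup>2 * exp (- (norm z)\<^sup>2)) \<partial>lborel) = (\<Sum>m. ennreal ((fock_norm (hom_comp f m))\<^sup>2))"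
    using nn_parseval[OF f] nn_integral_fock_norm[OF q] by simp
  have [measurable]: "f \<in> borel_measurable borel" using entire_measurable f by blast
  show iff: "f \<in> fock_space \<longleftrightarrow> summable (\<lambda>m. (fock_norm (hom_comp f m))\<^sup>2)"
  proof
    assume F: "f \<in> fock_space"
    have "(\<Sum>m. ennreal ((fock_norm (hom_comp f m))\<^sup>2)) \<noteq> top"
      unfolding P[symmetric] nn_integral_fock_norm[OF F] by simp
    then show "summable (\<lambda>m. (fock_norm (hom_comp f m))\<^sup>2)" by (intro summable_suminf_not_top) auto
  next
    assume s: "summable (\<lambda>m. (fock_norm (hom_comp f m))\<^sup>2)"
    have "integrable lborel (\<lambda>z. (cmod (f z))\<^sup>2 * exp (- (norm z)\<^sup>2))"
    proof (rule integrableI_nonneg)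
      show "(\<integral>\<^sup>+z. ennreal ((cmod (f z))\<^sup>2 * exp (- (norm z)\<^sup>2)) \<partial>lborel) < \<infinity>"
        unfolding P by (subst suminf_ennreal2[OF _ s]) simp_all
    qed auto
    then show "f \<in> fock_space" using f by (simp add: fock_space_def)
  qed
  assume F: "f \<in> fock_space"
  then have s: "summable (\<lambda>m. (fock_norm (hom_comp f m))\<^sup>2)" using iff by blast
  have "ennreal (\<Sum>m. (fock_norm (hom_comp f m))\<^sup>2) = ennreal ((fock_norm f)\<^sup>2)"
    unfolding nn_integral_fock_norm[OF F, symmetric] P by (rule suminf_ennreal2[OF _ s, symmetric]) simp
  then have "(\<Sum>m. (fock_norm (hom_comp f m))\<^sup>2) = (fock_norm f)\<^sup>2"
    by (subst (asm) ennreal_inj) (auto intro!: suminf_nonneg s)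
  then show "(\<lambda>m. (fock_norm (hom_comp f m))\<^sup>2) sums (fock_norm f)\<^sup>2" using s by (simp add: sums_iff)
qed

text \<open>All four terms have the shape \<open>f z + c * g z\<close>, so that a single statement
  about norms, taken at four values of \<open>c\<close>, transfers Parseval's identity to inner
  products.\<close>

lemma fock_polarization:
  fixes f g :: "complex^'n::finite \<Rightarrow> complex"
  assumes f: "f \<in> fock_space" and g: "g \<in> fock_space"
  shows "4 * fock_inner f g = of_real ((fock_norm (\<lambda>z. f z + 1 * g z))\<^sup>2) - of_real ((fock_norm (\<lambda>z. f z + (-1) * g z))\<^sup>2)
    + \<i> * of_real ((fock_norm (\<lambda>z. f z + \<i> * g z))\<^sup>2) - \<i> * of_real ((fock_norm (\<lambda>z. f z + (-\<i>) * g z))\<^sup>2)"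
proof -
  have "fock_inner (\<lambda>z. f z + c * g z) (\<lambda>z. f z + c * g z)
      = fock_inner f f + c * fock_inner g f + cnj c * fock_inner f g + c * cnj c * fock_inner g g" for c
    using f g fock_space_cmult[OF g, of c] fock_space_add[OF f fock_space_cmult[OF g, of c]]
    by (simp only: fock_inner_add_left fock_inner_add_right fock_inner_cmult_left fock_inner_cmult_right)
      (simp add: algebra_simps)
  note E = this
  show ?thesis unfolding fock_inner_self[symmetric] E by (simp add: algebra_simps)
qed

lemma fock_inner_sums:
  fixes f g :: "complex^'n::finite \<Rightarrow> complex"
  assumes f: "f \<in> fock_space" and g: "g \<in> fock_space"
  shows "(\<lambda>m. fock_inner (hom_comp f m) (hom_comp g m)) sums fock_inner f g"
proof -
  note ef = fock_space_entire[OF f] and eg = fock_space_entire[OF g]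
  have N: "(\<lambda>m. complex_of_real ((fock_norm (\<lambda>z. hom_comp f m z + c * hom_comp g m z))\<^sup>2)) sums of_real ((fock_norm (\<lambda>z. f z + c * g z))\<^sup>2)" for c
    using fock_norm_sums[OF fock_space_entire fock_space_add[OF f fock_space_cmult[OF g, of c]]]
      fock_space_add[OF f fock_space_cmult[OF g, of c]]
    unfolding sums_of_real_iff by (simp add: hom_comp_add hom_comp_cmult entire_cmult ef eg)
  have q: "hom_comp f m \<in> fock_space" "hom_comp g m \<in> fock_space" for m
    using hom_polys_fock_space hom_comp_hom_polys ef eg by blast+
  have "(\<lambda>m. 4 * fock_inner (hom_comp f m) (hom_comp g m)) sums (4 * fock_inner f g)"
    unfolding fock_polarization[OF f g] fock_polarization[OF q]
    by (intro sums_add sums_diff sums_mult N)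
  then show ?thesis using sums_mult_D[of 4] by (simp add: sums_mult_iff)
qed

text \<open>The set where \<open>f\<close> is nonzero is a null set, and it is open by continuity;
  an open null set is empty.\<close>

lemma fock_norm_eq_0:
  fixes f :: "complex^'n::finite \<Rightarrow> complex"
  assumes f: "f \<in> fock_space" and z: "fock_norm f = 0"
  shows "f = (\<lambda>z. 0)"
proof -
  have "AE z in lborel. (cmod (f z))\<^sup>2 * exp (- (norm z)\<^sup>2) = 0"
    using f fock_norm_square[of f] z
    by (subst integral_nonneg_eq_0_iff_AE[symmetric]) (auto simp: fock_space_def)
  then have "AE z in lborel. f z = 0" by simp
  then have ae: "{z. f z \<noteq> 0} \<in> null_sets lborel"
    using AE_iff_null[of lborel "\<lambda>z. f z = 0"] entire_measurable[OF fock_space_entire[OF f]] by simp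
  then have "negligible {z. f z \<noteq> 0}"
    by (simp add: negligible_iff_null_sets null_sets_completionI)
  moreover have "open {z. f z \<noteq> 0}"
    using entire_continuous_on[OF fock_space_entire[OF f], of UNIV]
    by (intro open_Collect_neq continuous_on_const)
  ultimately have "{z. f z \<noteq> 0} = {}" using open_not_negligible by blast
  then show ?thesis by auto
qed

section \<open>Multiplication is adjoint to differentiation\<close>

lemma has_vector_derivative_axis:
  fixes q :: "complex^'n::finite \<Rightarrow> complex"
  assumes q: "entire q"
  shows "((\<lambda>t. q (z + t *\<^sub>R axis j c)) has_vector_derivative c * partial_z j q (z + t *\<^sub>R axis j c)) (at t)"
proof -
  have ax: "t *\<^sub>R axis j c = (of_real t * c) *s axis j 1" for t :: real
    by (simp add: vec_eq_iff axis_def scaleR_conv_of_real[of t c])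
  have "((\<lambda>s. q (z + (s * c) *s axis j 1)) has_field_derivative partial_z j q (z + (of_real t * c) *s axis j 1) * c) (at (of_real t))"
    by (rule DERIV_chain2[where g = "\<lambda>s. s * c", OF entire_partial_z[OF q]]) (auto intro!: derivative_eq_intros)
  then show ?thesis
    unfolding ax by (subst mult.commute) (rule has_vector_derivative_real_field)
qed

lemma gaussian_has_vector_derivative_axis:
  fixes z :: "complex^'n::finite"
  shows "((\<lambda>t. of_real (exp (- (norm (z + t *\<^sub>R axis j c))\<^sup>2)) :: complex) has_vector_derivative
    of_real (- (2 * ((z + t *\<^sub>R axis j c) $ j \<bullet> c)) * exp (- (norm (z + t *\<^sub>R axis j c))\<^sup>2))) (at t)"
proof -
  have "((\<lambda>t. exp (- ((z + t *\<^sub>R axis j c) \<bullet> (z + t *\<^sub>R axis j c)))) has_real_derivative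
      - (2 * ((z + t *\<^sub>R axis j c) \<bullet> axis j c)) * exp (- ((z + t *\<^sub>R axis j c) \<bullet> (z + t *\<^sub>R axis j c)))) (at t)"
    by (auto intro!: derivative_eq_intros simp: has_real_derivative_iff_has_vector_derivative has_vector_derivative_def
        inner_commute algebra_simps)
  then show ?thesis
    unfolding power2_norm_eq_inner inner_axis
    by (intro has_vector_derivative_of_real) (simp add: has_real_derivative_iff_has_vector_derivative)
qed

lemma hom_polys_partial_z_fock_space: "q \<in> hom_polys m \<Longrightarrow> partial_z j q \<in> fock_space"
proof (cases m)
  case 0
  assume "q \<in> hom_polys m"
  then have "partial_z j q = (\<lambda>z. 0)" using hom_polys_partial_z_0 0 by blast
  then show ?thesis by (simp add: fock_space_zero)
qed (blast intro: hom_polys_fock_space hom_polys_partial_z)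

text \<open>Integrate the derivatives of \<open>q * cnj r * exp (- (norm z)\<^sup>2)\<close> in the real directions \<open>e\<^sub>j\<close> and
  \<open>\<i> e\<^sub>j\<close>; the combination \<open>\<partial>/\<partial>x\<^sub>j - \<i> \<partial>/\<partial>y\<^sub>j\<close> annihilates \<open>cnj r\<close>.\<close>

lemma fock_inner_partial_z:
  fixes q r :: "complex^'n::finite \<Rightarrow> complex"
  assumes q: "q \<in> hom_polys m" and r: "r \<in> hom_polys k"
  shows "fock_inner (partial_z j q) r = fock_inner q (\<lambda>z. z $ j * r z)"
proof -
  note eq = hom_polys_entire[OF q] and er = hom_polys_entire[OF r]
  define w :: "complex^'n \<Rightarrow> complex" where "w = (\<lambda>z. of_real (exp (- (norm z)\<^sup>2)))"
  define T where "T = (\<lambda>f g z. f z * cnj (g z) * w z)"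
  define zq where "zq = (\<lambda>z. z $ j * q z)"
  define zr where "zr = (\<lambda>z. z $ j * r z)"
  have F: "q \<in> fock_space" "r \<in> fock_space" "partial_z j q \<in> fock_space" "partial_z j r \<in> fock_space"
    "zq \<in> fock_space" "zr \<in> fock_space"
    unfolding zq_def zr_def using q r
    by (blast intro: hom_polys_fock_space hom_polys_partial_z_fock_space hom_polys_coord_mult)+
  have int: "integrable lborel (T f g)" if "f \<in> fock_space" "g \<in> fock_space" for f g
    unfolding T_def w_def by (rule fock_integrable[OF that])
  have inner: "fock_inner f g = (LINT z|lborel. T f g z)" for f g
    unfolding fock_inner_def T_def w_def ..
  have cont: "continuous_on UNIV (T f g)" if "f \<in> fock_space" "g \<in> fock_space" for f g
    unfolding T_def w_def
    by (intro continuous_intros entire_continuous_on fock_space_entire that)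
  define f' where "f' = (\<lambda>c z. c * T (partial_z j q) r z + cnj c * T q (partial_z j r) z
      - cnj c * T zq r z - c * T q zr z)"
  have main: "c * fock_inner (partial_z j q) r + cnj c * fock_inner q (partial_z j r)
      - cnj c * fock_inner zq r - c * fock_inner q zr = 0" for c
  proof -
    have "(LINT z|lborel. f' c z) = 0"
    proof (rule integral_directional_derivative[where f = "T q r" and v = "axis j c"])
      fix z t
      let ?y = "z + t *\<^sub>R axis j c"
      have D: "((\<lambda>t. T q r (z + t *\<^sub>R axis j c)) has_vector_derivative
          (q ?y * cnj (r ?y)) * of_real (- (2 * (?y $ j \<bullet> c)) * exp (- (norm ?y)\<^sup>2))
          + (q ?y * cnj (c * partial_z j r ?y) + c * partial_z j q ?y * cnj (r ?y)) * of_real (exp (- (norm ?y)\<^sup>2))) (at t)"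
        unfolding T_def w_def
        by (intro has_vector_derivative_mult has_vector_derivative_cnj has_vector_derivative_axis
            gaussian_has_vector_derivative_axis eq er)
      \<comment> \<open>The derivative of the Gaussian exponent splits into a part with
        \<open>c\<close> and a part with \<open>cnj c\<close>; they produce the terms with
        \<open>zr\<close> and \<open>zq\<close> in \<open>f'\<close>.\<close>
      have "complex_of_real (2 * (?y $ j \<bullet> c)) = ?y $ j * cnj c + cnj (?y $ j) * c"
        by (simp add: complex_eq_iff inner_complex_def algebra_simps)
      then have "(q ?y * cnj (r ?y)) * of_real (- (2 * (?y $ j \<bullet> c)) * exp (- (norm ?y)\<^sup>2))
          + (q ?y * cnj (c * partial_z j r ?y) + c * partial_z j q ?y * cnj (r ?y)) * of_real (exp (- (norm ?y)\<^sup>2)) = f' c ?y"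
        unfolding f'_def T_def w_def zq_def zr_def of_real_mult of_real_minus
        by (simp only: complex_cnj_mult) (simp add: algebra_simps)
      then show "((\<lambda>t. T q r (z + t *\<^sub>R axis j c)) has_vector_derivative f' c ?y) (at t)"
        using D by simp
    next
      show "continuous_on UNIV (f' c)"
        unfolding f'_def by (intro continuous_intros cont F)
      show "integrable lborel (f' c)"
        unfolding f'_def
        by (intro Bochner_Integration.integrable_diff Bochner_Integration.integrable_add integrable_mult_right int F)
    qed (intro int F)
    moreover have "(LINT z|lborel. f' c z) = c * fock_inner (partial_z j q) r + cnj c * fock_inner q (partial_z j r)
      - cnj c * fock_inner zq r - c * fock_inner q zr"
      unfolding f'_def inner
      by (simp add: Bochner_Integration.integral_diff Bochner_Integration.integral_add
          Bochner_Integration.integrable_diff Bochner_Integration.integrable_add int F)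
    ultimately show ?thesis by simp
  qed
  \<comment> \<open>Adding the instance \<open>c = 1\<close> to the instance \<open>c = \<i>\<close>
    divided by \<i> cancels the terms with \<open>cnj c\<close>.\<close>
  have 1: "fock_inner (partial_z j q) r + fock_inner q (partial_z j r) - fock_inner zq r - fock_inner q zr = 0"
    using main[of 1] by simp
  have "\<i> * (fock_inner (partial_z j q) r - fock_inner q (partial_z j r) + fock_inner zq r - fock_inner q zr) = 0"
    using main[of \<i>] by (simp add: algebra_simps)
  then have 2: "fock_inner (partial_z j q) r - fock_inner q (partial_z j r) + fock_inner zq r - fock_inner q zr = 0"
    by simp
  have "2 * (fock_inner (partial_z j q) r - fock_inner q zr) = 0"
    using arg_cong2[OF 1 2, of "(+)"] by (simp add: algebra_simps)
  then show ?thesis by (simp add: zr_def)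
qed

section \<open>The anticommutation relation for exterior and interior multiplication\<close>

definition wedge_sign :: "'n::{finite,linorder} set \<Rightarrow> 'n \<Rightarrow> complex" where
  "wedge_sign J j = (-1) ^ card {i \<in> J. i < j}"

lemma wedge_coeff_eq: "wedge_coeff j J K = (if j \<notin> J \<and> K = insert j J then wedge_sign J j else 0)"
  by (simp add: wedge_coeff_def wedge_sign_def)

lemma cnj_wedge_coeff [simp]: "cnj (wedge_coeff j J K) = wedge_coeff j J K"
  by (simp add: wedge_coeff_def)

lemma wedge_sign_square [simp]: "wedge_sign J j * wedge_sign J j = 1"
  by (simp add: wedge_sign_def flip: power_add mult_2)

lemma wedge_sign_insert:
  assumes "k \<notin> M"
  shows "wedge_sign (insert k M) j = (if k < j then - wedge_sign M j else wedge_sign M j)"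
proof -
  have "{i \<in> insert k M. i < j} = (if k < j then insert k {i \<in> M. i < j} else {i \<in> M. i < j})" by auto
  then show ?thesis using assms by (simp add: wedge_sign_def)
qed

text \<open>This is the matrix entry from \<open>I\<close> to \<open>J\<close> of wedging with
  \<open>dz_k\<close> followed by contraction with index \<open>j\<close>;
  \<open>sum_wedge_coeff_source\<close> treats the opposite order. In each sum at most one
  intermediate set contributes.\<close>

lemma sum_wedge_coeff_target:
  "(\<Sum>K\<in>UNIV. wedge_coeff k I K * wedge_coeff j J K) =
    (if j \<notin> J \<and> k \<notin> I \<and> insert j J = insert k I then wedge_sign I k * wedge_sign J j else 0)"
proof -
  have "(\<Sum>K\<in>UNIV. wedge_coeff k I K * wedge_coeff j J K) =
      (\<Sum>K\<in>UNIV. if K = insert j J then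
        (if j \<notin> J \<and> k \<notin> I \<and> insert j J = insert k I then wedge_sign I k * wedge_sign J j else 0) else 0)"
  proof (rule sum.cong)
    fix K show "wedge_coeff k I K * wedge_coeff j J K = (if K = insert j J then
        (if j \<notin> J \<and> k \<notin> I \<and> insert j J = insert k I then wedge_sign I k * wedge_sign J j else 0) else 0)"
      by (cases "K = insert j J"; cases "K = insert k I") (simp_all add: wedge_coeff_eq del: insert_eq_iff)
  qed simp
  also have "\<dots> = (if j \<notin> J \<and> k \<notin> I \<and> insert j J = insert k I then wedge_sign I k * wedge_sign J j else 0)"
    by (simp only: sum.delta[OF finite] UNIV_I if_True)
  finally show ?thesis .
qed

lemma sum_wedge_coeff_source:
  "(\<Sum>M\<in>UNIV. wedge_coeff k M J * wedge_coeff j M I) =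
    (if k \<in> J \<and> j \<in> I \<and> J - {k} = I - {j} then wedge_sign (J - {k}) k * wedge_sign (I - {j}) j else 0)"
proof -
  have "(\<Sum>M\<in>UNIV. wedge_coeff k M J * wedge_coeff j M I) =
      (\<Sum>M\<in>UNIV. if M = J - {k} then
        (if k \<in> J \<and> j \<in> I \<and> J - {k} = I - {j} then wedge_sign (J - {k}) k * wedge_sign (I - {j}) j else 0) else 0)"
  proof (rule sum.cong)
    fix M
    have "wedge_coeff k M J = (if k \<in> J \<and> M = J - {k} then wedge_sign M k else 0)"
      "wedge_coeff j M I = (if j \<in> I \<and> M = I - {j} then wedge_sign M j else 0)"
      unfolding wedge_coeff_eq by (intro if_cong refl, blast)+
    then show "wedge_coeff k M J * wedge_coeff j M I = (if M = J - {k} then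
        (if k \<in> J \<and> j \<in> I \<and> J - {k} = I - {j} then wedge_sign (J - {k}) k * wedge_sign (I - {j}) j else 0) else 0)"
      by (cases "M = J - {k}"; cases "M = I - {j}") simp_all
  qed simp
  also have "\<dots> = (if k \<in> J \<and> j \<in> I \<and> J - {k} = I - {j} then wedge_sign (J - {k}) k * wedge_sign (I - {j}) j else 0)"
    by (simp only: sum.delta[OF finite] UNIV_I if_True)
  finally show ?thesis .
qed

text \<open>For \<open>j \<noteq> k\<close> both sums are nonzero for the same pairs, those with
  \<open>J = insert k M\<close> and \<open>I = insert j M\<close> for a set \<open>M\<close>
  containing neither index. Exactly one of \<open>j\<close> and \<open>k\<close> precedes the other,
  so exactly one sign flips and the products cancel.\<close>

lemma wedge_coeff_anticommutation:
  "(\<Sum>K\<in>UNIV. wedge_coeff k I K * wedge_coeff j J K) + (\<Sum>M\<in>UNIV. wedge_coeff k M J * wedge_coeff j M I)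
    = (if j = k \<and> I = J then 1 else 0)"
proof (cases "j = k")
  case True
  have "insert k J = insert k I \<longleftrightarrow> I = J" if "k \<notin> J" "k \<notin> I"
    using insert_ident[OF that] by blast
  moreover have "J - {k} = I - {k} \<longleftrightarrow> I = J" if "k \<in> J" "k \<in> I" using that by blast
  ultimately show ?thesis
    unfolding sum_wedge_coeff_target sum_wedge_coeff_source True
    by (cases "k \<in> J"; cases "k \<in> I"; cases "I = J") (simp_all del: insert_eq_iff)
next
  case False
  show ?thesis
  proof (cases "k \<in> J \<and> j \<in> I \<and> J - {k} = I - {j}")
    case True
    define M where "M = J - {k}"
    have J: "J = insert k M" "k \<notin> M" using True unfolding M_def by blast+
    have I: "I = insert j M" "j \<notin> M" using True unfolding M_def by blast+
    have "j \<notin> J" "k \<notin> I" "insert j J = insert k I" using J I False by blast+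
    moreover have "J - {k} = M" "I - {j} = M" using J I by blast+
    moreover have "wedge_sign I k * wedge_sign J j = - (wedge_sign M k * wedge_sign M j)"
      unfolding J(1) I(1) wedge_sign_insert[OF J(2)] wedge_sign_insert[OF I(2)]
      using False by (cases j k rule: linorder_cases) auto
    ultimately show ?thesis
      unfolding sum_wedge_coeff_target sum_wedge_coeff_source using True False by (simp del: insert_eq_iff)
  next
    case neg: False
    \<comment> \<open>The two sums have the same support: where the second one vanishes, so does the
      first.\<close>
    have nt: "\<not> (j \<notin> J \<and> k \<notin> I \<and> insert j J = insert k I)"
    proof
      assume a: "j \<notin> J \<and> k \<notin> I \<and> insert j J = insert k I"
      then have "k \<in> J" "j \<in> I" using False by (metis insert_iff)+
      have a': "j \<notin> J" "k \<notin> I" using a by blast+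
      have "J - {k} = insert j J - {j} - {k}" by (simp only: Diff_insert_absorb[OF a'(1)])
      also have "\<dots> = insert k I - {k} - {j}" using a by (metis Diff_insert Diff_insert2)
      also have "\<dots> = I - {j}" by (simp only: Diff_insert_absorb[OF a'(2)])
      finally show False using neg \<open>k \<in> J\<close> \<open>j \<in> I\<close> by blast
    qed
    show ?thesis
      unfolding sum_wedge_coeff_target sum_wedge_coeff_source if_not_P[OF neg] if_not_P[OF nt] using False by simp
  qed
qed

text \<open>Contracting with index \<open>k\<close> and wedging with \<open>dz_k\<close> again
  projects onto the forms that contain \<open>dz_k\<close>; the sum over \<open>k\<close> is the
  number operator.\<close>

lemma sum_wedge_coeff_number:
  "(\<Sum>k\<in>UNIV. \<Sum>M\<in>UNIV. wedge_coeff k M J * wedge_coeff k M I) = (if I = J then of_nat (card J) else 0)"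
proof -
  have "(\<Sum>M\<in>UNIV. wedge_coeff k M J * wedge_coeff k M I) = (if k \<in> J then (if I = J then 1 else 0) else 0)" for k
  proof -
    have "J - {k} = I - {k} \<longleftrightarrow> I = J" if "k \<in> J" "k \<in> I" using that by blast
    then show ?thesis
      unfolding sum_wedge_coeff_source by (cases "k \<in> J"; cases "k \<in> I"; cases "I = J") simp_all
  qed
  then have "(\<Sum>k\<in>UNIV. \<Sum>M\<in>UNIV. wedge_coeff k M J * wedge_coeff k M I) = (\<Sum>k\<in>UNIV. if k \<in> J then (if I = J then 1 else 0) else 0)"
    by (simp only:)
  also have "\<dots> = (\<Sum>k\<in>J. if I = J then 1 else 0)" by (subst sum.inter_restrict[symmetric]) auto
  finally show ?thesis by simp
qed

section \<open>Interior multiplication by the Euler field\<close>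

text \<open>The coefficients are those of \<open>del\<close>, read from \<open>K\<close> back to
  \<open>J\<close>, and differentiation is replaced by multiplication with the coordinate.\<close>

definition contr :: "'n::{finite,linorder} form \<Rightarrow> 'n form" where
  "contr g = (\<lambda>J z. \<Sum>K\<in>UNIV. \<Sum>j\<in>UNIV. z $ j * g K z * wedge_coeff j J K)"

text \<open>Regularity, degree and homogeneity are kept apart from \<open>fock_forms\<close>, so
  that the identities for \<open>del\<close> and \<open>contr\<close> are available before square
  integrability is known.\<close>

definition entire_form :: "'n::finite form \<Rightarrow> bool" where
  "entire_form f \<longleftrightarrow> (\<forall>J. entire (f J))"

definition form_degree :: "nat \<Rightarrow> 'n form \<Rightarrow> bool" where
  "form_degree p f \<longleftrightarrow> (\<forall>J. card J \<noteq> p \<longrightarrow> f J = 0)"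

definition hom_form :: "nat \<Rightarrow> 'n::finite form \<Rightarrow> bool" where
  "hom_form m q \<longleftrightarrow> (\<forall>J. q J \<in> hom_polys m)"

definition form_comp :: "'n::finite form \<Rightarrow> nat \<Rightarrow> 'n form" where
  "form_comp f m = (\<lambda>J. hom_comp (f J) m)"

lemma zero_form_apply [simp]: "(0 :: 'n form) J z = 0"
  by (simp add: zero_fun_def)

lemma hom_form_entire: "hom_form m q \<Longrightarrow> entire_form q"
  unfolding hom_form_def entire_form_def using hom_polys_entire by blast

lemma form_comp_hom_form: "entire_form f \<Longrightarrow> hom_form m (form_comp f m)"
  unfolding hom_form_def entire_form_def form_comp_def using hom_comp_hom_polys by blast

lemma entire_form_del: "entire_form f \<Longrightarrow> entire_form (del f)"
  unfolding entire_form_def del_def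
  by (intro allI entire_sum entire_mult entire_imp_entire_partial_z entire_const) auto

lemma entire_form_contr: "entire_form f \<Longrightarrow> entire_form (contr f)"
  unfolding entire_form_def contr_def
  by (intro allI entire_sum entire_mult entire_coord entire_const) auto

lemma del_zero [simp]: "del 0 = 0"
  by (simp add: del_def fun_eq_iff)

lemma contr_zero [simp]: "contr 0 = 0"
  by (simp add: contr_def fun_eq_iff)

lemma form_degree_del:
  fixes f :: "'n::{finite,linorder} form"
  assumes "form_degree p f" shows "form_degree (Suc p) (del f)"
proof -
  have z: "partial_z j (f J) z * wedge_coeff j J K = 0" if K: "card K \<noteq> Suc p" for j J K z
  proof (cases "card J = p")
    case True
    then show ?thesis using K by (auto simp: wedge_coeff_eq)
  next
    case False
    then have "f J = 0" using assms by (simp add: form_degree_def)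
    then show ?thesis by simp
  qed
  show ?thesis
    unfolding form_degree_def
  proof (intro allI impI ext)
    fix K :: "'n set" and z assume K: "card K \<noteq> Suc p"
    have "del f K z = (\<Sum>J\<in>(UNIV :: 'n set set). \<Sum>j\<in>(UNIV :: 'n set). 0)"
      unfolding del_def by (intro sum.cong refl z[OF K])
    then show "del f K z = 0 z" by simp
  qed
qed

lemma form_degree_contr: "form_degree (Suc p) f \<Longrightarrow> form_degree p (contr f)"
  unfolding form_degree_def contr_def
  by (auto simp: fun_eq_iff wedge_coeff_eq intro!: sum.neutral)

lemma contr_degree_0: "form_degree 0 f \<Longrightarrow> contr f = 0"
  unfolding form_degree_def contr_def
  by (auto simp: fun_eq_iff wedge_coeff_eq intro!: sum.neutral)

lemma form_comp_degree: "form_degree p f \<Longrightarrow> form_degree p (form_comp f m)"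
  unfolding form_degree_def form_comp_def by (simp add: zero_fun_def hom_comp_zero)

lemma form_comp_hom:
  assumes "hom_form k q" shows "form_comp q m = (if m = k then q else 0)"
proof
  fix J
  have "q J \<in> hom_polys k" using assms by (simp add: hom_form_def)
  then show "form_comp q m J = (if m = k then q else 0) J"
    unfolding form_comp_def by (simp add: hom_comp_hom_poly zero_fun_def)
qed

lemma form_comp_del:
  assumes "entire_form f" shows "form_comp (del f) m = del (form_comp f (Suc m))"
proof (intro ext)
  fix K z
  have e: "entire (f J)" "entire (partial_z j (f J))" for J j
    using assms by (auto simp: entire_form_def entire_imp_entire_partial_z)
  have "hom_comp (del f K) m = hom_comp (\<lambda>z. \<Sum>J\<in>UNIV. \<Sum>j\<in>UNIV. wedge_coeff j J K * partial_z j (f J) z) m"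
    by (simp add: del_def mult.commute)
  also have "\<dots> = (\<lambda>z. \<Sum>J\<in>UNIV. \<Sum>j\<in>UNIV. wedge_coeff j J K * partial_z j (hom_comp (f J) (Suc m)) z)"
    by (simp add: hom_comp_sum entire_sum entire_cmult e hom_comp_cmult hom_comp_partial_z)
  finally show "form_comp (del f) m K z = del (form_comp f (Suc m)) K z"
    by (simp add: form_comp_def del_def mult.commute)
qed

lemma form_comp_contr_Suc:
  assumes "entire_form f" shows "form_comp (contr f) (Suc m) = contr (form_comp f m)"
proof (intro ext)
  fix K z
  have e: "entire (f J)" "entire (\<lambda>z. z $ j * f J z)" for J j
    using assms by (auto simp: entire_form_def intro: entire_mult entire_coord)
  have "hom_comp (contr f K) (Suc m) = hom_comp (\<lambda>z. \<Sum>J\<in>UNIV. \<Sum>j\<in>UNIV. wedge_coeff j K J * (z $ j * f J z)) (Suc m)"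
    by (simp add: contr_def mult_ac)
  also have "\<dots> = (\<lambda>z. \<Sum>J\<in>UNIV. \<Sum>j\<in>UNIV. wedge_coeff j K J * (z $ j * hom_comp (f J) m z))"
    by (simp add: hom_comp_sum entire_sum entire_cmult e hom_comp_cmult hom_comp_coord_mult_Suc)
  finally show "form_comp (contr f) (Suc m) K z = contr (form_comp f m) K z"
    by (simp add: form_comp_def contr_def mult_ac)
qed

lemma form_comp_contr_0:
  assumes "entire_form f" shows "form_comp (contr f) 0 = 0"
proof (intro ext)
  fix K z
  have e: "entire (f J)" "entire (\<lambda>z. z $ j * f J z)" for J j
    using assms by (auto simp: entire_form_def intro: entire_mult entire_coord)
  have "hom_comp (contr f K) 0 = hom_comp (\<lambda>z. \<Sum>J\<in>UNIV. \<Sum>j\<in>UNIV. wedge_coeff j K J * (z $ j * f J z)) 0"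
    by (simp add: contr_def mult_ac)
  also have "\<dots> = (\<lambda>z. 0)"
    by (simp add: hom_comp_sum entire_sum entire_cmult e hom_comp_cmult hom_comp_coord_mult_0)
  finally show "form_comp (contr f) 0 K z = 0 K z"
    by (simp add: form_comp_def)
qed

lemma form_comp_add:
  "entire_form f \<Longrightarrow> entire_form g \<Longrightarrow> form_comp (f + g) m = form_comp f m + form_comp g m"
  by (simp add: form_comp_def entire_form_def fun_eq_iff plus_fun_def hom_comp_add)

lemma form_comp_diff:
  "entire_form f \<Longrightarrow> entire_form g \<Longrightarrow> form_comp (f - g) m = form_comp f m - form_comp g m"
  by (simp add: form_comp_def entire_form_def fun_eq_iff fun_diff_def hom_comp_diff)

lemma form_comp_scale:
  "entire_form f \<Longrightarrow> form_comp (form_scale c f) m = form_scale c (form_comp f m)"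
  by (simp add: form_comp_def entire_form_def fun_eq_iff form_scale_def hom_comp_cmult)

lemma entire_form_diff: "entire_form f \<Longrightarrow> entire_form g \<Longrightarrow> entire_form (f - g)"
  by (simp add: entire_form_def fun_diff_def entire_diff)

lemma entire_form_scale: "entire_form f \<Longrightarrow> entire_form (form_scale c f)"
  by (simp add: entire_form_def form_scale_def entire_cmult)

lemma entire_form_eqI:
  assumes "entire_form f" "entire_form g" "\<And>m. form_comp f m = form_comp g m" shows "f = g"
proof
  fix J show "f J = g J"
  proof (rule entire_eqI)
    show "hom_comp (f J) m z = hom_comp (g J) m z" for m z
      using fun_cong[OF assms(3)[of m, unfolded form_comp_def], of J] by simp
  qed (use assms in \<open>auto simp: entire_form_def\<close>)
qed

lemma hom_polys_sum: "(\<And>i. i \<in> I \<Longrightarrow> f i \<in> hom_polys m) \<Longrightarrow> (\<lambda>z. \<Sum>i\<in>I. f i z) \<in> hom_polys m"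
  by (induction I rule: infinite_finite_induct) (auto simp: hom_polys_zero hom_polys_add)

lemma hom_form_del: "hom_form (Suc m) q \<Longrightarrow> hom_form m (del q)"
  unfolding hom_form_def del_def mult.commute[of "partial_z _ _ _"]
  by (intro allI hom_polys_sum hom_polys_cmult hom_polys_partial_z) auto

lemma hom_form_del_0: "hom_form 0 q \<Longrightarrow> del q = 0"
  by (simp add: hom_form_def del_def fun_eq_iff hom_polys_partial_z_0)

lemma hom_form_contr: "hom_form m q \<Longrightarrow> hom_form (Suc m) (contr q)"
  unfolding hom_form_def contr_def mult.commute[of _ "wedge_coeff _ _ _"]
  by (intro allI hom_polys_sum hom_polys_cmult hom_polys_coord_mult) auto

section \<open>Cartan's formula\<close>

lemma sum_rotate4:
  "(\<Sum>K\<in>A. \<Sum>j\<in>B. \<Sum>I\<in>C. \<Sum>k\<in>D. T K j I k) = (\<Sum>j\<in>B. \<Sum>k\<in>D. \<Sum>I\<in>C. \<Sum>K\<in>A. T K j I k)"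
proof -
  have "(\<Sum>K\<in>A. \<Sum>j\<in>B. \<Sum>I\<in>C. \<Sum>k\<in>D. T K j I k) = (\<Sum>j\<in>B. \<Sum>K\<in>A. \<Sum>k\<in>D. \<Sum>I\<in>C. T K j I k)"
    by (subst sum.swap) (intro sum.cong refl sum.swap)
  also have "\<dots> = (\<Sum>j\<in>B. \<Sum>k\<in>D. \<Sum>K\<in>A. \<Sum>I\<in>C. T K j I k)"
    by (intro sum.cong refl sum.swap)
  also have "\<dots> = (\<Sum>j\<in>B. \<Sum>k\<in>D. \<Sum>I\<in>C. \<Sum>K\<in>A. T K j I k)"
    by (intro sum.cong refl sum.swap)
  finally show ?thesis .
qed

text \<open>\<open>contr\<close> is contraction with the Euler field \<open>\<Sum>j. z\<^sub>j \<partial>/\<partial>z\<^sub>j\<close>, so the left side is the Lie derivative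
  along this field.\<close>

lemma cartan_formula:
  assumes f: "entire_form f"
  shows "contr (del f) J z + del (contr f) J z = (\<Sum>j\<in>UNIV. z $ j * partial_z j (f J) z) + of_nat (card J) * f J z"
proof -
  have e: "entire (f J)" for J using f by (simp add: entire_form_def)
  let ?P = "\<lambda>k I. partial_z k (f I) z"
  have "contr (del f) J z = (\<Sum>K\<in>UNIV. \<Sum>j\<in>UNIV. \<Sum>I\<in>UNIV. \<Sum>k\<in>UNIV. z $ j * ?P k I * (wedge_coeff k I K * wedge_coeff j J K))"
    unfolding contr_def del_def by (simp add: sum_distrib_left sum_distrib_right mult_ac)
  also have "\<dots> = (\<Sum>j\<in>UNIV. \<Sum>k\<in>UNIV. \<Sum>I\<in>UNIV. z $ j * ?P k I * (\<Sum>K\<in>UNIV. wedge_coeff k I K * wedge_coeff j J K))"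
    by (rule trans[OF sum_rotate4]) (simp add: sum_distrib_left)
  finally have 1: "contr (del f) J z = \<dots>" .
  \<comment> \<open>The product rule splits off the terms in which the coordinate itself is
    differentiated; these assemble to the number operator and give \<open>card J\<close>. The others
    meet the terms of \<open>contr (del f)\<close> in the anticommutation relation.\<close>
  have pd: "partial_z k (contr f M) z = (\<Sum>I\<in>UNIV. \<Sum>j\<in>UNIV. wedge_coeff j M I * ((if k = j then f I z else 0) + z $ j * ?P k I))" for k M
  proof -
    have "contr f M = (\<lambda>z. \<Sum>I\<in>UNIV. \<Sum>j\<in>UNIV. wedge_coeff j M I * (z $ j * f I z))"
      unfolding contr_def by (simp add: mult_ac)
    then show ?thesis
      by (simp add: partial_z_sum partial_z_cmult partial_z_mult entire_sum entire_cmult entire_mult entire_coord e partial_z_coord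
          if_distrib[of "\<lambda>x. x * _"] cong: if_cong)
  qed
  have "del (contr f) J z = (\<Sum>M\<in>UNIV. \<Sum>k\<in>UNIV. \<Sum>I\<in>UNIV. \<Sum>j\<in>UNIV. z $ j * ?P k I * (wedge_coeff k M J * wedge_coeff j M I))
      + (\<Sum>M\<in>UNIV. \<Sum>k\<in>UNIV. \<Sum>I\<in>UNIV. \<Sum>j\<in>UNIV. (if k = j then f I z else 0) * (wedge_coeff k M J * wedge_coeff j M I))"
    unfolding del_def pd by (simp add: sum_distrib_left sum_distrib_right sum.distrib algebra_simps)
  also have "(\<Sum>M\<in>UNIV. \<Sum>k\<in>UNIV. \<Sum>I\<in>UNIV. \<Sum>j\<in>UNIV. z $ j * ?P k I * (wedge_coeff k M J * wedge_coeff j M I))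
      = (\<Sum>j\<in>UNIV. \<Sum>k\<in>UNIV. \<Sum>I\<in>UNIV. z $ j * ?P k I * (\<Sum>M\<in>UNIV. wedge_coeff k M J * wedge_coeff j M I))"
    by (rule trans[OF sum_rotate4], rule trans[OF sum.swap]) (simp add: sum_distrib_left)
  also have "(\<Sum>M\<in>UNIV. \<Sum>k\<in>UNIV. \<Sum>I\<in>UNIV. \<Sum>j\<in>UNIV. (if k = j then f I z else 0) * (wedge_coeff k M J * wedge_coeff j M I))
      = (\<Sum>M\<in>UNIV. \<Sum>k\<in>UNIV. \<Sum>I\<in>UNIV. f I z * (wedge_coeff k M J * wedge_coeff k M I))"
    by (intro sum.cong refl) (simp add: if_distrib[of "\<lambda>x. x * _"] cong: if_cong)
  also have "\<dots> = (\<Sum>I\<in>UNIV. f I z * (\<Sum>k\<in>UNIV. \<Sum>M\<in>UNIV. wedge_coeff k M J * wedge_coeff k M I))"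
  proof -
    have "(\<Sum>M\<in>UNIV. \<Sum>k\<in>UNIV. \<Sum>I\<in>UNIV. f I z * (wedge_coeff k M J * wedge_coeff k M I))
      = (\<Sum>M\<in>UNIV. \<Sum>I\<in>UNIV. \<Sum>k\<in>UNIV. f I z * (wedge_coeff k M J * wedge_coeff k M I))"
      by (intro sum.cong refl sum.swap)
    also have "\<dots> = (\<Sum>I\<in>UNIV. \<Sum>M\<in>UNIV. \<Sum>k\<in>UNIV. f I z * (wedge_coeff k M J * wedge_coeff k M I))"
      by (rule sum.swap)
    also have "\<dots> = (\<Sum>I\<in>UNIV. \<Sum>k\<in>UNIV. \<Sum>M\<in>UNIV. f I z * (wedge_coeff k M J * wedge_coeff k M I))"
      by (intro sum.cong refl sum.swap)
    finally show ?thesis by (simp add: sum_distrib_left)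
  qed
  also have "\<dots> = of_nat (card J) * f J z"
    unfolding sum_wedge_coeff_number by (simp add: if_distrib[of "\<lambda>x. _ * x"] mult.commute cong: if_cong)
  finally have 2: "del (contr f) J z = (\<Sum>j\<in>UNIV. \<Sum>k\<in>UNIV. \<Sum>I\<in>UNIV. z $ j * ?P k I * (\<Sum>M\<in>UNIV. wedge_coeff k M J * wedge_coeff j M I))
      + of_nat (card J) * f J z" .
  have "contr (del f) J z + del (contr f) J z = (\<Sum>j\<in>UNIV. \<Sum>k\<in>UNIV. \<Sum>I\<in>UNIV. z $ j * ?P k I *
      ((\<Sum>K\<in>UNIV. wedge_coeff k I K * wedge_coeff j J K) + (\<Sum>M\<in>UNIV. wedge_coeff k M J * wedge_coeff j M I))) + of_nat (card J) * f J z"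
    unfolding 1 2 by (simp only: distrib_left sum.distrib add.assoc)
  also have "(\<Sum>j\<in>UNIV. \<Sum>k\<in>UNIV. \<Sum>I\<in>UNIV. z $ j * ?P k I *
      ((\<Sum>K\<in>UNIV. wedge_coeff k I K * wedge_coeff j J K) + (\<Sum>M\<in>UNIV. wedge_coeff k M J * wedge_coeff j M I)))
      = (\<Sum>j\<in>UNIV. \<Sum>k\<in>UNIV. \<Sum>I\<in>UNIV. if I = J then (if k = j then z $ j * ?P k I else 0) else 0)"
    unfolding wedge_coeff_anticommutation by (intro sum.cong refl) auto
  also have "\<dots> = (\<Sum>j\<in>UNIV. z $ j * ?P j J)" by simp
  finally show ?thesis .
qed

lemma hom_form_laplace:
  assumes q: "hom_form m q" and d: "form_degree p q"
  shows "contr (del q) + del (contr q) = form_scale (of_nat (m + p)) q"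
proof (intro ext)
  fix J z
  \<comment> \<open>Outside degree \<open>p\<close> the coefficients are 0, so \<open>card J\<close>
    may be replaced by \<open>p\<close> throughout.\<close>
  have "card J = p \<or> q J z = 0" using d by (auto simp: form_degree_def)
  then have "of_nat (card J) * q J z = of_nat p * q J z" by auto
  moreover have "(\<Sum>j\<in>UNIV. z $ j * partial_z j (q J) z) = of_nat m * q J z"
    using q by (intro hom_polys_euler) (simp add: hom_form_def)
  ultimately show "(contr (del q) + del (contr q)) J z = form_scale (of_nat (m + p)) q J z"
    using cartan_formula[OF hom_form_entire[OF q], of J z] by (simp add: form_scale_def algebra_simps)
qed

lemma form_comp_contr_del:
  assumes f: "entire_form f" shows "form_comp (contr (del f)) m = contr (del (form_comp f m))"
proof (cases m)
  case 0
  have "del (form_comp f 0) = 0" by (rule hom_form_del_0[OF form_comp_hom_form[OF f]])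
  then show ?thesis using 0 by (simp add: form_comp_contr_0 entire_form_del f)
qed (simp add: form_comp_contr_Suc form_comp_del entire_form_del f)

lemma form_comp_del_contr:
  assumes f: "entire_form f" shows "form_comp (del (contr f)) m = del (contr (form_comp f m))"
  by (simp add: form_comp_contr_Suc form_comp_del entire_form_contr f)

lemma form_comp_laplace:
  assumes f: "entire_form f" and d: "form_degree p f"
  shows "form_comp (contr (del f) + del (contr f)) m = form_scale (of_nat (m + p)) (form_comp f m)"
  using hom_form_laplace[OF form_comp_hom_form[OF f] form_comp_degree[OF d]]
  by (simp add: form_comp_add form_comp_contr_del form_comp_del_contr entire_form_del entire_form_contr f)

section \<open>Hilbert space structure on forms\<close>

definition fock_form :: "'n::finite form \<Rightarrow> bool" where
  "fock_form f \<longleftrightarrow> (\<forall>J. f J \<in> fock_space)"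

lemma fock_forms_iff: "f \<in> fock_forms p \<longleftrightarrow> fock_form f \<and> form_degree p f"
  unfolding fock_forms_def fock_form_def form_degree_def
  using fock_space_zero by (auto simp: zero_fun_def)

lemma fock_form_entire: "fock_form f \<Longrightarrow> entire_form f"
  unfolding fock_form_def entire_form_def using fock_space_entire by blast

lemma hom_form_fock_form: "hom_form m q \<Longrightarrow> fock_form q"
  unfolding hom_form_def fock_form_def using hom_polys_fock_space by blast

lemma fock_form_add: "fock_form f \<Longrightarrow> fock_form g \<Longrightarrow> fock_form (f + g)"
  unfolding fock_form_def plus_fun_def by (simp add: fock_space_add)

lemma fock_form_scale: "fock_form f \<Longrightarrow> fock_form (form_scale c f)"
  unfolding fock_form_def form_scale_def by (simp add: fock_space_cmult)

lemma diff_eq_add_scale: "f - g = f + form_scale (-1) (g :: 'n form)"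
  by (simp add: form_scale_def fun_eq_iff)

lemma fock_form_diff: "fock_form f \<Longrightarrow> fock_form g \<Longrightarrow> fock_form (f - g)"
  unfolding diff_eq_add_scale by (intro fock_form_add fock_form_scale)

lemma form_degree_zero [simp]: "form_degree p 0"
  by (simp add: form_degree_def)

lemma form_degree_add: "form_degree p f \<Longrightarrow> form_degree p g \<Longrightarrow> form_degree p (f + g)"
  by (simp add: form_degree_def)

lemma form_degree_scale: "form_degree p f \<Longrightarrow> form_degree p (form_scale c f)"
  by (simp add: form_degree_def form_scale_def fun_eq_iff)

lemma form_degree_diff: "form_degree p f \<Longrightarrow> form_degree p g \<Longrightarrow> form_degree p (f - g)"
  unfolding diff_eq_add_scale by (intro form_degree_add form_degree_scale)

lemma form_inner_add_left: "fock_form f \<Longrightarrow> fock_form g \<Longrightarrow> fock_form h \<Longrightarrow>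
  form_inner (f + g) h = form_inner f h + form_inner g h"
  by (simp add: form_inner_def fock_form_def plus_fun_def fock_inner_add_left sum.distrib)

lemma form_inner_add_right: "fock_form f \<Longrightarrow> fock_form g \<Longrightarrow> fock_form h \<Longrightarrow>
  form_inner h (f + g) = form_inner h f + form_inner h g"
  by (simp add: form_inner_def fock_form_def plus_fun_def fock_inner_add_right sum.distrib)

lemma form_inner_scale_left: "form_inner (form_scale c f) g = c * form_inner f g"
  by (simp add: form_inner_def form_scale_def fock_inner_cmult_left sum_distrib_left)

lemma form_inner_scale_right: "form_inner f (form_scale c g) = cnj c * form_inner f g"
  by (simp add: form_inner_def form_scale_def fock_inner_cmult_right sum_distrib_left)

lemma form_inner_diff_right: "fock_form f \<Longrightarrow> fock_form g \<Longrightarrow> fock_form h \<Longrightarrow>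
  form_inner h (f - g) = form_inner h f - form_inner h g"
  unfolding diff_eq_add_scale by (simp only: form_inner_add_right fock_form_scale form_inner_scale_right) simp

lemma form_inner_zero [simp]: "form_inner 0 f = 0" "form_inner f 0 = 0"
  by (simp_all add: form_inner_def zero_fun_def)

lemma fock_inner_cnj: "fock_inner g f = cnj (fock_inner f g)"
  unfolding fock_inner_def Bochner_Integration.integral_cnj[symmetric]
  by (rule Bochner_Integration.integral_cong) (simp_all add: mult_ac)

lemma form_inner_cnj: "form_inner g f = cnj (form_inner f g)"
  unfolding form_inner_def cnj_sum by (intro sum.cong refl fock_inner_cnj)

lemma form_norm_square: "(form_norm f)\<^sup>2 = (\<Sum>J\<in>UNIV. (fock_norm (f J))\<^sup>2)"
  unfolding form_norm_def by (intro real_sqrt_pow2 sum_nonneg) auto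

lemma form_norm_nonneg [simp]: "form_norm f \<ge> 0"
  unfolding form_norm_def by (intro real_sqrt_ge_zero sum_nonneg) auto

lemma form_inner_self: "form_inner f f = of_real ((form_norm f)\<^sup>2)"
  unfolding form_inner_def form_norm_square by (simp add: fock_inner_self)

lemma form_norm_zero [simp]: "form_norm 0 = 0"
  using form_inner_self[of 0] by simp

lemma form_norm_scale_square: "(form_norm (form_scale c f))\<^sup>2 = (cmod c)\<^sup>2 * (form_norm f)\<^sup>2"
proof -
  have "complex_of_real ((form_norm (form_scale c f))\<^sup>2) = of_real ((cmod c)\<^sup>2 * (form_norm f)\<^sup>2)"
    unfolding form_inner_self[symmetric] of_real_mult complex_norm_square
    by (simp add: form_inner_scale_left form_inner_scale_right)
  then show ?thesis by (simp only: of_real_eq_iff)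
qed

lemma form_norm_eq_0:
  assumes "fock_form f" "form_norm f = 0" shows "f = 0"
proof
  fix J
  have "(\<Sum>J\<in>UNIV. (fock_norm (f J))\<^sup>2) = 0" using form_norm_square[of f] assms(2) by simp
  then have "fock_norm (f J) = 0" by (subst (asm) sum_nonneg_eq_0_iff) auto
  then show "f J = 0 J" using fock_norm_eq_0[of "f J"] assms(1) by (simp add: fock_form_def zero_fun_def)
qed

lemma form_norm_sums:
  assumes "fock_form f"
  shows "(\<lambda>m. (form_norm (form_comp f m))\<^sup>2) sums (form_norm f)\<^sup>2"
  unfolding form_norm_square form_comp_def
  using assms by (intro sums_sum fock_norm_sums) (auto simp: fock_form_def fock_space_entire)

lemma form_inner_sums:
  assumes "fock_form f" "fock_form g"
  shows "(\<lambda>m. form_inner (form_comp f m) (form_comp g m)) sums form_inner f g"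
  unfolding form_inner_def form_comp_def
  using assms by (intro sums_sum fock_inner_sums) (auto simp: fock_form_def)

lemma fock_form_summableI:
  assumes e: "entire_form f" and s: "summable (\<lambda>m. (form_norm (form_comp f m))\<^sup>2)"
  shows "fock_form f"
  unfolding fock_form_def
proof
  fix J
  have "summable (\<lambda>m. (fock_norm (hom_comp (f J) m))\<^sup>2)"
  proof (rule summable_comparison_test'[OF s])
    fix m
    have "(fock_norm (form_comp f m J))\<^sup>2 \<le> (form_norm (form_comp f m))\<^sup>2"
      unfolding form_norm_square by (rule member_le_sum) auto
    then show "norm ((fock_norm (hom_comp (f J) m))\<^sup>2) \<le> (form_norm (form_comp f m))\<^sup>2"
      by (simp add: form_comp_def)
  qed
  then show "f J \<in> fock_space" using e by (simp add: fock_space_iff_summable(1) entire_form_def)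
qed

lemma fock_space_sum: "(\<And>i. i \<in> I \<Longrightarrow> f i \<in> fock_space) \<Longrightarrow> (\<lambda>z. \<Sum>i\<in>I. f i z) \<in> fock_space"
  by (induction I rule: infinite_finite_induct) (auto simp: fock_space_zero fock_space_add)

lemma fock_inner_sum_left:
  "(\<And>i. i \<in> I \<Longrightarrow> f i \<in> fock_space) \<Longrightarrow> g \<in> fock_space \<Longrightarrow>
    fock_inner (\<lambda>z. \<Sum>i\<in>I. f i z) g = (\<Sum>i\<in>I. fock_inner (f i) g)"
  by (induction I rule: infinite_finite_induct) (auto simp: fock_inner_add_left fock_space_sum)

lemma fock_inner_sum_right:
  "(\<And>i. i \<in> I \<Longrightarrow> f i \<in> fock_space) \<Longrightarrow> g \<in> fock_space \<Longrightarrow>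
    fock_inner g (\<lambda>z. \<Sum>i\<in>I. f i z) = (\<Sum>i\<in>I. fock_inner g (f i))"
  by (induction I rule: infinite_finite_induct) (auto simp: fock_inner_add_right fock_space_sum)

text \<open>The numbers \<open>wedge_coeff\<close> are real and pass unchanged through the conjugate
  linear argument, so transposing their matrix turns \<open>del\<close> into
  \<open>contr\<close>.\<close>

lemma form_inner_del:
  assumes q: "hom_form m q" and r: "hom_form k r"
  shows "form_inner (del q) r = form_inner q (contr r)"
proof -
  have qJ: "q J \<in> hom_polys m" "r J \<in> hom_polys k" for J using q r by (auto simp: hom_form_def)
  have F: "q J \<in> fock_space" "r J \<in> fock_space" "(\<lambda>z. z $ j * r J z) \<in> fock_space" "partial_z j (q J) \<in> fock_space" for J j
    using qJ by (blast intro: hom_polys_fock_space hom_polys_coord_mult hom_polys_partial_z_fock_space)+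
  have "form_inner (del q) r = (\<Sum>K\<in>UNIV. fock_inner (\<lambda>z. \<Sum>J\<in>UNIV. \<Sum>j\<in>UNIV. wedge_coeff j J K * partial_z j (q J) z) (r K))"
    unfolding form_inner_def del_def by (simp add: mult.commute)
  also have "\<dots> = (\<Sum>K\<in>UNIV. \<Sum>J\<in>UNIV. \<Sum>j\<in>UNIV. wedge_coeff j J K * fock_inner (partial_z j (q J)) (r K))"
    by (simp add: fock_inner_sum_left fock_space_sum fock_space_cmult F fock_inner_cmult_left)
  also have "\<dots> = (\<Sum>J\<in>UNIV. \<Sum>K\<in>UNIV. \<Sum>j\<in>UNIV. wedge_coeff j J K * fock_inner (q J) (\<lambda>z. z $ j * r K z))"
    unfolding fock_inner_partial_z[OF qJ] by (rule sum.swap)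
  also have "\<dots> = (\<Sum>J\<in>UNIV. fock_inner (q J) (\<lambda>z. \<Sum>K\<in>UNIV. \<Sum>j\<in>UNIV. wedge_coeff j J K * (z $ j * r K z)))"
    by (simp add: fock_inner_sum_right fock_space_sum fock_space_cmult F fock_inner_cmult_right)
  also have "\<dots> = form_inner q (contr r)"
    unfolding form_inner_def contr_def by (simp add: mult_ac)
  finally show ?thesis .
qed

section \<open>The adjoint of \<open>del\<close>\<close>

text \<open>Parseval's identity for \<open>del f\<close> and \<open>g\<close> reduces the claim to
  polynomial forms. Since \<open>contr g\<close> may fail to be square integrable, it enters only
  through its components.\<close>

lemma form_inner_del_sums:
  assumes f: "fock_form f" "fock_form (del f)" and g: "fock_form g"
  shows "(\<lambda>m. form_inner (form_comp f m) (form_comp (contr g) m)) sums form_inner (del f) g"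
proof -
  note ef = fock_form_entire[OF f(1)] and eg = fock_form_entire[OF g]
  have "form_inner (form_comp (del f) m) (form_comp g m) = form_inner (form_comp f (Suc m)) (form_comp (contr g) (Suc m))" for m
    unfolding form_comp_del[OF ef] form_comp_contr_Suc[OF eg]
    by (rule form_inner_del[OF form_comp_hom_form[OF ef] form_comp_hom_form[OF eg]])
  then have "(\<lambda>m. form_inner (form_comp f (Suc m)) (form_comp (contr g) (Suc m))) sums form_inner (del f) g"
    using form_inner_sums[OF f(2) g] by simp
  \<comment> \<open>The component of \<open>contr g\<close> of degree 0 vanishes, so the series may
    start there.\<close>
  then show ?thesis
    using sums_Suc_iff[of "\<lambda>m. form_inner (form_comp f m) (form_comp (contr g) m)"]
    by (simp add: form_comp_contr_0[OF eg])
qed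

lemma hom_form_del_ex: "hom_form m q \<Longrightarrow> \<exists>k. hom_form k (del q)"
proof (cases m)
  case 0
  assume "hom_form m q"
  then have "del q = 0" using 0 hom_form_del_0 by blast
  then show ?thesis using hom_polys_zero by (auto simp: hom_form_def zero_fun_def)
qed (use hom_form_del in blast)

lemma hom_form_del_dom:
  assumes "hom_form m q" "form_degree p q" shows "q \<in> del_dom p"
  using assms hom_form_del_ex[OF assms(1)] form_degree_del[OF assms(2)]
  unfolding del_dom_def fock_forms_iff by (auto intro: hom_form_fock_form)

text \<open>Tested against its own homogeneous components, the difference of \<open>h\<close> and \<open>contr g\<close> vanishes.\<close>

lemma adjoint_eq_contr:
  fixes g :: "'n::{finite,linorder} form"
  assumes g: "g \<in> fock_forms (Suc p)" and h: "h \<in> fock_forms p"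
    and eq: "\<And>f. f \<in> del_dom p \<Longrightarrow> form_inner (del f) g = form_inner f h"
  shows "h = contr g"
proof -
  have G: "fock_form g" "form_degree (Suc p) g" and H: "fock_form h" "form_degree p h"
    using g h by (auto simp: fock_forms_iff)
  note eg = entire_form_contr[OF fock_form_entire[OF G(1)]] and eh = fock_form_entire[OF H(1)]
  show ?thesis
  proof (rule entire_form_eqI[OF eh eg])
    fix m
    define u where "u = form_comp (contr g) m - form_comp h m"
    have hm: "hom_form m (form_comp (contr g) m)" "hom_form m (form_comp h m)"
      using form_comp_hom_form eg eh by blast+
    have u: "hom_form m u" "form_degree p u"
      unfolding u_def form_comp_diff[OF eg eh, symmetric]
      by (intro form_comp_hom_form entire_form_diff eg eh form_comp_degree form_degree_diff form_degree_contr G H)+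
    have ud: "u \<in> del_dom p" using hom_form_del_dom[OF u] .
    then have F: "fock_form u" "fock_form (del u)" by (auto simp: del_dom_def fock_forms_iff)
    have sing: "(\<lambda>k. form_inner (form_comp u k) (form_comp w k)) sums form_inner u (form_comp w m)" for w
    proof -
      have "(\<lambda>k. form_inner (form_comp u k) (form_comp w k)) = (\<lambda>k. if k = m then form_inner u (form_comp w k) else 0)"
        using form_comp_hom[OF u(1)] by (intro ext) simp
      then show ?thesis using sums_single[of m "\<lambda>k. form_inner u (form_comp w k)"] by simp
    qed
    have "form_inner u (form_comp (contr g) m) = form_inner (del u) g"
      using form_inner_del_sums[OF F G(1)] sing[of "contr g"] sums_unique2 by blast
    also have "\<dots> = form_inner u h" by (rule eq[OF ud])
    also have "\<dots> = form_inner u (form_comp h m)"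
      using form_inner_sums[OF F(1) H(1)] sing[of h] sums_unique2 by blast
    finally have "form_inner u u = 0"
      unfolding u_def[symmetric] using form_inner_diff_right[OF hom_form_fock_form[OF hm(1)] hom_form_fock_form[OF hm(2)] F(1)]
      by (simp add: u_def[symmetric])
    then have "u = 0" using form_norm_eq_0[OF F(1)] by (simp add: form_inner_self)
    then show "form_comp h m = form_comp (contr g) m" by (simp add: u_def)
  qed
qed

lemma form_inner_del_contr:
  assumes f: "f \<in> del_dom p" and g: "g \<in> fock_forms (Suc p)" and c: "contr g \<in> fock_forms p"
  shows "form_inner (del f) g = form_inner f (contr g)"
  using form_inner_del_sums[of f g] form_inner_sums[of f "contr g"] f g c sums_unique2
  by (auto simp: del_dom_def fock_forms_iff)

text \<open>The adjoint thus has the maximal domain of contraction: all forms for which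
  \<open>contr g\<close> is again square integrable.\<close>

lemma del_adj_dom_iff: "g \<in> del_adj_dom p \<longleftrightarrow> g \<in> fock_forms (Suc p) \<and> contr g \<in> fock_forms p"
proof
  assume "g \<in> del_adj_dom p"
  then obtain h where "g \<in> fock_forms (Suc p)" "h \<in> fock_forms p"
    "\<And>f. f \<in> del_dom p \<Longrightarrow> form_inner (del f) g = form_inner f h"
    unfolding del_adj_dom_def adjoint_dom_def by blast
  then show "g \<in> fock_forms (Suc p) \<and> contr g \<in> fock_forms p" using adjoint_eq_contr by blast
qed (use form_inner_del_contr in \<open>unfold del_adj_dom_def adjoint_dom_def, blast\<close>)

lemma del_adj_eq:
  assumes "g \<in> del_adj_dom p" shows "del_adj p g = contr g"
  unfolding del_adj_def adjoint_op_def
proof (rule the_equality)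
  show "contr g \<in> fock_forms p \<and> (\<forall>f\<in>del_dom p. form_inner (del f) g = form_inner f (contr g))"
    using assms form_inner_del_contr unfolding del_adj_dom_iff by blast
  show "h = contr g" if "h \<in> fock_forms p \<and> (\<forall>f\<in>del_dom p. form_inner (del f) g = form_inner f h)" for h
    using that assms adjoint_eq_contr unfolding del_adj_dom_iff by blast
qed

section \<open>The Laplacian\<close>

lemma contr_degree_0_fock: "f \<in> fock_forms 0 \<Longrightarrow> contr f = 0"
  by (simp add: fock_forms_iff contr_degree_0)

lemma laplacian_domain_iff:
  "f \<in> laplacian_domain p \<longleftrightarrow> f \<in> fock_forms p \<and> del f \<in> fock_forms (Suc p) \<and> contr (del f) \<in> fock_forms p \<and>
    (\<forall>q. p = Suc q \<longrightarrow> contr f \<in> fock_forms q \<and> del (contr f) \<in> fock_forms p)"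
  by (cases p) (auto simp: del_dom_def del_adj_dom_iff del_adj_eq)

text \<open>In degree 0 the form \<open>contr f\<close> is 0, so one formula covers both clauses of
  \<open>laplacian\<close>.\<close>

lemma laplacian_eq: "f \<in> laplacian_domain p \<Longrightarrow> laplacian p f = contr (del f) + del (contr f)"
  by (cases p) (auto simp: del_dom_def del_adj_dom_iff del_adj_eq contr_degree_0_fock)

lemma fock_forms_zero: "0 \<in> fock_forms p"
proof -
  have "fock_form 0" by (simp add: fock_form_def zero_fun_def fock_space_zero)
  then show ?thesis by (simp add: fock_forms_iff)
qed

lemma fock_forms_add: "f \<in> fock_forms p \<Longrightarrow> g \<in> fock_forms p \<Longrightarrow> f + g \<in> fock_forms p"
  by (simp add: fock_forms_iff fock_form_add form_degree_add)

lemma fock_forms_scale: "f \<in> fock_forms p \<Longrightarrow> form_scale c f \<in> fock_forms p"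
  by (simp add: fock_forms_iff fock_form_scale form_degree_scale)

lemma fock_forms_diff: "f \<in> fock_forms p \<Longrightarrow> g \<in> fock_forms p \<Longrightarrow> f - g \<in> fock_forms p"
  by (simp add: fock_forms_iff fock_form_diff form_degree_diff)

lemma laplacian_domain_fock: "f \<in> laplacian_domain p \<Longrightarrow> f \<in> fock_forms p"
  unfolding laplacian_domain_iff by blast

lemma laplacian_fock:
  assumes "f \<in> laplacian_domain p" shows "laplacian p f \<in> fock_forms p"
proof -
  have "del (contr f) \<in> fock_forms p"
    using assms unfolding laplacian_domain_iff by (cases p) (auto simp: contr_degree_0_fock fock_forms_zero)
  then show ?thesis
    unfolding laplacian_eq[OF assms] using assms by (intro fock_forms_add) (auto simp: laplacian_domain_iff)
qed

lemma form_comp_laplacian: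
  assumes "f \<in> laplacian_domain p"
  shows "form_comp (laplacian p f) m = form_scale (of_nat (m + p)) (form_comp f m)"
  unfolding laplacian_eq[OF assms] using laplacian_domain_fock[OF assms]
  by (intro form_comp_laplace) (auto simp: fock_forms_iff fock_form_entire)

text \<open>An energy identity: the eigenvalue equation \<open>hom_form_laplace\<close> is paired
  with \<open>q\<close>, and \<open>contr\<close> and \<open>del\<close> are moved across the inner
  product.\<close>

lemma form_norm_del_contr:
  assumes q: "hom_form m q" and d: "form_degree p q"
  shows "(form_norm (del q))\<^sup>2 + (form_norm (contr q))\<^sup>2 = real (m + p) * (form_norm q)\<^sup>2"
proof -
  obtain k where k: "hom_form k (del q)" using hom_form_del_ex[OF q] by blast
  have c: "hom_form (Suc m) (contr q)" by (rule hom_form_contr[OF q])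
  have 1: "of_real ((form_norm (del q))\<^sup>2) = form_inner q (contr (del q))"
    unfolding form_inner_self[symmetric] by (rule form_inner_del[OF q k])
  have "form_inner (del (contr q)) q = of_real ((form_norm (contr q))\<^sup>2)"
    unfolding form_inner_self[symmetric] by (rule form_inner_del[OF c q])
  then have 2: "of_real ((form_norm (contr q))\<^sup>2) = form_inner q (del (contr q))"
    using form_inner_cnj[of q "del (contr q)"] by simp
  have "complex_of_real ((form_norm (del q))\<^sup>2 + (form_norm (contr q))\<^sup>2) = form_inner q (contr (del q) + del (contr q))"
    unfolding of_real_add 1 2
    by (rule form_inner_add_right[symmetric])
      (blast intro: hom_form_fock_form hom_form_contr[OF k] hom_form_del[OF c] q)+
  also have "\<dots> = complex_of_real (real (m + p) * (form_norm q)\<^sup>2)"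
    unfolding hom_form_laplace[OF q d] by (simp add: form_inner_scale_right form_inner_self)
  finally show ?thesis by (simp only: of_real_eq_iff)
qed

text \<open>The energy identity bounds the two first order terms, and applying it to
  \<open>del q\<close> and \<open>contr q\<close> bounds the second order ones. These forms have
  degrees \<open>m - 1\<close>, \<open>p + 1\<close> and \<open>m + 1\<close>, \<open>p - 1\<close>,
  so the factor is \<open>m + p\<close> each time; if \<open>m = 0\<close> or \<open>p = 0\<close>,
  the form in question is 0.\<close>

lemma form_norm_bounds:
  assumes q: "hom_form m q" and d: "form_degree p q"
  shows form_norm_del_le: "(form_norm (del q))\<^sup>2 \<le> real (m + p) ^ 2 * (form_norm q)\<^sup>2"
    and form_norm_contr_le: "(form_norm (contr q))\<^sup>2 \<le> real (m + p) ^ 2 * (form_norm q)\<^sup>2"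
    and form_norm_contr_del_le: "(form_norm (contr (del q)))\<^sup>2 \<le> real (m + p) ^ 2 * (form_norm q)\<^sup>2"
    and form_norm_del_contr_le: "(form_norm (del (contr q)))\<^sup>2 \<le> real (m + p) ^ 2 * (form_norm q)\<^sup>2"
proof -
  \<comment> \<open>A natural number is at most its square, so the first order bounds fit under the
    second order weight.\<close>
  have "real (m + p) \<le> real (m + p) ^ 2"
    unfolding of_nat_power[symmetric] of_nat_le_iff by (cases "m + p") (simp_all add: power2_eq_square)
  then have sq: "real (m + p) * (form_norm q)\<^sup>2 \<le> real (m + p) ^ 2 * (form_norm q)\<^sup>2" by (rule mult_right_mono) simp
  have dq: "(form_norm (del q))\<^sup>2 \<le> real (m + p) * (form_norm q)\<^sup>2"
    and cq: "(form_norm (contr q))\<^sup>2 \<le> real (m + p) * (form_norm q)\<^sup>2"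
    using form_norm_del_contr[OF q d] zero_le_power2[of "form_norm (del q)"] zero_le_power2[of "form_norm (contr q)"]
    by linarith+
  show "(form_norm (del q))\<^sup>2 \<le> real (m + p) ^ 2 * (form_norm q)\<^sup>2"
    "(form_norm (contr q))\<^sup>2 \<le> real (m + p) ^ 2 * (form_norm q)\<^sup>2" using dq cq sq by linarith+
  have twice: "x \<le> real (m + p) ^ 2 * (form_norm q)\<^sup>2"
    if "x \<le> real (m + p) * y" "y \<le> real (m + p) * (form_norm q)\<^sup>2" for x y
    using order_trans[OF that(1) mult_left_mono[OF that(2), of "real (m + p)"]] by (simp add: power2_eq_square mult.assoc)
  show "(form_norm (contr (del q)))\<^sup>2 \<le> real (m + p) ^ 2 * (form_norm q)\<^sup>2"
  proof (cases m)
    case 0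
    then show ?thesis using q by (simp add: hom_form_del_0)
  next
    case (Suc k)
    have "(form_norm (contr (del q)))\<^sup>2 \<le> real (m + p) * (form_norm (del q))\<^sup>2"
    proof -
      have "hom_form k (del q)" using hom_form_del q Suc by blast
      from form_norm_del_contr[OF this form_degree_del[OF d]]
      have "(form_norm (del (del q)))\<^sup>2 + (form_norm (contr (del q)))\<^sup>2 = real (m + p) * (form_norm (del q))\<^sup>2"
        using Suc by simp
      then show ?thesis using zero_le_power2[of "form_norm (del (del q))"] by linarith
    qed
    then show ?thesis by (rule twice[OF _ dq])
  qed
  show "(form_norm (del (contr q)))\<^sup>2 \<le> real (m + p) ^ 2 * (form_norm q)\<^sup>2"
  proof (cases p)
    case 0
    then show ?thesis using d by (simp add: contr_degree_0)
  next
    case (Suc k)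
    have "(form_norm (del (contr q)))\<^sup>2 \<le> real (m + p) * (form_norm (contr q))\<^sup>2"
    proof -
      have "form_degree k (contr q)" using form_degree_contr d Suc by blast
      from form_norm_del_contr[OF hom_form_contr[OF q] this]
      have "(form_norm (del (contr q)))\<^sup>2 + (form_norm (contr (contr q)))\<^sup>2 = real (m + p) * (form_norm (contr q))\<^sup>2"
        using Suc by simp
      then show ?thesis using zero_le_power2[of "form_norm (contr (contr q))"] by linarith
    qed
    then show ?thesis by (rule twice[OF _ cq])
  qed
qed

text \<open>The series dominates the component norms of each form that
  \<open>laplacian_domain_iff\<close> requires to be square integrable beyond \<open>f\<close>
  itself.\<close>

lemma laplacian_domainI:
  assumes f: "f \<in> fock_forms p" and s: "summable (\<lambda>m. real (m + p) ^ 2 * (form_norm (form_comp f m))\<^sup>2)"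
  shows "f \<in> laplacian_domain p"
proof -
  have e: "entire_form f" and d: "form_degree p f" using f by (auto simp: fock_forms_iff fock_form_entire)
  note q = form_comp_hom_form[OF e] and dq = form_comp_degree[OF d]
  note eds = entire_form_del[OF e] entire_form_contr[OF e]
  have s': "summable (\<lambda>m. (form_norm (F m))\<^sup>2)"
    if "\<And>m. (form_norm (F m))\<^sup>2 \<le> real (m + p) ^ 2 * (form_norm (form_comp f m))\<^sup>2" for F :: "nat \<Rightarrow> 'a form"
    by (rule summable_comparison_test'[OF s, of 0]) (simp add: that del: of_nat_add)
  have 1: "del f \<in> fock_forms (Suc p)"
    unfolding fock_forms_iff
  proof (intro conjI fock_form_summableI eds form_degree_del d)
    have "summable (\<lambda>m. (form_norm (del (form_comp f m)))\<^sup>2)" by (rule s'[OF form_norm_del_le[OF q dq]])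
    then show "summable (\<lambda>m. (form_norm (form_comp (del f) m))\<^sup>2)"
      unfolding form_comp_del[OF e] by (subst summable_Suc_iff)
  qed
  have 2: "contr (del f) \<in> fock_forms p"
    unfolding fock_forms_iff
  proof (intro conjI fock_form_summableI entire_form_contr eds form_degree_contr form_degree_del d)
    show "summable (\<lambda>m. (form_norm (form_comp (contr (del f)) m))\<^sup>2)"
      unfolding form_comp_contr_del[OF e] by (rule s'[OF form_norm_contr_del_le[OF q dq]])
  qed
  have 3: "contr f \<in> fock_forms r \<and> del (contr f) \<in> fock_forms p" if r: "p = Suc r" for r
  proof
    have d': "form_degree r (contr f)" using form_degree_contr d r by blast
    show "contr f \<in> fock_forms r"
      unfolding fock_forms_iff
    proof (intro conjI fock_form_summableI eds d')
      have "summable (\<lambda>m. (form_norm (contr (form_comp f m)))\<^sup>2)" by (rule s'[OF form_norm_contr_le[OF q dq]])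
      then show "summable (\<lambda>m. (form_norm (form_comp (contr f) m))\<^sup>2)"
        unfolding form_comp_contr_Suc[OF e, symmetric] by (subst (asm) summable_Suc_iff)
    qed
    show "del (contr f) \<in> fock_forms p"
      unfolding fock_forms_iff r
    proof (intro conjI fock_form_summableI entire_form_del eds form_degree_del d')
      show "summable (\<lambda>m. (form_norm (form_comp (del (contr f)) m))\<^sup>2)"
        unfolding form_comp_del_contr[OF e] by (rule s'[OF form_norm_del_contr_le[OF q dq]])
    qed
  qed
  show ?thesis unfolding laplacian_domain_iff using f 1 2 3 by blast
qed

lemma hom_form_laplacian_domain:
  assumes "hom_form m q" "form_degree p q" shows "q \<in> laplacian_domain p"
proof (rule laplacian_domainI)
  show "q \<in> fock_forms p" using assms by (simp add: fock_forms_iff hom_form_fock_form)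
  show "summable (\<lambda>k. real (k + p) ^ 2 * (form_norm (form_comp q k))\<^sup>2)"
    by (rule summable_finite[of "{m}"]) (auto simp: form_comp_hom[OF assms(1)])
qed

section \<open>Eigenspaces and resolvent\<close>

lemma eigenspace_laplacian:
  "eigenspace (laplacian_domain p) (laplacian p) (of_nat (m + p)) = {f. hom_form m f \<and> form_degree p f}"
proof (intro equalityI subsetI)
  fix f assume "f \<in> eigenspace (laplacian_domain p) (laplacian p) (of_nat (m + p))"
  then have f: "f \<in> laplacian_domain p" and eq: "laplacian p f = form_scale (of_nat (m + p)) f"
    by (auto simp: eigenspace_def)
  have e: "entire_form f" and d: "form_degree p f"
    using laplacian_domain_fock[OF f] by (auto simp: fock_forms_iff fock_form_entire)
  note hc = form_comp_hom_form[OF e, of m]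
  have z: "form_comp f k = 0" if "k \<noteq> m" for k
  proof -
    have "form_scale (of_nat (k + p)) (form_comp f k) = form_scale (of_nat (m + p)) (form_comp f k)"
      unfolding form_comp_laplacian[OF f, symmetric] eq by (rule form_comp_scale[OF e])
    then show ?thesis using that by (simp add: form.scale_cancel_right del: of_nat_add)
  qed
  have "f = form_comp f m"
  proof (rule entire_form_eqI[OF e hom_form_entire[OF hc]])
    fix k show "form_comp f k = form_comp (form_comp f m) k"
      unfolding form_comp_hom[OF hc] by (simp add: z)
  qed
  then have "hom_form m f" by (rule ssubst) (rule hc)
  then show "f \<in> {f. hom_form m f \<and> form_degree p f}" using d by simp
next
  fix f :: "'a form" assume "f \<in> {f. hom_form m f \<and> form_degree p f}"
  then have h: "hom_form m f" and d: "form_degree p f" by auto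
  have f: "f \<in> laplacian_domain p" by (rule hom_form_laplacian_domain[OF h d])
  have "laplacian p f = form_scale (of_nat (m + p)) f"
    unfolding laplacian_eq[OF f] by (rule hom_form_laplace[OF h d])
  then show "f \<in> eigenspace (laplacian_domain p) (laplacian p) (of_nat (m + p))" using f by (simp add: eigenspace_def)
qed

text \<open>The summand 1 in the weight will bound the inverse, and the growth of the weight will
  place preimages in the domain of the Laplacian.\<close>

lemma distance_to_shifted_nats:
  fixes c :: complex
  assumes "\<And>m::nat. c \<noteq> of_nat (m + p)"
  obtains A where "A \<ge> 0" "\<And>m::nat. 1 + real (m + p) \<le> A * cmod (of_nat (m + p) - c)"
proof -
  define s where "s = (\<lambda>m. (1 + real (m + p)) / cmod (of_nat (m + p) - c))"
  have pos: "cmod (of_nat (m + p) - c) > 0" for m using assms[of m] by auto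
  \<comment> \<open>For \<open>x \<ge> 2 * cmod c + 1\<close> one has
    \<open>1 + x \<le> 2 * (x - cmod c)\<close>, so the quotient \<open>s m\<close> is at most 2
    from \<open>N\<close> on; the finitely many earlier quotients are added up.\<close>
  obtain N :: nat where N: "real N \<ge> 2 * cmod c + 1" using real_arch_simple by blast
  define A where "A = 2 + (\<Sum>m<N. s m)"
  have s0: "s m \<ge> 0" for m unfolding s_def by simp
  have "s m \<le> A" for m
  proof (cases "m < N")
    case True
    have "s m \<le> (\<Sum>m<N. s m)" using True s0 by (intro member_le_sum) auto
    then show ?thesis by (simp add: A_def)
  next
    case False
    have "cmod (of_nat (m + p) - c) \<ge> real (m + p) - cmod c"
      using norm_triangle_ineq2[of "of_nat (m + p)" c] by (simp only: norm_of_nat)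
    moreover have "real N \<le> real (m + p)" using False by simp
    ultimately have "1 + real (m + p) \<le> 2 * cmod (of_nat (m + p) - c)" using N by linarith
    then have "s m \<le> 2" unfolding s_def using pos[of m] by (simp add: pos_divide_le_eq del: of_nat_add)
    then show ?thesis using s0 by (simp add: A_def add_increasing2 sum_nonneg)
  qed
  then have "1 + real (m + p) \<le> A * cmod (of_nat (m + p) - c)" for m
    by (simp only: s_def pos_divide_le_eq[OF pos])
  moreover have "A \<ge> 0" unfolding A_def by (intro add_nonneg_nonneg sum_nonneg s0) auto
  ultimately show ?thesis using that by blast
qed

text \<open>On components the shifted operator is multiplication by
  \<open>of_nat (m + p) - c\<close>. Injectivity follows because these numbers are nonzero, and
  their uniform lower bound becomes the estimate of the inverse by Parseval's identity.\<close>

lemma laplacian_resolvent: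
  assumes c: "\<And>m::nat. c \<noteq> of_nat (m + p)"
  shows "c \<in> resolvent_set (fock_forms p :: 'n::{finite,linorder} form set) (laplacian_domain p) (laplacian p)"
proof -
  obtain A where A: "A \<ge> 0" "\<And>m::nat. 1 + real (m + p) \<le> A * cmod (of_nat (m + p) - c)"
    using distance_to_shifted_nats[OF c] by blast
  have nz: "of_nat (m + p) - c \<noteq> 0" for m using c[of m] by auto
  let ?T = "\<lambda>f :: 'n form. laplacian p f - form_scale c f"
  have mem: "?T f \<in> fock_forms p" if "f \<in> laplacian_domain p" for f :: "'n form"
    by (intro fock_forms_diff laplacian_fock fock_forms_scale laplacian_domain_fock that)
  have comp: "form_comp (?T f) m = form_scale (of_nat (m + p) - c) (form_comp f m)" if f: "f \<in> laplacian_domain p" for f :: "'n form" and m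
  proof -
    have "entire_form f" "entire_form (laplacian p f)"
      using laplacian_domain_fock[OF f] laplacian_fock[OF f] by (auto simp: fock_forms_iff fock_form_entire)
    then show ?thesis
      by (simp add: form_comp_diff form_comp_scale entire_form_scale form_comp_laplacian[OF f] form.scale_left_diff_distrib)
  qed
  have ent: "entire_form f" if "f \<in> fock_forms p" for f :: "'n form"
    using that by (simp add: fock_forms_iff fock_form_entire)
  have inj: "inj_on ?T (laplacian_domain p)"
  proof (rule inj_onI)
    fix f g :: "'n form" assume fg: "f \<in> laplacian_domain p" "g \<in> laplacian_domain p" "?T f = ?T g"
    show "f = g"
    proof (rule entire_form_eqI[OF ent[OF laplacian_domain_fock[OF fg(1)]] ent[OF laplacian_domain_fock[OF fg(2)]]])
      fix m
      have "form_scale (of_nat (m + p) - c) (form_comp f m) = form_scale (of_nat (m + p) - c) (form_comp g m)"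
        using comp[OF fg(1)] comp[OF fg(2)] fg(3) by metis
      then show "form_comp f m = form_comp g m" using nz[of m] by (simp add: form.scale_cancel_left del: of_nat_add)
    qed
  qed
  have surj: "\<exists>f\<in>laplacian_domain p. ?T f = g" if g: "g \<in> fock_forms p" for g :: "'n form"
  proof -
    define a where "a = (\<lambda>m. 1 / (of_nat (m + p) - c))"
    have aA: "(1 + real (m + p)) * cmod (a m) \<le> A" for m
      using A(2)[of m] nz[of m] by (simp add: a_def norm_divide pos_divide_le_eq del: of_nat_add)
    have aA1: "cmod (a m) \<le> A" for m
      using aA[of m] mult_right_mono[of 1 "1 + real (m + p)" "cmod (a m)"] by (simp del: of_nat_add)
    have aA2: "real (m + p) * cmod (a m) \<le> A" for m
      using aA[of m] by (simp add: distrib_right del: of_nat_add) (smt (verit) norm_ge_zero)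
    \<comment> \<open>The preimage is first a pointwise series; that it is entire, square integrable
      and in the domain is established in this order.\<close>
    define f :: "'n form" where "f = (\<lambda>J z. \<Sum>m. a m * hom_comp (g J) m z)"
    have gJ: "entire (g J)" for J using ent[OF g] by (simp add: entire_form_def)
    have E: "expands (f J) (\<lambda>m z. a m * hom_comp (g J) m z)" for J
      unfolding f_def by (rule expands_multiplier[OF expands_hom_comp[OF gJ] aA1])
    have ef: "entire_form f" unfolding entire_form_def using expands_imp_entire[OF E] by blast
    have fm: "form_comp f m = form_scale (a m) (form_comp g m)" for m
      unfolding form_comp_def form_scale_def expands_imp_hom_comp[OF E] by simp
    have df: "form_degree p f"
      unfolding form_degree_def
    proof (intro allI impI)
      fix J :: "'n set" assume "card J \<noteq> p"
      then have "g J = (\<lambda>z. 0)" using g by (simp add: fock_forms_iff form_degree_def zero_fun_def)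
      then have "hom_comp (g J) m = (\<lambda>z. 0)" for m by (simp only: hom_comp_zero)
      then show "f J = 0" by (simp add: f_def fun_eq_iff)
    qed
    \<comment> \<open>This one convergent series dominates both the component norms of
      \<open>f\<close> and the same norms with the weight \<open>real (m + p) ^ 2\<close>.\<close>
    have sg: "summable (\<lambda>m. A\<^sup>2 * (form_norm (form_comp g m))\<^sup>2)"
      using form_norm_sums[of g] g by (intro summable_mult) (auto simp: fock_forms_iff sums_iff)
    have "fock_form f"
    proof (rule fock_form_summableI[OF ef], rule summable_comparison_test'[OF sg])
      fix m
      show "norm ((form_norm (form_comp f m))\<^sup>2) \<le> A\<^sup>2 * (form_norm (form_comp g m))\<^sup>2"
        unfolding fm form_norm_scale_square using power_mono[OF aA1[of m], of 2]
        by (simp add: mult_right_mono)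
    qed
    then have ff: "f \<in> fock_forms p" using df by (simp add: fock_forms_iff)
    have fd: "f \<in> laplacian_domain p"
    proof (rule laplacian_domainI[OF ff], rule summable_comparison_test'[OF sg])
      fix m
      have "(real (m + p) * cmod (a m))\<^sup>2 * (form_norm (form_comp g m))\<^sup>2 \<le> A\<^sup>2 * (form_norm (form_comp g m))\<^sup>2"
        by (intro mult_right_mono power_mono aA2) auto
      then show "norm (real (m + p) ^ 2 * (form_norm (form_comp f m))\<^sup>2) \<le> A\<^sup>2 * (form_norm (form_comp g m))\<^sup>2"
        unfolding fm form_norm_scale_square by (simp add: power_mult_distrib mult.assoc del: of_nat_add)
    qed
    moreover have "?T f = g"
    proof (rule entire_form_eqI[OF ent[OF mem[OF fd]] ent[OF g]])
      fix m show "form_comp (?T f) m = form_comp g m"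
        unfolding comp[OF fd] fm using nz[of m] by (simp add: a_def del: of_nat_add)
    qed
    ultimately show ?thesis by blast
  qed
  have bound: "form_norm f \<le> A * form_norm (?T f)" if f: "f \<in> laplacian_domain p" for f :: "'n form"
  proof (rule power2_le_imp_le)
    have "(form_norm f)\<^sup>2 \<le> A\<^sup>2 * (form_norm (?T f))\<^sup>2"
    proof (rule sums_le)
      show "(\<lambda>m. (form_norm (form_comp f m))\<^sup>2) sums (form_norm f)\<^sup>2"
        using laplacian_domain_fock[OF f] by (intro form_norm_sums) (simp add: fock_forms_iff)
      show "(\<lambda>m. A\<^sup>2 * (form_norm (form_comp (?T f) m))\<^sup>2) sums (A\<^sup>2 * (form_norm (?T f))\<^sup>2)"
        using mem[OF f] by (intro sums_mult form_norm_sums) (simp add: fock_forms_iff)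
      fix m
      have "1 \<le> A * cmod (of_nat (m + p) - c)" using A(2)[of m] by simp
      then have "1 \<le> (A * cmod (of_nat (m + p) - c))\<^sup>2" by (rule one_le_power)
      then have "1 * (form_norm (form_comp f m))\<^sup>2 \<le> (A * cmod (of_nat (m + p) - c))\<^sup>2 * (form_norm (form_comp f m))\<^sup>2"
        by (rule mult_right_mono) simp
      then show "(form_norm (form_comp f m))\<^sup>2 \<le> A\<^sup>2 * (form_norm (form_comp (?T f) m))\<^sup>2"
        unfolding comp[OF f] form_norm_scale_square by (simp add: power_mult_distrib mult.assoc del: of_nat_add)
    qed
    then show "(form_norm f)\<^sup>2 \<le> (A * form_norm (?T f))\<^sup>2" by (simp add: power_mult_distrib)
  qed (simp add: A(1))
  have "bij_betw ?T (laplacian_domain p) (fock_forms p)"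
    unfolding bij_betw_def using inj mem surj by blast
  then show ?thesis unfolding resolvent_set_def using bound by blast
qed

section \<open>Dimension of the eigenspaces\<close>

text \<open>Reading the exponents along an enumeration of the coordinates identifies them with the
  lists of \<open>CARD('n)\<close> naturals with sum \<open>m\<close>, which are counted by stars
  and bars.\<close>

lemma card_multidegs:
  "card (multidegs m :: ('n::finite \<Rightarrow> nat) set) = (CARD('n) + m - 1) choose (CARD('n) - 1)"
proof -
  let ?n = "CARD('n)"
  obtain xs :: "'n list" where xs: "set xs = UNIV" "distinct xs"
    using finite_distinct_list[OF finite[of UNIV]] by blast
  have len: "length xs = ?n" using distinct_card[OF xs(2)] xs(1) by simp
  have "bij_betw (\<lambda>a. map a xs) (multidegs m) {l :: nat list. length l = ?n \<and> sum_list l = m}"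
    unfolding bij_betw_def
  proof (intro conjI equalityI subsetI)
    show "inj_on (\<lambda>a. map a xs) (multidegs m)"
      using xs(1) by (intro inj_onI ext) (simp add: map_eq_conv)
    fix l assume "l \<in> (\<lambda>a. map a xs) ` multidegs m"
    then show "l \<in> {l. length l = ?n \<and> sum_list l = m}"
      using xs len by (auto simp: multidegs_def sum_list_distinct_conv_sum_set)
  next
    fix l :: "nat list" assume l: "l \<in> {l. length l = ?n \<and> sum_list l = m}"
    define a where "a = (\<lambda>x. l ! inv_into {..<?n} (nth xs) x)"
    have "inj_on (nth xs) {..<?n}" using xs(2) len by (auto simp: inj_on_def nth_eq_iff_index_eq)
    then have map: "map a xs = l"
      using l len by (intro nth_equalityI) (auto simp: a_def inv_into_f_f)
    have "a \<in> multidegs m"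
      using sum_list_distinct_conv_sum_set[OF xs(2), of a] l xs(1) unfolding map by (simp add: multidegs_def)
    then show "l \<in> (\<lambda>a. map a xs) ` multidegs m" using map by blast
  qed
  then have "card (multidegs m :: ('n \<Rightarrow> nat) set) = (m + ?n - 1) choose m"
    using card_length_sum_list[of ?n m] by (simp add: bij_betw_same_card)
  also have "\<dots> = (?n + m - 1) choose (?n - 1)"
  proof -
    \<comment> \<open>There is at least one coordinate, so the truncated subtractions are
      exact.\<close>
    have "0 < ?n" by simp
    then have "m \<le> ?n + m - 1" "?n + m - 1 - m = ?n - 1" by linarith+
    then show ?thesis using binomial_symmetric[of m "?n + m - 1"] by (simp only: add.commute)
  qed
  finally show ?thesis .
qed

text \<open>The rotation of a coordinate in which the exponents differ changes the sign of the integrand.\<close>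

lemma cmonom_orthogonal:
  fixes a b :: "'n::finite \<Rightarrow> nat"
  assumes "a \<noteq> b" shows "fock_inner (cmonom a) (cmonom b) = 0"
proof -
  obtain j where j: "a j \<noteq> b j" using assms by blast
  define \<theta> where "\<theta> = pi / (real (a j) - real (b j))"
  define c where "c = cis \<theta>"
  define T :: "complex^'n \<Rightarrow> complex^'n" where "T = (\<lambda>z. \<chi> i. if i = j then c * z $ i else z $ i)"
  have lin: "linear T" by (rule linearI) (auto simp: T_def vec_eq_iff algebra_simps)
  have nrm: "norm (T z) = norm z" for z
    unfolding norm_vec_def by (intro L2_set_cong) (auto simp: T_def c_def norm_mult)
  have mono: "cmonom d (T z) = c ^ d j * cmonom d z" for d z
    by (simp add: cmonom_def T_def prod.remove[of UNIV j] power_mult_distrib)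
  have "c ^ a j * cnj c ^ b j = cis (real (a j) * \<theta>) * cis (- (real (b j) * \<theta>))"
    by (simp add: c_def Complex.DeMoivre cis_cnj)
  also have "\<dots> = cis ((real (a j) - real (b j)) * \<theta>)" by (simp add: cis_mult algebra_simps)
  also have "\<dots> = -1" using j by (simp add: \<theta>_def)
  finally have c: "c ^ a j * cnj c ^ b j = -1" .
  have F: "(\<lambda>z. cmonom a z * cnj (cmonom b z) * of_real (exp (- (norm z)\<^sup>2))) \<in> borel_measurable borel"
    by (intro fock_integrand_measurable entire_measurable entire_cmonom)
  have "fock_inner (cmonom a) (cmonom b)
      = (LINT z|lborel. cmonom a (T z) * cnj (cmonom b (T z)) * of_real (exp (- (norm (T z))\<^sup>2)))"
    unfolding fock_inner_def using integral_linear_isometry[OF lin nrm F] by simp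
  also have "\<dots> = (LINT z|lborel. (c ^ a j * cnj c ^ b j) * (cmonom a z * cnj (cmonom b z) * of_real (exp (- (norm z)\<^sup>2))))"
    by (simp add: mono nrm mult_ac)
  also have "\<dots> = - fock_inner (cmonom a) (cmonom b)"
    unfolding c fock_inner_def by simp
  finally show ?thesis by (simp add: complex_eq_iff)
qed

lemma fock_inner_cmonom_self: "fock_inner (cmonom a) (cmonom a) \<noteq> 0"
proof
  assume "fock_inner (cmonom a) (cmonom a) = 0"
  then have "fock_norm (cmonom a) = 0" by (simp add: fock_inner_self)
  then have "cmonom a = (\<lambda>z. 0)"
    using fock_norm_eq_0 hom_polys_fock_space hom_polys_cmonom by blast
  then have "cmonom a (\<chi> i. 1) = 0" by simp
  then show False by (simp add: cmonom_def)
qed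

section \<open>A monomial basis of the eigenspaces\<close>

definition single_form :: "'n set \<Rightarrow> (complex^'n \<Rightarrow> complex) \<Rightarrow> 'n form" where
  "single_form J f = (\<lambda>K. if K = J then f else 0)"

lemma single_form_hom: "q \<in> hom_polys m \<Longrightarrow> hom_form m (single_form J q)"
  by (simp add: hom_form_def single_form_def zero_fun_def hom_polys_zero)

lemma single_form_degree: "card J = p \<Longrightarrow> form_degree p (single_form J q)"
  by (simp add: form_degree_def single_form_def)

lemma form_inner_single_form:
  "form_inner (single_form J f) (single_form K g) = (if J = K then fock_inner f g else 0)"
proof -
  have "form_inner (single_form J f) (single_form K g) = (\<Sum>I\<in>UNIV. if I = J then (if J = K then fock_inner f g else 0) else 0)"
    unfolding form_inner_def by (intro sum.cong) (auto simp: single_form_def zero_fun_def)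
  then show ?thesis by simp
qed

definition eigenbasis :: "nat \<Rightarrow> nat \<Rightarrow> 'n::finite form set" where
  "eigenbasis p m = (\<lambda>(J, a). single_form J (cmonom a)) ` ({J. card J = p} \<times> multidegs m)"

text \<open>Besides orthogonality this shows that distinct index pairs give distinct nonzero forms,
  so the basis can be counted by its index pairs.\<close>

lemma form_inner_eigenbasis:
  "form_inner (single_form J (cmonom a)) (single_form K (cmonom b)) \<noteq> 0 \<longleftrightarrow> J = K \<and> a = b"
  using cmonom_orthogonal[of a b] fock_inner_cmonom_self[of a] by (auto simp: form_inner_single_form)

lemma card_eigenbasis:
  "card (eigenbasis p m :: 'n::finite form set) = ((CARD('n) + m - 1) choose (CARD('n) - 1)) * (CARD('n) choose p)"
proof -
  have "inj_on (\<lambda>(J, a). single_form J (cmonom a)) ({J :: 'n set. card J = p} \<times> multidegs m)"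
  proof (rule inj_onI, clarify)
    fix J K :: "'n set" and a b
    assume "single_form J (cmonom a) = single_form K (cmonom b)"
    then show "J = K \<and> a = b" using form_inner_eigenbasis[of J a J a] form_inner_eigenbasis[of J a K b] by simp
  qed
  then show ?thesis
    unfolding eigenbasis_def using n_subsets[of "UNIV :: 'n set" p]
    by (simp add: card_image card_cartesian_product card_multidegs mult.commute)
qed

lemma finite_eigenbasis: "finite (eigenbasis p m :: 'n::finite form set)"
  unfolding eigenbasis_def by (intro finite_imageI finite_cartesian_product finite_multidegs) simp

lemma form_inner_sum_left:
  assumes "\<And>v. v \<in> B \<Longrightarrow> fock_form v" "fock_form w"
  shows "form_inner (\<Sum>v\<in>B. form_scale (u v) v) w = (\<Sum>v\<in>B. u v * form_inner v w)"
proof -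
  have "fock_form (\<Sum>v\<in>B. form_scale (u v) v) \<and>
      form_inner (\<Sum>v\<in>B. form_scale (u v) v) w = (\<Sum>v\<in>B. u v * form_inner v w)"
    using assms(1)
  proof (induction B rule: infinite_finite_induct)
    case (insert v B)
    have eq: "(\<Sum>v\<in>insert v B. form_scale (u v) v) = form_scale (u v) v + (\<Sum>v\<in>B. form_scale (u v) v)"
      using insert(1,2) by (rule sum.insert)
    have F: "fock_form (form_scale (u v) v)" "fock_form (\<Sum>v\<in>B. form_scale (u v) v)"
      using insert by (auto intro: fock_form_scale)
    show ?case
      unfolding eq form_inner_add_left[OF F assms(2)] form_inner_scale_left sum.insert[OF insert(1,2)]
      using insert F by (simp only: fock_form_add) simp
  qed (use fock_forms_zero[of 0] in \<open>auto simp: fock_forms_iff\<close>)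
  then show ?thesis ..
qed

lemma eigenbasis_subset: "eigenbasis p m \<subseteq> {f. hom_form m f \<and> form_degree p f}"
  unfolding eigenbasis_def multidegs_def
  by (auto intro: single_form_hom hom_polys_cmonom single_form_degree)

lemma eigenbasis_orthogonal:
  assumes "v \<in> eigenbasis p m" "w \<in> eigenbasis p m"
  shows "form_inner v w \<noteq> 0 \<longleftrightarrow> v = w"
proof -
  obtain J a where v: "v = single_form J (cmonom a)" using assms(1) by (auto simp: eigenbasis_def)
  obtain K b where w: "w = single_form K (cmonom b)" using assms(2) by (auto simp: eigenbasis_def)
  show ?thesis
  proof
    assume "v = w"
    then show "form_inner v w \<noteq> 0" using form_inner_eigenbasis[of J a J a] v by simp
  next
    assume "form_inner v w \<noteq> 0"
    then show "v = w" using form_inner_eigenbasis[of J a K b] v w by simp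
  qed
qed

text \<open>Pairing a vanishing linear combination with one basis form isolates its coefficient, by
  orthogonality.\<close>

lemma independent_eigenbasis: "form.independent (eigenbasis p m)"
  unfolding form.dependent_finite[OF finite_eigenbasis]
proof (rule notI, elim exE conjE bexE)
  fix u w assume w: "w \<in> eigenbasis p m" "u w \<noteq> 0" and s: "(\<Sum>v\<in>eigenbasis p m. form_scale (u v) v) = 0"
  have F: "fock_form v" if "v \<in> eigenbasis p m" for v
    using that eigenbasis_subset hom_form_fock_form by blast
  have "form_inner v w = (if v = w then form_inner w w else 0)" if "v \<in> eigenbasis p m" for v
    using eigenbasis_orthogonal[OF that w(1)] by auto
  then have "(\<Sum>v\<in>eigenbasis p m. u v * form_inner v w) = (\<Sum>v\<in>eigenbasis p m. if v = w then u w * form_inner w w else 0)"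
    by (intro sum.cong) auto
  also have "\<dots> = u w * form_inner w w" using w(1) by (simp add: sum.delta[OF finite_eigenbasis])
  finally have "u w * form_inner w w = 0"
    using form_inner_sum_left[of "eigenbasis p m" w u, OF F F[OF w(1)]] by (simp add: s)
  then show False using w eigenbasis_orthogonal[OF w(1) w(1)] by simp
qed

lemma span_eigenbasis: "{f. hom_form m f \<and> form_degree p f} \<subseteq> form.span (eigenbasis p m)"
proof
  fix f :: "'a form" assume "f \<in> {f. hom_form m f \<and> form_degree p f}"
  then have h: "\<And>J. f J \<in> hom_polys m" and d: "\<And>J. card J \<noteq> p \<Longrightarrow> f J = 0"
    by (auto simp: hom_form_def form_degree_def)
  have single: "single_form J q \<in> form.span (eigenbasis p m)" if "q \<in> hom_polys m" "card J = p" for J :: "'a set" and q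
    using that(1)
  proof (induction rule: hom_polys_induct)
    case zero
    have "single_form J (\<lambda>z. 0) = 0" by (simp add: single_form_def fun_eq_iff)
    then show ?case by (simp only: form.span_zero)
  next
    case (step c a r)
    have "single_form J (cmonom a) \<in> eigenbasis p m"
      using step(1) that(2) by (auto simp: eigenbasis_def multidegs_def)
    then have "form_scale c (single_form J (cmonom a)) + single_form J r \<in> form.span (eigenbasis p m)"
      by (intro form.span_add form.span_scale form.span_base step(3))
    moreover have "single_form J (\<lambda>z. c * cmonom a z + r z) = form_scale c (single_form J (cmonom a)) + single_form J r"
      by (simp add: single_form_def form_scale_def fun_eq_iff)
    ultimately show ?case by (simp only:)
  qed
  have "f = (\<Sum>J\<in>{J. card J = p}. single_form J (f J))"
  proof
    fix K
    have "(\<Sum>J\<in>{J. card J = p}. single_form J (f J)) K = (\<Sum>J\<in>{J. card J = p}. single_form J (f J) K)"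
      by (rule sum_fun_apply)
    also have "\<dots> = (\<Sum>J\<in>{J. card J = p}. if J = K then f J else 0)"
      by (intro sum.cong) (auto simp: single_form_def)
    also have "\<dots> = (if K \<in> {J. card J = p} then f K else 0)"
      by (rule sum.delta) simp
    also have "\<dots> = f K" using d[of K] by simp
    finally show "f K = (\<Sum>J\<in>{J. card J = p}. single_form J (f J)) K" ..
  qed
  moreover have "(\<Sum>J\<in>{J. card J = p}. single_form J (f J)) \<in> form.span (eigenbasis p m)"
    by (intro form.span_sum single h) simp
  ultimately show "f \<in> form.span (eigenbasis p m)" by (rule ssubst[where P = "\<lambda>h. h \<in> form.span (eigenbasis p m)"])
qed

lemma multiplicity_laplacian:
  "multiplicity_of (laplacian_domain p :: 'n::{finite,linorder} form set) (laplacian p) (of_nat (m + p))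
    = ((CARD('n) + m - 1) choose (CARD('n) - 1)) * (CARD('n) choose p)"
  unfolding multiplicity_of_def eigenspace_laplacian
  by (rule form.dim_unique[OF eigenbasis_subset span_eigenbasis independent_eigenbasis card_eigenbasis])

text \<open>Since \<open>p \<le> CARD('n)\<close>, there is an index set with \<open>p\<close>
  elements, hence a nonzero eigenform; the shifted operator is then not injective.\<close>

lemma shifted_nat_notin_resolvent:
  assumes "p \<le> CARD('n::{finite,linorder})"
  shows "of_nat (m + p) \<notin> resolvent_set (fock_forms p :: 'n form set) (laplacian_domain p) (laplacian p)"
proof
  let ?T = "\<lambda>f :: 'n form. laplacian p f - form_scale (of_nat (m + p)) f"
  assume "of_nat (m + p) \<in> resolvent_set (fock_forms p :: 'n form set) (laplacian_domain p) (laplacian p)"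
  then have inj: "inj_on ?T (laplacian_domain p)" by (auto simp: resolvent_set_def bij_betw_def)
  obtain J :: "'n set" where J: "card J = p"
    using obtain_subset_with_card_n[OF assms] by blast
  \<comment> \<open>The whole degree is placed on one arbitrarily chosen coordinate.\<close>
  define a where "a = (\<lambda>i :: 'n. if i = (SOME i. True) then m else 0)"
  have "sum a UNIV = m" by (simp add: a_def)
  then have e: "single_form J (cmonom a) \<in> eigenbasis p m" using J by (auto simp: eigenbasis_def multidegs_def)
  have E: "f \<in> laplacian_domain p \<and> ?T f = 0" if "hom_form m f" "form_degree p f" for f
    using that eigenspace_laplacian[of p m] by (auto simp: eigenspace_def)
  have "hom_form m (0 :: 'n form)" using hom_polys_zero by (simp add: hom_form_def zero_fun_def)
  then have "single_form J (cmonom a) = 0"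
    using inj_onD[OF inj, of "single_form J (cmonom a)" 0] E[of "single_form J (cmonom a)"] E[of 0]
      eigenbasis_subset[of p m] e by auto
  then show False using form_inner_eigenbasis[of J a J a] by simp
qed

theorem theorem4p8:
  fixes p :: nat
  assumes "p \<le> CARD('n::{finite,linorder})"
  shows "op_spectrum (fock_forms p :: 'n form set) (laplacian_domain p) (laplacian p)
           = {of_nat (m + p) | m :: nat. True}
       \<and> (\<forall>m :: nat. multiplicity_of (laplacian_domain p :: 'n form set) (laplacian p) (of_nat (m + p))
           = ((CARD('n) + m - 1) choose (CARD('n) - 1)) * (CARD('n) choose p))"
proof
  show "op_spectrum (fock_forms p :: 'n form set) (laplacian_domain p) (laplacian p) = {of_nat (m + p) | m :: nat. True}"
    unfolding op_spectrum_def using laplacian_resolvent shifted_nat_notin_resolvent[OF assms] by blast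
  show "\<forall>m :: nat. multiplicity_of (laplacian_domain p :: 'n form set) (laplacian p) (of_nat (m + p))
           = ((CARD('n) + m - 1) choose (CARD('n) - 1)) * (CARD('n) choose p)"
    using multiplicity_laplacian by blast
qed

end
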